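(* Let $\mathcal T$ be a triangulation of $\Omega$ satisfying the basic triangulation assumptions, with $\mathcal N=\mathcal N_{\rm ani}\cup\mathcal N_{\rm reg}$. Then there is a constant $C$ (depending only on $\Omega$ and the fixed constants in the mesh assumptions, but not on the diameters and aspect ratios of the elements of $\mathcal T$) such that for any node $z\in\mathcal N$, any function $v\in W^1_1(\omega_z)$ and any edge $S\subset\gamma_z$, $$\|v\phi_z\|_{1;S}\le C\Bigl(\|\nabla v\|_{1;\omega_z}+\kappa_{z,S}\,\|v\|_{1;\omega_z}\Bigr)$$ and $$|S|^{-1}\|v\phi_z\|_{1;S}^2\le C\Bigl(\|v\|_{2;\omega_z}\|\nabla v\|_{2;\omega_z}+\kappa_{z,S}\,\|v\|_{2;\omega_z}^2\Bigr),$$ where $\kappa_{z,S}=H_z^{-1}$ if $S\subset\mathring\gamma_z$ and $\kappa_{z,S}=h_z^{-1}$ if $S\subset\gamma_z\setminus\mathring\gamma_z$, and $\phi_z$ is the hat basis function associated with $z$.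
   Context: **Notation.** $a\lesssim b$ means $a\le Cb$ with a generic constant $C$ that does not depend on the diameters and aspect ratios of the elements of $\mathcal T$; $a\sim b$ means $a\lesssim b$ and $b\lesssim a$. In the mesh assumptions below, all constants hidden in $\lesssim,\sim$ are fixed in advance. $\|\cdot\|_{p;\mathcal D}$ is the $L_p(\mathcal D)$ norm (on an edge, of the trace, with respect to arc length); the right-hand side of the second bound is understood as $+\infty$ if it is not finite. **Mesh.** $\Omega\subset\mathbb R^2$ is a (possibly non-Lipschitz) polygonal domain, $\mathcal T$ is a triangulation of $\Omega$, and $\mathcal N$ and $\mathcal S$ are its sets of nodes and edges. For $T\in\mathcal T$, $H_T$ is the maximum edge length and $h_T:=2H_T^{-1}|T|$ the minimum height of $T$. For $z\in\mathcal N$: $\omega_z$ is the patch of elements surrounding $z$ (having $z$ as a vertex), $\mathcal S_z$ is the set of edges originating at $z$, $H_z:=\operatorname{diam}(\omega_z)$, $h_z:=H_z^{-1}|\omega_z|$, $\gamma_z:=\mathcal S_z\setminus\partial\Omega$ (the edges at $z$ in the interior of $\omega_z$), and $\mathring\gamma_z:=\{S\subset\gamma_z:|S|\lesssim h_z\}$. $\phi_z$ is the continuous function, linear on each element, equal to $1$ at $z$ and $0$ at all other nodes. **Basic triangulation assumptions.** (1) Maximum Angle condition: the maximum interior angle in any $T\in\mathcal T$ is uniformly bounded by some positive $\alpha_0<\pi$. (2) Local Element Orientation condition: for any $z\in\mathcal N$ there is a rectangle $R_z\supset\omega_z$ with $|R_z|\sim|\omega_z|$; furthermore, if $z\in\mathcal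 N\cap\partial\Omega$ is not a corner of $\Omega$, then $R_z$ has a side parallel to the segment $\mathcal S_z\cap\partial\Omega$. (3) The number of triangles containing any node is uniformly bounded. **Node types.** With a fixed small constant $c_0$, write $a\ll b$ for $a<c_0b$. $\mathcal N_{\rm ani}$ (anisotropic nodes) is the set of $z\in\mathcal N$ such that $h_z\ll H_z$ and, for all $T\subset\omega_z$, $h_T\sim h_z$ and $H_T\sim H_z$. $\mathcal N_{\rm reg}$ (regular nodes) is the set of nodes surrounded by shape-regular mesh elements (i.e. $h_T\sim H_T$ for all $T\subset\omega_z$).
   Formalization: At a boundary point where the domain is not Lipschitz, a node is taken per sector of triangles joined through edges not on the boundary, and the patch is that sector; with all triangles at the point lumped in one patch the bounds can fail where the domain touches itself. *)

theory Defs
  imports "HOL-Analysis.Analysis"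
begin

section \<open>Lebesgue and Sobolev spaces\<close>

definition in_Lp :: "real \<Rightarrow> 'a::euclidean_space set \<Rightarrow> ('a \<Rightarrow> 'b::euclidean_space) \<Rightarrow> bool" where
  "in_Lp p D f \<longleftrightarrow>
     set_borel_measurable lborel D f \<and> set_integrable lborel D (\<lambda>x. norm (f x) powr p)"

text \<open>The value is meaningful only under \<^const>\<open>in_Lp\<close>: a Bochner integral that does not
  exist is \<open>0\<close>.\<close>

definition Lp_norm :: "real \<Rightarrow> 'a::euclidean_space set \<Rightarrow> ('a \<Rightarrow> 'b::euclidean_space) \<Rightarrow> real" where
  "Lp_norm p D f = (LINT x:D|lborel. norm (f x) powr p) powr (1 / p)"

text \<open>\<open>C\<^sup>\<infinity>\<close> on an open set: \<open>D hs\<close> is the iterated directional derivative of \<open>f\<close> in the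
  directions listed in \<open>hs\<close>.\<close>

definition smooth_on :: "'a::euclidean_space set \<Rightarrow> ('a \<Rightarrow> real) \<Rightarrow> bool" where
  "smooth_on U f \<longleftrightarrow>
     (\<exists>D :: 'a list \<Rightarrow> 'a \<Rightarrow> real.
        (\<forall>x\<in>U. D [] x = f x) \<and>
        (\<forall>hs. \<forall>x\<in>U. (D hs has_derivative (\<lambda>h. D (h # hs) x)) (at x)))"

definition test_function :: "'a::euclidean_space set \<Rightarrow> ('a \<Rightarrow> real) \<Rightarrow> bool" where
  "test_function U \<psi> \<longleftrightarrow>
     smooth_on UNIV \<psi> \<and> compact (closure {x. \<psi> x \<noteq> 0}) \<and> closure {x. \<psi> x \<noteq> 0} \<subseteq> U"

text \<open>\<open>v \<in> W\<^sup>1\<^sub>1(U)\<close> with weak gradient \<open>G\<close>, for \<open>U\<close> open.\<close>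

definition W11 :: "'a::euclidean_space set \<Rightarrow> ('a \<Rightarrow> real) \<Rightarrow> ('a \<Rightarrow> 'a) \<Rightarrow> bool" where
  "W11 U v G \<longleftrightarrow>
     in_Lp 1 U v \<and> in_Lp 1 U G \<and>
     (\<forall>\<psi> D\<psi>. test_function U \<psi> \<longrightarrow> (\<forall>x. GDERIV \<psi> x :> D\<psi> x) \<longrightarrow>
        (LINT x:U|lborel. v x *\<^sub>R D\<psi> x) = - (LINT x:U|lborel. \<psi> x *\<^sub>R G x))"

text \<open>Functions on the edge from \<open>a\<close> to \<open>b\<close>, with respect to arc length. The end points, which are
  irrelevant for the integrals, are left out: they may lie outside the open set in which the open
  edge is contained.\<close>

definition edge_pullback :: "'a::euclidean_space \<Rightarrow> 'a \<Rightarrow> ('a \<Rightarrow> real) \<Rightarrow> real \<Rightarrow> real" where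
  "edge_pullback a b f = (\<lambda>t. f (a + t *\<^sub>R (b - a)))"

definition edge_L1_norm :: "'a::euclidean_space \<Rightarrow> 'a \<Rightarrow> ('a \<Rightarrow> real) \<Rightarrow> real" where
  "edge_L1_norm a b f = dist a b * (LINT t:{0<..<1}|lborel. \<bar>edge_pullback a b f t\<bar>)"

text \<open>\<open>g\<close> is the trace on the edge from \<open>a\<close> to \<open>b\<close>, which lies inside the open set \<open>U\<close>, of the
  function \<open>v \<in> W\<^sup>1\<^sub>1(U)\<close> with weak gradient \<open>G\<close>. The trace operator is the extension by continuity
  of the restriction of functions in \<open>C\<^sup>\<infinity>(U) \<inter> W\<^sup>1\<^sub>1(U)\<close>, a dense subspace of \<open>W\<^sup>1\<^sub>1(U)\<close>.\<close>

definition trace_on_edge ::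
  "'a::euclidean_space set \<Rightarrow> ('a \<Rightarrow> real) \<Rightarrow> ('a \<Rightarrow> 'a) \<Rightarrow> 'a \<Rightarrow> 'a \<Rightarrow> ('a \<Rightarrow> real) \<Rightarrow> bool" where
  "trace_on_edge U v G a b g \<longleftrightarrow>
     in_Lp 1 {0<..<1} (edge_pullback a b g) \<and>
     (\<exists>u Du.
        (\<forall>n::nat. smooth_on U (u n) \<and> (\<forall>x\<in>U. GDERIV (u n) x :> Du n x) \<and>
           in_Lp 1 U (u n) \<and> in_Lp 1 U (Du n) \<and>
           in_Lp 1 {0<..<1} (edge_pullback a b (u n))) \<and>
        (\<lambda>n. Lp_norm 1 U (\<lambda>x. u n x - v x)) \<longlonglongrightarrow> 0 \<and>
        (\<lambda>n. Lp_norm 1 U (\<lambda>x. Du n x - G x)) \<longlonglongrightarrow> 0 \<and>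
        (\<lambda>n. edge_L1_norm a b (\<lambda>x. u n x - g x)) \<longlonglongrightarrow> 0)"

section \<open>Polygonal domains and triangulations\<close>

type_synonym point = "real ^ 2"
type_synonym triangle = "point set" \<comment> \<open>the set of the three vertices\<close>

text \<open>No Lipschitz condition: the domain may lie on both sides of its boundary (slits), and may
  touch itself at boundary points.\<close>

definition polygonal_domain :: "point set \<Rightarrow> bool" where
  "polygonal_domain \<Omega> \<longleftrightarrow>
     open \<Omega> \<and> connected \<Omega> \<and> bounded \<Omega> \<and> \<Omega> \<noteq> {} \<and>
     (\<exists>E. finite E \<and> (\<forall>(a, b)\<in>E. a \<noteq> b) \<and> frontier \<Omega> = (\<Union>(a, b)\<in>E. closed_segment a b))"

text \<open>A boundary point is not a corner if the boundary is straight near it.\<close>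

definition corner :: "point set \<Rightarrow> point \<Rightarrow> bool" where
  "corner \<Omega> p \<longleftrightarrow> p \<in> frontier \<Omega> \<and>
     \<not> (\<exists>r>0. \<exists>d. d \<noteq> 0 \<and> frontier \<Omega> \<inter> ball p r = range (\<lambda>s::real. p + s *\<^sub>R d) \<inter> ball p r)"

text \<open>Conformity is required inside \<open>\<Omega>\<close>, so that the triangles on the two sides of a slit do not
  have to match. The last clause says that the edges resolve the boundary.\<close>

definition polygon_triangulation :: "point set \<Rightarrow> triangle set \<Rightarrow> bool" where
  "polygon_triangulation \<Omega> \<T> \<longleftrightarrow>
     finite \<T> \<and>
     (\<forall>T\<in>\<T>. card T = 3 \<and> \<not> affine_dependent T \<and> interior (convex hull T) \<subseteq> \<Omega>) \<and>
     (\<Union>T\<in>\<T>. convex hull T) = closure \<Omega> \<and>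
     (\<forall>T\<in>\<T>. \<forall>T'\<in>\<T>. T \<noteq> T' \<longrightarrow>
        convex hull T \<inter> convex hull T' \<inter> \<Omega> = convex hull (T \<inter> T') \<inter> \<Omega>) \<and>
     (\<forall>T\<in>\<T>. \<forall>a\<in>T. \<forall>b\<in>T. a \<noteq> b \<longrightarrow>
        open_segment a b \<subseteq> \<Omega> \<or> closed_segment a b \<subseteq> frontier \<Omega>)"

definition area :: "point set \<Rightarrow> real" where
  "area A = measure lborel A"

definition H_tri :: "triangle \<Rightarrow> real" where
  "H_tri T = Max {dist a b | a b. a \<in> T \<and> b \<in> T}"

definition h_tri :: "triangle \<Rightarrow> real" where
  "h_tri T = 2 * area (convex hull T) / H_tri T"

definition tri_angle :: "point \<Rightarrow> point \<Rightarrow> point \<Rightarrow> real" where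
  "tri_angle a b c = arccos (((b - a) \<bullet> (c - a)) / (norm (b - a) * norm (c - a)))"

section \<open>Nodes\<close>

text \<open>A vertex \<open>p\<close> in the interior of \<open>\<Omega>\<close>, or at which \<open>\<Omega>\<close> is locally Lipschitz, is one node, whose
  patch consists of all triangles having \<open>p\<close> as a vertex. In a non-Lipschitz domain the triangles
  at a boundary point \<open>p\<close> may form several sectors separated by the boundary (the two sides of a
  slit, the parts of \<open>\<Omega>\<close> touching each other at \<open>p\<close>). As usual for functions that are continuous in
  \<open>\<Omega>\<close>, but not necessarily across a slit, \<open>p\<close> then carries one node per sector. Hence a node is a
  pair of its position and the set of its surrounding triangles.\<close>

type_synonym node = "point \<times> triangle set"

definition adjacent_at :: "point set \<Rightarrow> triangle set \<Rightarrow> point \<Rightarrow> (triangle \<times> triangle) set" where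
  "adjacent_at \<Omega> \<T> p = {(T, T'). T \<in> \<T> \<and> T' \<in> \<T> \<and>
     (\<exists>q. q \<noteq> p \<and> {p, q} \<subseteq> T \<inter> T' \<and> \<not> closed_segment p q \<subseteq> frontier \<Omega>)}"

definition node_of :: "point set \<Rightarrow> triangle set \<Rightarrow> triangle \<Rightarrow> point \<Rightarrow> node" where
  "node_of \<Omega> \<T> T p = (p, (adjacent_at \<Omega> \<T> p)\<^sup>* `` {T})"

definition nodes :: "point set \<Rightarrow> triangle set \<Rightarrow> node set" where
  "nodes \<Omega> \<T> = {node_of \<Omega> \<T> T p | T p. T \<in> \<T> \<and> p \<in> T}"

abbreviation pos :: "node \<Rightarrow> point" where "pos z \<equiv> fst z"
abbreviation elements :: "node \<Rightarrow> triangle set" where "elements z \<equiv> snd z"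

definition patch :: "node \<Rightarrow> point set" where
  "patch z = (\<Union>T\<in>elements z. convex hull T)"

text \<open>The patch as an open set, the domain of the Sobolev functions. Intersecting with \<open>\<Omega>\<close> removes
  the slits.\<close>

definition open_patch :: "point set \<Rightarrow> node \<Rightarrow> point set" where
  "open_patch \<Omega> z = \<Omega> \<inter> interior (patch z)"

definition H_node :: "node \<Rightarrow> real" where
  "H_node z = diameter (patch z)"

definition h_node :: "node \<Rightarrow> real" where
  "h_node z = area (patch z) / H_node z"

text \<open>The edges originating at \<open>z\<close> are represented by their end points other than \<open>z\<close>.\<close>

definition edges_at :: "node \<Rightarrow> point set" where
  "edges_at z = \<Union>(elements z) - {pos z}"

definition boundary_edges :: "point set \<Rightarrow> node \<Rightarrow> point set" where
  "boundary_edges \<Omega> z = {q \<in> edges_at z. closed_segment (pos z) q \<subseteq> frontier \<Omega>}"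

definition gamma :: "point set \<Rightarrow> node \<Rightarrow> point set" where
  "gamma \<Omega> z = edges_at z - boundary_edges \<Omega> z"

definition gamma_ring :: "real \<Rightarrow> point set \<Rightarrow> node \<Rightarrow> point set" where
  "gamma_ring K \<Omega> z = {q \<in> gamma \<Omega> z. dist (pos z) q \<le> K * h_node z}"

definition kappa :: "real \<Rightarrow> point set \<Rightarrow> node \<Rightarrow> point \<Rightarrow> real" where
  "kappa K \<Omega> z q = (if q \<in> gamma_ring K \<Omega> z then 1 / H_node z else 1 / h_node z)"

text \<open>Since \<open>\<phi>\<close> need not be continuous up to a slit, the nodal values are those of its affine pieces.\<close>

definition hat_function :: "point set \<Rightarrow> triangle set \<Rightarrow> node \<Rightarrow> (point \<Rightarrow> real) \<Rightarrow> bool" where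
  "hat_function \<Omega> \<T> z \<phi> \<longleftrightarrow>
     continuous_on \<Omega> \<phi> \<and>
     (\<forall>T\<in>\<T>. \<exists>c d.
        (\<forall>x \<in> convex hull T \<inter> \<Omega>. \<phi> x = c + d \<bullet> x) \<and>
        (\<forall>q\<in>T. c + d \<bullet> q = (if node_of \<Omega> \<T> T q = z then 1 else 0)))"

section \<open>Mesh assumptions and node types\<close>

definition comparable :: "real \<Rightarrow> real \<Rightarrow> real \<Rightarrow> bool" where
  "comparable K a b \<longleftrightarrow> a \<le> K * b \<and> b \<le> K * a"

definition max_angle_condition :: "real \<Rightarrow> triangle set \<Rightarrow> bool" where
  "max_angle_condition \<alpha>\<^sub>0 \<T> \<longleftrightarrow>
     (\<forall>T\<in>\<T>. \<forall>a\<in>T. \<forall>b\<in>T. \<forall>c\<in>T. a \<noteq> b \<longrightarrow> a \<noteq> c \<longrightarrow> b \<noteq> c \<longrightarrow> tri_angle a b c \<le> \<alpha>\<^sub>0)"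

definition rectangle :: "point \<Rightarrow> point \<Rightarrow> point \<Rightarrow> real \<Rightarrow> real \<Rightarrow> point set" where
  "rectangle c e f l m = {c + s *\<^sub>R e + t *\<^sub>R f | s t. \<bar>s\<bar> \<le> l \<and> \<bar>t\<bar> \<le> m}"

definition local_orientation_condition :: "real \<Rightarrow> point set \<Rightarrow> triangle set \<Rightarrow> bool" where
  "local_orientation_condition K \<Omega> \<T> \<longleftrightarrow>
     (\<forall>z \<in> nodes \<Omega> \<T>. \<exists>c e f l m.
        norm e = 1 \<and> norm f = 1 \<and> e \<bullet> f = 0 \<and> 0 < l \<and> 0 < m \<and>
        patch z \<subseteq> rectangle c e f l m \<and>
        comparable K (area (rectangle c e f l m)) (area (patch z)) \<and>
        (pos z \<in> frontier \<Omega> \<and> \<not> corner \<Omega> (pos z) \<longrightarrow>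
          (\<exists>d\<in>{e, f}. \<forall>q \<in> boundary_edges \<Omega> z. \<exists>s. q - pos z = s *\<^sub>R d)))"

definition basic_triangulation_assumptions ::
  "real \<Rightarrow> real \<Rightarrow> nat \<Rightarrow> point set \<Rightarrow> triangle set \<Rightarrow> bool" where
  "basic_triangulation_assumptions \<alpha>\<^sub>0 K\<^sub>R m \<Omega> \<T> \<longleftrightarrow>
     max_angle_condition \<alpha>\<^sub>0 \<T> \<and>
     local_orientation_condition K\<^sub>R \<Omega> \<T> \<and>
     (\<forall>z \<in> nodes \<Omega> \<T>. card (elements z) \<le> m)"

definition anisotropic_nodes :: "real \<Rightarrow> real \<Rightarrow> point set \<Rightarrow> triangle set \<Rightarrow> node set" where
  "anisotropic_nodes c\<^sub>0 K \<Omega> \<T> = {z \<in> nodes \<Omega> \<T>. h_node z < c\<^sub>0 * H_node z \<and>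
     (\<forall>T \<in> elements z. comparable K (h_tri T) (h_node z) \<and> comparable K (H_tri T) (H_node z))}"

definition regular_nodes :: "real \<Rightarrow> point set \<Rightarrow> triangle set \<Rightarrow> node set" where
  "regular_nodes K \<Omega> \<T> = {z \<in> nodes \<Omega> \<T>. \<forall>T \<in> elements z. comparable K (h_tri T) (H_tri T)}"

end

theory Submission
  imports Defs
begin

text \<open>Let \<open>T\<close> be a triangle with vertices \<open>p\<close> (the node), \<open>q\<close>, \<open>r\<close>. Integrating \<open>\<partial>(v \<phi>)\<close> over \<open>T\<close>
  in the direction of \<open>pr\<close> only leaves the edge \<open>pq\<close>, because \<open>\<phi>\<close> vanishes on \<open>qr\<close>, and gives
  \<open>\<parallel>v \<phi>\<parallel>\<^bsub>1;pq\<^esub> \<le> (\<parallel>\<nabla>v\<parallel>\<^bsub>1;T\<^esub> + \<parallel>v\<parallel>\<^bsub>1;T\<^esub> / |pr|) / sin \<angle>p\<close>. This settles regular nodes and short edges of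
  anisotropic nodes. For a long edge \<open>\<angle>p\<close> may be small; then \<open>\<angle>q\<close> is not, by the maximum angle
  condition, and integration in the direction of \<open>qr\<close>, along which \<open>\<phi>\<close> is constant, bounds
  \<open>\<parallel>v \<phi>\<parallel>\<^bsub>1;pq\<^esub>\<close> by \<open>\<parallel>v \<phi>\<parallel>\<^bsub>1;pr\<^esub>\<close> and \<open>\<parallel>\<nabla>v\<parallel>\<^bsub>1;T\<^esub>\<close>. Passing from triangle to triangle around \<open>p\<close>, one reaches
  a triangle with a wide angle at \<open>p\<close>: if there were none, the patch would be a narrow cone at \<open>p\<close>
  whose two extreme edges lie in the boundary of the domain, but the boundary has finitely many
  directions. The second bound is the first one applied to \<open>v\<^sup>2\<close>, combined with the Cauchy-Schwarz
  inequality.\<close>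

section \<open>Integration over lines in a triangle\<close>

text \<open>Geometry and analysis meet in the locale \<open>edge_estimate\<close>, an inequality for
  all \<open>C1_on\<close> functions on the open patch. Such functions are uncontrolled at the
  boundary of the patch, which may contain the side opposite to the node; so lines stop short of
  that side, and inequalities are stated in \<open>ennreal\<close>, where nothing has to be
  integrable. The maximum angle condition bounds no single angle from below, so one narrow triangle
  alone gives nothing useful. Passing on to a neighbour costs only the gradient term and a factor;
  the term with \<open>v\<close>, and with it the weight \<open>1 / h_node z\<close>, arises once,
  in the wide triangle at the end of the path, whose other edge at the node may be as short as a
  height. The constant must not see the mesh: a path has at most \<open>m * m\<close> steps, each
  costing a factor \<open>2 / \<epsilon>\<close>, and \<epsilon> depends on the maximum angle, on
  \<open>m\<close> and on the least gap between directions of boundary segments. Neighbours share an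
  edge at the node, so narrow triangles alone could open the cone by no more than a small multiple
  of \<epsilon>, less than this gap.\<close>

definition cross2 :: "real ^ 2 \<Rightarrow> real ^ 2 \<Rightarrow> real" where
  "cross2 a b = a $ 1 * b $ 2 - a $ 2 * b $ 1"

section \<open>Estimates along a single line\<close>

lemma abs_diff_le_nn_integral_deriv:
  fixes f f' :: "real \<Rightarrow> real"
  assumes "0 \<le> L" and der: "\<And>s. \<lbrakk>0 \<le> s; s \<le> L\<rbrakk> \<Longrightarrow> (f has_real_derivative f' s) (at s)"
    and cont: "continuous_on {0..L} f'"
  shows "ennreal \<bar>f L - f 0\<bar> \<le> (\<integral>\<^sup>+s\<in>{0<..<L}. \<bar>f' s\<bar> \<partial>lborel)"
proof -
  have int: "set_integrable lborel {0..L} f'"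
    by (rule borel_integrable_atLeastAtMost') (rule cont)
  have "f L - f 0 = (LINT s:{0..L}|lborel. f' s)"
    unfolding set_lebesgue_integral_def
    by (rule integral_FTC_atLeastAtMost[symmetric])
       (use assms in \<open>auto simp: has_real_derivative_iff_has_vector_derivative
          intro: has_vector_derivative_at_within\<close>)
  then have "ennreal \<bar>f L - f 0\<bar> \<le> (\<integral>\<^sup>+s. norm (indicator {0..L} s *\<^sub>R f' s) \<partial>lborel)"
    using integral_norm_bound_ennreal[OF int[unfolded set_integrable_def]]
    by (simp add: set_lebesgue_integral_def)
  also have "\<dots> = (\<integral>\<^sup>+s\<in>{0<..<L}. \<bar>f' s\<bar> \<partial>lborel)"
  proof (rule nn_integral_cong_AE)
    show "AE s in lborel. ennreal (norm (indicator {0..L} s *\<^sub>R f' s))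
        = ennreal \<bar>f' s\<bar> * indicator {0<..<L} s"
      using AE_lborel_singleton[of "0::real"] AE_lborel_singleton[of L]
      by eventually_elim (auto simp: indicator_def)
  qed
  finally show ?thesis .
qed

text \<open>The factor \<open>K - s\<close> removes the boundary term at the far end. Nothing is
  known of \<open>f\<close> at \<open>L\<close>, which will lie on the side opposite to the node and
  possibly outside the open set; so the argument runs on \<open>{0..K}\<close> with
  \<open>K < L\<close>, and \<open>K\<close> tends to \<open>L\<close> on the left side only, the
  right side being independent of \<open>K\<close>.\<close>

lemma abs_mult_le_nn_integral_deriv:
  fixes f f' :: "real \<Rightarrow> real"
  assumes "0 < L" and der: "\<And>s. \<lbrakk>0 \<le> s; s < L\<rbrakk> \<Longrightarrow> (f has_real_derivative f' s) (at s)"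
    and cont: "continuous_on {0..<L} f'"
  shows "ennreal (L * \<bar>f 0\<bar>) \<le> (\<integral>\<^sup>+s\<in>{0<..<L}. (L * \<bar>f' s\<bar> + \<bar>f s\<bar>) \<partial>lborel)" (is "_ \<le> ?R")
proof -
  have "ennreal (K * \<bar>f 0\<bar>) \<le> ?R" if K: "0 < K" "K < L" for K
  proof -
    define F where "F s = f s * (K - s)" for s
    define F' where "F' s = f' s * (K - s) - f s" for s
    have contf: "continuous_on {0..K} f"
      using K by (intro continuous_at_imp_continuous_on ballI) (auto intro!: DERIV_isCont der)
    have "continuous_on {0..K} f'"
      by (rule continuous_on_subset[OF cont]) (use K in auto)
    then have "ennreal \<bar>F K - F 0\<bar> \<le> (\<integral>\<^sup>+s\<in>{0<..<K}. \<bar>F' s\<bar> \<partial>lborel)"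
      using K contf unfolding F_def F'_def
      by (intro abs_diff_le_nn_integral_deriv)
         (auto intro!: derivative_eq_intros continuous_intros der simp: algebra_simps)
    also have "\<dots> \<le> ?R"
    proof (rule nn_integral_mono)
      fix s
      have "\<bar>F' s\<bar> \<le> L * \<bar>f' s\<bar> + \<bar>f s\<bar>" if "0 < s" "s < K"
      proof -
        have "\<bar>F' s\<bar> \<le> \<bar>f' s * (K - s)\<bar> + \<bar>f s\<bar>" by (simp add: F'_def)
        also have "\<bar>f' s * (K - s)\<bar> \<le> L * \<bar>f' s\<bar>"
          using that K mult_left_mono[of "K - s" L "\<bar>f' s\<bar>"] by (simp add: abs_mult mult.commute)
        finally show ?thesis by simp
      qed
      then show "ennreal \<bar>F' s\<bar> * indicator {0<..<K} s
          \<le> ennreal (L * \<bar>f' s\<bar> + \<bar>f s\<bar>) * indicator {0<..<L} s"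
        using K by (auto simp: indicator_def ennreal_leI simp del: ennreal_plus)
    qed
    finally show ?thesis using K by (simp add: F_def abs_mult mult.commute)
  qed
  moreover have "((\<lambda>K. ennreal (K * \<bar>f 0\<bar>)) \<longlongrightarrow> ennreal (L * \<bar>f 0\<bar>)) (at_left L)"
    by (intro tendsto_intros)
  moreover have "\<forall>\<^sub>F K in at_left L. 0 < K \<and> K < L"
    using \<open>0 < L\<close> eventually_at_left_real[of 0 L] by (auto elim: eventually_mono)
  ultimately show ?thesis
    by (intro tendsto_upperbound[where F = "at_left L"]) (auto elim: eventually_mono)
qed

text \<open>Cramer's rule for the coordinates of \<open>x\<close> in the basis \<open>a\<close>,
  \<open>b\<close>, multiplied by the determinant.\<close>

lemma cross2_expand: "cross2 a b *\<^sub>R x = cross2 x b *\<^sub>R a + cross2 a x *\<^sub>R b"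
  by (simp add: vec_eq_iff forall_2 cross2_def algebra_simps)

section \<open>Linear coordinates in the plane\<close>

lemma measurable_vec2:
  "(\<lambda>(t, s). vector [t, s] :: real ^ 2) \<in> borel_measurable (lborel \<Otimes>\<^sub>M lborel)"
proof -
  have "(\<lambda>(t, s). vector [t, s] :: real ^ 2) = (\<lambda>x. fst x *\<^sub>R axis 1 1 + snd x *\<^sub>R axis 2 1)"
    by (auto simp: fun_eq_iff vec_eq_iff forall_2 axis_def)
  then show ?thesis by (simp add: measurable_split_conv)
qed

text \<open>Links the product measure, on which Tonelli's theorem acts, to Lebesgue measure on
  \<open>real ^ 2\<close>; agreement on boxes suffices.\<close>

lemma distr_lborel_vec2:
  "distr (lborel \<Otimes>\<^sub>M lborel) borel (\<lambda>(t, s). vector [t, s] :: real ^ 2) = lborel" (is "?M = _")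
proof (rule lborel_eqI[symmetric])
  note [measurable] = measurable_vec2
  fix l u :: "real ^ 2"
  assume le: "\<And>b. b \<in> Basis \<Longrightarrow> l \<bullet> b \<le> u \<bullet> b"
  have le': "l $ i \<le> u $ i" for i
    using le[of "axis i 1"] by (auto simp: Basis_vec_def inner_axis)
  have "emeasure ?M (box l u)
      = emeasure (lborel \<Otimes>\<^sub>M lborel) ({l $ 1<..<u $ 1} \<times> {l $ 2<..<u $ 2})"
    by (subst emeasure_distr) (auto intro!: arg_cong2[of _ _ _ _ emeasure]
        simp: mem_box_cart forall_2 space_pair_measure)
  also have "\<dots> = ennreal ((u $ 1 - l $ 1) * (u $ 2 - l $ 2))"
    using le' by (subst lborel.emeasure_pair_measure_Times) (auto simp: ennreal_mult)
  also have "(u $ 1 - l $ 1) * (u $ 2 - l $ 2) = (\<Prod>b\<in>Basis. (u - l) \<bullet> b)"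
  proof -
    have "(\<Prod>b\<in>Basis. (u - l) \<bullet> b) = (\<Prod>i\<in>UNIV. (u - l) $ i)"
      unfolding Basis_vec_def
      by (subst prod.UNION_disjoint) (auto simp: axis_eq_axis inner_axis)
    then show ?thesis by (simp add: prod_2 UNIV_2)
  qed
  finally show "emeasure ?M (box l u) = (\<Prod>b\<in>Basis. (u - l) \<bullet> b)" .
qed simp

text \<open>Again it suffices to compare measures of boxes. The inverse \<open>g\<close> is explicit
  by Cramer's rule, so preimages under \<open>f\<close> are linear images under \<open>g\<close>, to
  which the determinant formula applies.\<close>

lemma nn_integral_linear2:
  fixes a b :: "real ^ 2" and F :: "real ^ 2 \<Rightarrow> ennreal"
  assumes D: "cross2 a b \<noteq> 0" and [measurable]: "F \<in> borel_measurable borel"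
  shows "(\<integral>\<^sup>+x. F ((x $ 1) *\<^sub>R a + (x $ 2) *\<^sub>R b) \<partial>(lborel :: (real ^ 2) measure))
    = ennreal (1 / \<bar>cross2 a b\<bar>) * (\<integral>\<^sup>+x. F x \<partial>lborel)"
proof -
  define f :: "real ^ 2 \<Rightarrow> real ^ 2" where "f x = (x $ 1) *\<^sub>R a + (x $ 2) *\<^sub>R b" for x
  define g :: "real ^ 2 \<Rightarrow> real ^ 2" where
    "g x = vector [cross2 x b / cross2 a b, cross2 a x / cross2 a b]" for x
  have lin: "linear f" "linear g"
    by (auto intro!: linearI simp: f_def g_def cross2_def vec_eq_iff forall_2 algebra_simps
        add_divide_distrib diff_divide_distrib)
  have fg: "f (g x) = x" for x
    using arg_cong[OF cross2_expand[of a b x], of "\<lambda>y. (1 / cross2 a b) *\<^sub>R y"] D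
    by (simp add: f_def g_def scaleR_add_right)
  have gf: "g (f x) = x" for x
    using D by (auto simp: f_def g_def vec_eq_iff forall_2 cross2_def field_simps)
  have vimage: "f -` S = g ` S" for S
    using fg gf by (auto simp: image_iff) metis
  have det: "det (matrix f) = cross2 a b"
    by (simp add: det_2 matrix_def f_def axis_def cross2_def)
  have [measurable]: "f \<in> borel_measurable borel"
    using lin(1) by (intro borel_measurable_continuous_onI linear_continuous_on linear_conv_bounded_linear[THEN iffD1])
  have "lborel = density (distr lborel borel f) (\<lambda>_. ennreal \<bar>cross2 a b\<bar>)" (is "_ = ?M")
  proof (rule lborel_eqI)
    fix l u :: "real ^ 2"
    assume le: "\<And>b. b \<in> Basis \<Longrightarrow> l \<bullet> b \<le> u \<bullet> b"
    have lm: "g ` box l u \<in> lmeasurable"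
      by (rule measurable_linear_image[OF lin(2)]) simp
    have meas: "g ` box l u \<in> sets borel"
      unfolding vimage[symmetric] using measurable_sets[of f borel borel "box l u"] by simp
    have "measure lebesgue (box l u) = \<bar>cross2 a b\<bar> * measure lebesgue (g ` box l u)"
      using measure_linear_image[OF lin(1) lm] fg by (simp add: image_image det)
    then have m: "measure lborel (box l u) = \<bar>cross2 a b\<bar> * measure lborel (g ` box l u)"
      using meas by simp
    have fin: "emeasure lborel (g ` box l u) < \<infinity>"
      using lm meas by (simp add: fmeasurable_def)
    have "emeasure ?M (box l u) = ennreal \<bar>cross2 a b\<bar> * emeasure lborel (g ` box l u)"
      by (simp add: emeasure_density nn_integral_cmult_indicator nn_integral_cmult
          emeasure_distr vimage)
    also have "\<dots> = ennreal (measure lborel (box l u))"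
      using fin unfolding m by (simp add: emeasure_eq_ennreal_measure ennreal_mult less_top)
    also have "\<dots> = (\<Prod>b\<in>Basis. (u - l) \<bullet> b)"
      using emeasure_eq_ennreal_measure[of lborel "box l u"] emeasure_lborel_box[OF le] by simp
    finally show "emeasure ?M (box l u) = (\<Prod>b\<in>Basis. (u - l) \<bullet> b)" .
  qed simp
  then have "(\<integral>\<^sup>+x. F x \<partial>lborel) = (\<integral>\<^sup>+x. F x \<partial>?M)" by simp
  also have "\<dots> = ennreal \<bar>cross2 a b\<bar> * (\<integral>\<^sup>+x. F (f x) \<partial>lborel)"
    by (simp add: nn_integral_density nn_integral_distr nn_integral_cmult)
  finally have "ennreal (1 / \<bar>cross2 a b\<bar>) * (\<integral>\<^sup>+x. F x \<partial>lborel)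
      = ennreal (1 / \<bar>cross2 a b\<bar> * \<bar>cross2 a b\<bar>) * (\<integral>\<^sup>+x. F (f x) \<partial>lborel)"
    by (subst ennreal_mult) (auto simp: mult.assoc)
  then show ?thesis using D by (simp add: f_def)
qed

text \<open>Both parameters run over the whole line: in the applications \<open>F\<close> carries
  the indicator of an open set, so no triangle has to be described by limits of integration.\<close>

lemma nn_integral_affine2:
  fixes p a b :: "real ^ 2" and F :: "real ^ 2 \<Rightarrow> ennreal"
  assumes D: "cross2 a b \<noteq> 0" and [measurable]: "F \<in> borel_measurable borel"
  shows "(\<integral>\<^sup>+t. \<integral>\<^sup>+s. F (p + t *\<^sub>R a + s *\<^sub>R b) \<partial>lborel \<partial>lborel)
    = ennreal (1 / \<bar>cross2 a b\<bar>) * (\<integral>\<^sup>+x. F x \<partial>lborel)"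
proof -
  note [measurable] = measurable_vec2
  have [measurable]: "(\<lambda>x :: real ^ 2. F (p + ((x $ 1) *\<^sub>R a + (x $ 2) *\<^sub>R b))) \<in> borel_measurable borel"
    by measurable
  have "(\<integral>\<^sup>+t. \<integral>\<^sup>+s. F (p + t *\<^sub>R a + s *\<^sub>R b) \<partial>lborel \<partial>lborel)
      = (\<integral>\<^sup>+y. F (p + (fst y *\<^sub>R a + snd y *\<^sub>R b)) \<partial>(lborel \<Otimes>\<^sub>M lborel))"
    by (subst lborel.nn_integral_fst[symmetric]) (auto simp: add.assoc)
  also have "\<dots> = (\<integral>\<^sup>+x. F (p + ((x $ 1) *\<^sub>R a + (x $ 2) *\<^sub>R b)) \<partial>(lborel :: (real ^ 2) measure))"
    unfolding distr_lborel_vec2[symmetric]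
    by (simp add: nn_integral_distr case_prod_unfold)
  also have "\<dots> = ennreal (1 / \<bar>cross2 a b\<bar>) * (\<integral>\<^sup>+x. F (p + x) \<partial>lborel)"
    using nn_integral_linear2[OF D, of "\<lambda>x. F (p + x)"] by simp
  also have "(\<integral>\<^sup>+x. F (p + x) \<partial>lborel) = (\<integral>\<^sup>+x. F x \<partial>lborel)"
    by (subst (2) lborel_distr_plus[of p, symmetric]) (simp add: nn_integral_distr)
  finally show ?thesis .
qed

section \<open>C1 functions on a triangle\<close>

definition C1_on :: "'a::euclidean_space set \<Rightarrow> ('a \<Rightarrow> real) \<Rightarrow> ('a \<Rightarrow> 'a) \<Rightarrow> bool" where
  "C1_on U w Dw \<longleftrightarrow> (\<forall>x\<in>U. GDERIV w x :> Dw x) \<and> continuous_on U Dw"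

text \<open>The norm of \<open>w\<close> times the hat function on the edge, as the hat function
  falls linearly from 1 at \<open>p\<close> to 0 at \<open>q\<close>. Values in
  \<open>ennreal\<close> spare any integrability of \<open>w\<close> up to the end points.\<close>

definition weighted_edge :: "'a::euclidean_space \<Rightarrow> 'a \<Rightarrow> ('a \<Rightarrow> real) \<Rightarrow> ennreal" where
  "weighted_edge p q w =
     ennreal (dist p q) * (\<integral>\<^sup>+t\<in>{0<..<1}. (1 - t) * \<bar>w (p + t *\<^sub>R (q - p))\<bar> \<partial>lborel)"

lemma C1_on_continuous: "C1_on U w Dw \<Longrightarrow> continuous_on U w"
  unfolding C1_on_def gderiv_def
  by (intro continuous_at_imp_continuous_on ballI) (auto intro: has_derivative_continuous)

lemma C1_on_line:
  assumes "C1_on U w Dw" "x + s *\<^sub>R d \<in> U"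
  shows "((\<lambda>s. w (x + s *\<^sub>R d)) has_real_derivative d \<bullet> Dw (x + s *\<^sub>R d)) (at s)"
proof -
  have "(w has_derivative (\<lambda>h. h \<bullet> Dw (x + s *\<^sub>R d))) (at (x + s *\<^sub>R d))"
    using assms by (simp add: C1_on_def gderiv_def)
  moreover have "((\<lambda>s. x + s *\<^sub>R d) has_derivative (\<lambda>h. h *\<^sub>R d)) (at s)"
    by (auto intro!: derivative_eq_intros)
  ultimately show ?thesis
    unfolding has_field_derivative_def
    by (auto dest: has_derivative_compose simp: mult.commute[of "d \<bullet> _"] fun_eq_iff
        elim!: has_derivative_eq_rhs)
qed

lemma C1_on_continuous_line:
  assumes "C1_on U w Dw" "\<And>s. s \<in> S \<Longrightarrow> x + s *\<^sub>R d \<in> U"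
  shows "continuous_on S (\<lambda>s. d \<bullet> Dw (x + s *\<^sub>R d))"
proof -
  have "continuous_on U Dw" using assms by (simp add: C1_on_def)
  then have "continuous_on S (\<lambda>s. Dw (x + s *\<^sub>R d))"
    by (rule continuous_on_compose2) (use assms in \<open>auto intro!: continuous_intros\<close>)
  then show ?thesis by (intro continuous_intros)
qed

lemma C1_on_borel:
  assumes "open U" "C1_on U w Dw"
  shows "(\<lambda>x. ennreal \<bar>w x\<bar> * indicator U x) \<in> borel_measurable borel"
    and "(\<lambda>x. ennreal (norm (Dw x)) * indicator U x) \<in> borel_measurable borel"
proof -
  have [measurable]: "(\<lambda>x. indicator U x *\<^sub>R w x) \<in> borel_measurable borel"
    "(\<lambda>x. indicator U x *\<^sub>R Dw x) \<in> borel_measurable borel"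
    using assms C1_on_continuous[OF assms(2)]
    by (auto intro!: borel_measurable_continuous_on_indicator simp: C1_on_def simp del: real_scaleR_def)
  have "(\<lambda>x. ennreal \<bar>w x\<bar> * indicator U x) = (\<lambda>x. ennreal \<bar>indicator U x *\<^sub>R w x\<bar>)"
    "(\<lambda>x. ennreal (norm (Dw x)) * indicator U x) = (\<lambda>x. ennreal (norm (indicator U x *\<^sub>R Dw x)))"
    by (auto simp: indicator_def)
  then show "(\<lambda>x. ennreal \<bar>w x\<bar> * indicator U x) \<in> borel_measurable borel"
    "(\<lambda>x. ennreal (norm (Dw x)) * indicator U x) \<in> borel_measurable borel"
    by (simp_all only:) measurable
qed

text \<open>Lagrange's identity. Up to the product of the norms, \<open>cross2\<close> is the sine
  and the inner product the cosine of the angle.\<close>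

lemma cross2_inner_power2: "(cross2 a b)\<^sup>2 + (a \<bullet> b)\<^sup>2 = (norm a * norm b)\<^sup>2"
  unfolding power_mult_distrib power2_norm_eq_inner
  by (simp add: inner_vec_def sum_2 cross2_def power2_eq_square algebra_simps)

lemma cross2_le_norm: "\<bar>cross2 a b\<bar> \<le> norm a * norm b"
proof (rule power2_le_imp_le)
  show "\<bar>cross2 a b\<bar>\<^sup>2 \<le> (norm a * norm b)\<^sup>2"
    using cross2_inner_power2[of a b] zero_le_power2[of "a \<bullet> b"] unfolding power2_abs by linarith
qed simp

lemma collinear_iff_cross2: "collinear {p, q, r} \<longleftrightarrow> cross2 (q - p) (r - p) = 0"
proof -
  have "collinear {p, q, r} \<longleftrightarrow> collinear {0, q - p, r - p}"
    using collinear_3[of q p r] by (simp add: insert_commute)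
  also have "\<dots> \<longleftrightarrow> \<bar>(q - p) \<bullet> (r - p)\<bar> = norm (q - p) * norm (r - p)"
    by (rule norm_cauchy_schwarz_equal[symmetric])
  also have "\<dots> \<longleftrightarrow> ((q - p) \<bullet> (r - p))\<^sup>2 = (norm (q - p) * norm (r - p))\<^sup>2"
    by (subst power2_eq_iff_nonneg[symmetric]) auto
  also have "\<dots> \<longleftrightarrow> cross2 (q - p) (r - p) = 0"
    using cross2_inner_power2[of "q - p" "r - p"] by auto
  finally show ?thesis .
qed

lemma mem_interior_triangle:
  fixes p q r :: "real ^ 2"
  assumes "cross2 (q - p) (r - p) \<noteq> 0" "0 < t" "0 < s" "t + s < 1"
  shows "p + t *\<^sub>R (q - p) + s *\<^sub>R (r - p) \<in> interior (convex hull {p, q, r})"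
proof -
  have "(1 - t - s) *\<^sub>R p + t *\<^sub>R q + s *\<^sub>R r = p + t *\<^sub>R (q - p) + s *\<^sub>R (r - p)"
    by (simp add: algebra_simps)
  moreover have "0 < 1 - t - s" "1 - t - s + t + s = 1" using assms by auto
  ultimately show ?thesis
    unfolding interior_convex_hull_3_minimal[OF assms(1)[folded collinear_iff_cross2], simplified]
    using assms by blast
qed

lemma mem_open_segment_affine:
  fixes p q :: "'a::real_vector"
  assumes "p \<noteq> q" "0 < t" "t < 1"
  shows "p + t *\<^sub>R (q - p) \<in> open_segment p q"
  using assms by (auto simp: in_segment algebra_simps intro!: exI[of _ t])

text \<open>Integration along the lines parallel to the side \<open>pr\<close>: the weight vanishes on \<open>qr\<close>.\<close>

lemma weighted_edge_le_triangle:
  fixes p q r :: "real ^ 2"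
  assumes U: "open U" "interior (convex hull {p, q, r}) \<subseteq> U" "open_segment p q \<subseteq> U"
    and w: "C1_on U w Dw"
    and \<epsilon>: "0 < \<epsilon>" "\<epsilon> * norm (q - p) * norm (r - p) \<le> \<bar>cross2 (q - p) (r - p)\<bar>"
    and l: "0 < l" "l \<le> norm (r - p)" and D: "cross2 (q - p) (r - p) \<noteq> 0"
  shows "weighted_edge p q w \<le> ennreal (1 / \<epsilon>) *
    ((\<integral>\<^sup>+x\<in>U. norm (Dw x) \<partial>lborel) + ennreal (1 / l) * (\<integral>\<^sup>+x\<in>U. \<bar>w x\<bar> \<partial>lborel))"
proof -
  define a b where "a = q - p" and "b = r - p"
  note [measurable] = C1_on_borel[OF U(1) w]
  have nz: "p \<noteq> q" "norm a > 0" "norm b > 0"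
    using D unfolding a_def b_def by (auto simp: cross2_def)
  define F where "F x = ennreal (norm b) * (ennreal (norm (Dw x)) * indicator U x)
      + ennreal \<bar>w x\<bar> * indicator U x" for x
  have [measurable]: "F \<in> borel_measurable borel" unfolding F_def by measurable
  \<comment> \<open>The line starting at parameter \<open>t\<close> on \<open>pq\<close> crosses the
    triangle over a parameter interval of length \<open>1 - t\<close>, which is also the value of
    the hat function at its start. So the one-dimensional estimate with \<open>L = 1 - t\<close>
    produces the weight by itself.\<close>
  have line: "ennreal ((1 - t) * \<bar>w (p + t *\<^sub>R a)\<bar>) \<le> (\<integral>\<^sup>+s. F (p + t *\<^sub>R a + s *\<^sub>R b) \<partial>lborel)"
    if t: "0 < t" "t < 1" for t
  proof -
    have inU: "p + t *\<^sub>R a + s *\<^sub>R b \<in> U" if "0 \<le> s" "s < 1 - t" for s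
    proof (cases "s = 0")
      case True
      then show ?thesis using mem_open_segment_affine[OF nz(1) t] U(3) by (auto simp: a_def)
    next
      case False
      then show ?thesis using mem_interior_triangle[OF D t(1), of s] that U(2)
        by (auto simp: a_def b_def)
    qed
    have "ennreal ((1 - t) * \<bar>w (p + t *\<^sub>R a)\<bar>)
        \<le> (\<integral>\<^sup>+s\<in>{0<..<1 - t}. ((1 - t) * \<bar>b \<bullet> Dw (p + t *\<^sub>R a + s *\<^sub>R b)\<bar>
              + \<bar>w (p + t *\<^sub>R a + s *\<^sub>R b)\<bar>) \<partial>lborel)"
      using abs_mult_le_nn_integral_deriv[of "1 - t" "\<lambda>s. w (p + t *\<^sub>R a + s *\<^sub>R b)"
          "\<lambda>s. b \<bullet> Dw (p + t *\<^sub>R a + s *\<^sub>R b)"]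
        C1_on_line[OF w inU] C1_on_continuous_line[OF w, of "{0..<1 - t}"] inU t by simp
    also have "\<dots> \<le> (\<integral>\<^sup>+s. F (p + t *\<^sub>R a + s *\<^sub>R b) \<partial>lborel)"
    proof (rule nn_integral_mono)
      fix s
      let ?x = "p + t *\<^sub>R a + s *\<^sub>R b"
      show "ennreal ((1 - t) * \<bar>b \<bullet> Dw ?x\<bar> + \<bar>w ?x\<bar>) * indicator {0<..<1 - t} s \<le> F ?x"
      proof (cases "0 < s \<and> s < 1 - t")
        case True
        have "(1 - t) * \<bar>b \<bullet> Dw ?x\<bar> \<le> 1 * \<bar>b \<bullet> Dw ?x\<bar>"
          using t by (intro mult_right_mono) auto
        also have "\<dots> \<le> norm b * norm (Dw ?x)" by (simp add: Cauchy_Schwarz_ineq2)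
        finally have "ennreal ((1 - t) * \<bar>b \<bullet> Dw ?x\<bar> + \<bar>w ?x\<bar>)
            \<le> ennreal (norm b * norm (Dw ?x) + \<bar>w ?x\<bar>)"
          by (intro ennreal_leI) simp
        then show ?thesis using True inU[of s] by (simp add: F_def ennreal_mult)
      qed (auto simp: indicator_def)
    qed
    finally show ?thesis .
  qed
  have "(\<integral>\<^sup>+t\<in>{0<..<1}. (1 - t) * \<bar>w (p + t *\<^sub>R a)\<bar> \<partial>lborel)
      \<le> (\<integral>\<^sup>+t. \<integral>\<^sup>+s. F (p + t *\<^sub>R a + s *\<^sub>R b) \<partial>lborel \<partial>lborel)"
    by (intro nn_integral_mono) (auto simp: indicator_def line)
  also have "\<dots> = ennreal (1 / \<bar>cross2 a b\<bar>) * (\<integral>\<^sup>+x. F x \<partial>lborel)"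
    using D by (intro nn_integral_affine2) (auto simp: a_def b_def)
  also have "(\<integral>\<^sup>+x. F x \<partial>lborel) = ennreal (norm b) *
      ((\<integral>\<^sup>+x\<in>U. norm (Dw x) \<partial>lborel) + ennreal (1 / norm b) * (\<integral>\<^sup>+x\<in>U. \<bar>w x\<bar> \<partial>lborel))"
    using nz unfolding F_def
    by (subst nn_integral_add, simp, simp, subst nn_integral_cmult)
       (auto simp: distrib_left mult.assoc[symmetric] ennreal_mult[symmetric])
  finally have "weighted_edge p q w \<le> ennreal (norm a) * (ennreal (1 / \<bar>cross2 a b\<bar>) * (ennreal (norm b) *
      ((\<integral>\<^sup>+x\<in>U. norm (Dw x) \<partial>lborel) + ennreal (1 / norm b) * (\<integral>\<^sup>+x\<in>U. \<bar>w x\<bar> \<partial>lborel))))"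
    unfolding weighted_edge_def
    by (intro mult_mono) (auto simp: a_def dist_norm norm_minus_commute)
  also have "\<dots> = ennreal (norm a * norm b / \<bar>cross2 a b\<bar>) *
      ((\<integral>\<^sup>+x\<in>U. norm (Dw x) \<partial>lborel) + ennreal (1 / norm b) * (\<integral>\<^sup>+x\<in>U. \<bar>w x\<bar> \<partial>lborel))"
    by (simp add: mult.assoc[symmetric] ennreal_mult[symmetric])
  also have "\<dots> \<le> ennreal (1 / \<epsilon>) *
    ((\<integral>\<^sup>+x\<in>U. norm (Dw x) \<partial>lborel) + ennreal (1 / l) * (\<integral>\<^sup>+x\<in>U. \<bar>w x\<bar> \<partial>lborel))"
    using \<epsilon> l D unfolding a_def[symmetric] b_def[symmetric]
    by (intro mult_mono add_mono ennreal_leI order_refl)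
       (auto simp: field_simps divide_le_eq intro!: divide_left_mono)
  finally show ?thesis .
qed

text \<open>Integration along the lines parallel to the side \<open>qr\<close>, on which the weight is constant.\<close>

lemma weighted_edge_transfer:
  fixes p q r :: "real ^ 2"
  assumes U: "open U" "interior (convex hull {p, q, r}) \<subseteq> U" "open_segment p q \<subseteq> U"
      "open_segment p r \<subseteq> U"
    and w: "C1_on U w Dw"
    and \<epsilon>: "0 < \<epsilon>" "\<epsilon> * norm (q - p) * norm (r - q) \<le> \<bar>cross2 (q - p) (r - p)\<bar>"
    and D: "cross2 (q - p) (r - p) \<noteq> 0"
  shows "weighted_edge p q w \<le> ennreal (1 / \<epsilon>) *
    (weighted_edge p r w + (\<integral>\<^sup>+x\<in>U. norm (Dw x) \<partial>lborel))"
proof -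
  define a b c where "a = q - p" and "b = r - p" and "c = r - q"
  have abc: "b = a + c" by (simp add: a_def b_def c_def)
  have D': "cross2 a c = cross2 a b" "cross2 b c = cross2 a b"
    by (simp_all add: abc cross2_def algebra_simps)
  have Dab: "cross2 a b \<noteq> 0" using D by (simp add: a_def b_def)
  note [measurable] = C1_on_borel[OF U(1) w]
  have nz: "p \<noteq> q" "p \<noteq> r" "norm a > 0" "norm b > 0" "norm c > 0"
    using Dab D' unfolding a_def b_def c_def by (auto simp: cross2_def)
  define F where "F x = ennreal (norm c) * (ennreal (norm (Dw x)) * indicator U x)" for x
  have [measurable]: "F \<in> borel_measurable borel" unfolding F_def by measurable
  have contI: "continuous_on {0<..<1} (\<lambda>t. w (p + t *\<^sub>R (r - p)))"
    using U(4) mem_open_segment_affine[OF nz(2)]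
    by (intro continuous_on_compose2[OF C1_on_continuous[OF w]] continuous_intros) auto
  have [measurable]: "(\<lambda>t. ennreal ((1 - t) * \<bar>w (p + t *\<^sub>R b)\<bar>) * indicator {0<..<1} t)
      \<in> borel_measurable borel"
  proof -
    have [measurable]: "(\<lambda>t. indicator {0<..<1} t *\<^sub>R w (p + t *\<^sub>R (r - p))) \<in> borel_measurable borel"
      by (rule borel_measurable_continuous_on_indicator[OF _ contI]) simp
    have "(\<lambda>t. ennreal ((1 - t) * \<bar>w (p + t *\<^sub>R b)\<bar>) * indicator {0<..<1} t)
       = (\<lambda>t. ennreal ((1 - t) * \<bar>indicator {0<..<1} t *\<^sub>R w (p + t *\<^sub>R (r - p))\<bar>))"
      by (auto simp: indicator_def b_def)
    then show ?thesis by (simp only:) measurable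
  qed
  have line: "ennreal ((1 - t) * \<bar>w (p + t *\<^sub>R a)\<bar>)
      \<le> ennreal ((1 - t) * \<bar>w (p + t *\<^sub>R b)\<bar>) + (\<integral>\<^sup>+s. F (p + t *\<^sub>R a + s *\<^sub>R c) \<partial>lborel)"
    if t: "0 < t" "t < 1" for t
  proof -
    \<comment> \<open>The line in the direction of \<open>qr\<close> leaves \<open>pq\<close> at
      \<open>s = 0\<close> and reaches \<open>pr\<close> at \<open>s = t\<close>. Both end points
      belong to \<open>U\<close>, and the weight is \<open>1 - t\<close> at either.\<close>
    have inU: "p + t *\<^sub>R a + s *\<^sub>R c \<in> U" if s: "0 \<le> s" "s \<le> t" for s
    proof -
      consider "s = 0" | "s = t" | "0 < s" "s < t" using s by linarith
      then show ?thesis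
      proof cases
        case 1
        then show ?thesis using mem_open_segment_affine[OF nz(1) t] U(3) by (auto simp: a_def)
      next
        case 2
        then have "p + t *\<^sub>R a + s *\<^sub>R c = p + t *\<^sub>R (r - p)"
          by (simp add: a_def c_def algebra_simps)
        then show ?thesis using mem_open_segment_affine[OF nz(2) t] U(4) by (metis subsetD)
      next
        case 3
        have "p + t *\<^sub>R a + s *\<^sub>R c = p + (t - s) *\<^sub>R (q - p) + s *\<^sub>R (r - p)"
          by (simp add: a_def c_def algebra_simps)
        moreover have "p + (t - s) *\<^sub>R (q - p) + s *\<^sub>R (r - p) \<in> interior (convex hull {p, q, r})"
          using 3 t by (intro mem_interior_triangle[OF D]) auto
        ultimately show ?thesis using U(2) by (metis subsetD)
      qed
    qed
    have tb: "p + t *\<^sub>R b = p + t *\<^sub>R a + t *\<^sub>R c" by (simp add: abc algebra_simps)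
    have "ennreal \<bar>w (p + t *\<^sub>R b) - w (p + t *\<^sub>R a)\<bar>
        \<le> (\<integral>\<^sup>+s\<in>{0<..<t}. \<bar>c \<bullet> Dw (p + t *\<^sub>R a + s *\<^sub>R c)\<bar> \<partial>lborel)"
      unfolding tb
      using abs_diff_le_nn_integral_deriv[of t "\<lambda>s. w (p + t *\<^sub>R a + s *\<^sub>R c)"
          "\<lambda>s. c \<bullet> Dw (p + t *\<^sub>R a + s *\<^sub>R c)"]
        C1_on_line[OF w inU] C1_on_continuous_line[OF w, of "{0..t}"] inU t by simp
    also have "\<dots> \<le> (\<integral>\<^sup>+s. F (p + t *\<^sub>R a + s *\<^sub>R c) \<partial>lborel)"
    proof (rule nn_integral_mono)
      fix s
      let ?x = "p + t *\<^sub>R a + s *\<^sub>R c"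
      show "ennreal \<bar>c \<bullet> Dw ?x\<bar> * indicator {0<..<t} s \<le> F ?x"
      proof (cases "0 < s \<and> s < t")
        case True
        have "ennreal \<bar>c \<bullet> Dw ?x\<bar> \<le> ennreal (norm c * norm (Dw ?x))"
          by (intro ennreal_leI Cauchy_Schwarz_ineq2)
        then show ?thesis using True inU[of s] by (simp add: F_def ennreal_mult)
      qed (auto simp: indicator_def)
    qed
    finally have 1: "ennreal \<bar>w (p + t *\<^sub>R b) - w (p + t *\<^sub>R a)\<bar>
        \<le> (\<integral>\<^sup>+s. F (p + t *\<^sub>R a + s *\<^sub>R c) \<partial>lborel)" .
    have "(1 - t) * \<bar>w (p + t *\<^sub>R a)\<bar>
        \<le> (1 - t) * (\<bar>w (p + t *\<^sub>R b)\<bar> + \<bar>w (p + t *\<^sub>R b) - w (p + t *\<^sub>R a)\<bar>)"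
      using t by (intro mult_left_mono) auto
    also have "\<dots> \<le> (1 - t) * \<bar>w (p + t *\<^sub>R b)\<bar> + \<bar>w (p + t *\<^sub>R b) - w (p + t *\<^sub>R a)\<bar>"
      using t by (simp add: distrib_left mult_left_le_one_le)
    finally have "ennreal ((1 - t) * \<bar>w (p + t *\<^sub>R a)\<bar>)
       \<le> ennreal ((1 - t) * \<bar>w (p + t *\<^sub>R b)\<bar>) + ennreal \<bar>w (p + t *\<^sub>R b) - w (p + t *\<^sub>R a)\<bar>"
      using t by (subst ennreal_plus[symmetric]) (auto intro: ennreal_leI simp del: ennreal_plus)
    then show ?thesis by (rule order_trans) (intro add_mono 1 order_refl)
  qed
  have "(\<integral>\<^sup>+t\<in>{0<..<1}. (1 - t) * \<bar>w (p + t *\<^sub>R a)\<bar> \<partial>lborel)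
      \<le> (\<integral>\<^sup>+t. ennreal ((1 - t) * \<bar>w (p + t *\<^sub>R b)\<bar>) * indicator {0<..<1} t
          + (\<integral>\<^sup>+s. F (p + t *\<^sub>R a + s *\<^sub>R c) \<partial>lborel) \<partial>lborel)"
    by (intro nn_integral_mono) (auto simp: indicator_def line)
  also have "\<dots> = (\<integral>\<^sup>+t\<in>{0<..<1}. (1 - t) * \<bar>w (p + t *\<^sub>R b)\<bar> \<partial>lborel)
      + (\<integral>\<^sup>+t. \<integral>\<^sup>+s. F (p + t *\<^sub>R a + s *\<^sub>R c) \<partial>lborel \<partial>lborel)"
    by (intro nn_integral_add) auto
  also have "(\<integral>\<^sup>+t. \<integral>\<^sup>+s. F (p + t *\<^sub>R a + s *\<^sub>R c) \<partial>lborel \<partial>lborel)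
      = ennreal (1 / \<bar>cross2 a c\<bar>) * (\<integral>\<^sup>+x. F x \<partial>lborel)"
    using Dab D' by (intro nn_integral_affine2) auto
  also have "(\<integral>\<^sup>+x. F x \<partial>lborel) = ennreal (norm c) * (\<integral>\<^sup>+x\<in>U. norm (Dw x) \<partial>lborel)"
    unfolding F_def by (simp add: nn_integral_cmult)
  finally have "weighted_edge p q w \<le> ennreal (norm a) *
     ((\<integral>\<^sup>+t\<in>{0<..<1}. (1 - t) * \<bar>w (p + t *\<^sub>R b)\<bar> \<partial>lborel)
      + ennreal (1 / \<bar>cross2 a c\<bar>) * (ennreal (norm c) * (\<integral>\<^sup>+x\<in>U. norm (Dw x) \<partial>lborel)))"
    unfolding weighted_edge_def
    by (intro mult_mono) (auto simp: a_def dist_norm norm_minus_commute)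
  also have "\<dots> = ennreal (norm a) * (\<integral>\<^sup>+t\<in>{0<..<1}. (1 - t) * \<bar>w (p + t *\<^sub>R b)\<bar> \<partial>lborel)
      + ennreal (norm a * norm c / \<bar>cross2 a c\<bar>) * (\<integral>\<^sup>+x\<in>U. norm (Dw x) \<partial>lborel)"
    by (simp add: distrib_left mult.assoc[symmetric] ennreal_mult[symmetric])
  also have "\<dots> \<le> ennreal (norm b / \<epsilon>) * (\<integral>\<^sup>+t\<in>{0<..<1}. (1 - t) * \<bar>w (p + t *\<^sub>R b)\<bar> \<partial>lborel)
      + ennreal (1 / \<epsilon>) * (\<integral>\<^sup>+x\<in>U. norm (Dw x) \<partial>lborel)"
  proof (intro add_mono mult_right_mono ennreal_leI)
    \<comment> \<open>The norm on \<open>pr\<close> carries the length of \<open>pr\<close> instead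
      of that of \<open>pq\<close>. Since the three cross products agree, the lower bound on the
      sine at \<open>q\<close> also bounds \<open>norm a\<close> by
      \<open>norm b / \<epsilon>\<close>.\<close>
    have "\<epsilon> * norm a * norm c \<le> norm b * norm c"
      using cross2_le_norm[of b c] \<epsilon>(2) D' by (simp add: a_def b_def c_def)
    then have "\<epsilon> * norm a \<le> norm b" using nz by simp
    then show "norm a \<le> norm b / \<epsilon>" using \<epsilon> by (simp add: field_simps)
    show "norm a * norm c / \<bar>cross2 a c\<bar> \<le> 1 / \<epsilon>"
      using \<epsilon> Dab D' by (simp add: a_def b_def c_def field_simps)
  qed auto
  also have "\<dots> = ennreal (1 / \<epsilon>) *
    (weighted_edge p r w + (\<integral>\<^sup>+x\<in>U. norm (Dw x) \<partial>lborel))"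
    using \<epsilon> by (simp add: weighted_edge_def distrib_left mult.assoc[symmetric] ennreal_mult[symmetric]
        b_def dist_norm norm_minus_commute[of p r])
  finally show ?thesis .
qed

section \<open>From smooth functions to traces\<close>

lemma in_Lp_1_iff:
  assumes "U \<in> sets borel"
  shows "in_Lp 1 U f \<longleftrightarrow> integrable (restrict_space lborel U) f"
proof -
  have "integrable lborel (\<lambda>x. indicator U x *\<^sub>R norm (f x)) \<longleftrightarrow> integrable lborel (\<lambda>x. indicator U x *\<^sub>R f x)"
    if "(\<lambda>x. indicator U x *\<^sub>R f x) \<in> borel_measurable lborel"
    using integrable_norm_iff[OF that] by simp
  then show ?thesis
    using assms borel_measurable_integrable
    unfolding in_Lp_def set_borel_measurable_def set_integrable_def
    by (auto simp: integrable_restrict_space)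
qed

lemma Lp_norm_1:
  assumes "U \<in> sets borel"
  shows "Lp_norm 1 U f = (\<integral>x. norm (f x) \<partial>restrict_space lborel U)"
  using assms by (simp add: Lp_norm_def set_lebesgue_integral_def integral_restrict_space)

lemma in_Lp_2D:
  assumes "U \<in> sets borel" "in_Lp 2 U f"
  shows "f \<in> borel_measurable (restrict_space lborel U)"
    and "integrable (restrict_space lborel U) (\<lambda>x. (norm (f x))\<^sup>2)"
    and "(Lp_norm 2 U f)\<^sup>2 = (\<integral>x. (norm (f x))\<^sup>2 \<partial>restrict_space lborel U)"
proof -
  have eq: "norm (f x) powr 2 = (norm (f x))\<^sup>2" for x
    by (cases "f x = 0") (auto simp: powr_numeral)
  show "f \<in> borel_measurable (restrict_space lborel U)"
    "integrable (restrict_space lborel U) (\<lambda>x. (norm (f x))\<^sup>2)"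
    using assms unfolding in_Lp_def eq
    by (auto simp: set_borel_measurable_def set_integrable_def integrable_restrict_space
        borel_measurable_restrict_space_iff)
  show "(Lp_norm 2 U f)\<^sup>2 = (\<integral>x. (norm (f x))\<^sup>2 \<partial>restrict_space lborel U)"
  proof -
    have "0 \<le> (LINT x:U|lborel. (norm (f x))\<^sup>2)"
      unfolding set_lebesgue_integral_def by (intro integral_nonneg_AE) auto
    then show ?thesis
      using assms unfolding Lp_norm_def eq
      by (simp add: set_lebesgue_integral_def integral_restrict_space powr_half_sqrt)
  qed
qed

lemma Cauchy_Schwarz_integral:
  fixes f g :: "'a \<Rightarrow> real"
  assumes [measurable]: "f \<in> borel_measurable M" "g \<in> borel_measurable M"
    and int: "integrable M (\<lambda>x. (f x)\<^sup>2)" "integrable M (\<lambda>x. (g x)\<^sup>2)"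
  shows "integrable M (\<lambda>x. f x * g x)"
    and "(\<integral>x. \<bar>f x * g x\<bar> \<partial>M)\<^sup>2 \<le> (\<integral>x. (f x)\<^sup>2 \<partial>M) * (\<integral>x. (g x)\<^sup>2 \<partial>M)"
proof -
  have "\<bar>f x * g x\<bar> \<le> (f x)\<^sup>2 + (g x)\<^sup>2" for x
  proof -
    have "2 * (\<bar>f x\<bar> * \<bar>g x\<bar>) \<le> \<bar>f x\<bar>\<^sup>2 + \<bar>g x\<bar>\<^sup>2"
      using sum_squares_bound[of "\<bar>f x\<bar>" "\<bar>g x\<bar>"] by simp
    moreover have "0 \<le> \<bar>f x\<bar> * \<bar>g x\<bar>" by simp
    ultimately show ?thesis unfolding abs_mult power2_abs by linarith
  qed
  then show fg: "integrable M (\<lambda>x. f x * g x)"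
    by (intro Bochner_Integration.integrable_bound[OF Bochner_Integration.integrable_add[OF int]]) auto
  have "ennreal ((\<integral>x. \<bar>f x * g x\<bar> \<partial>M)\<^sup>2) = (\<integral>\<^sup>+x. ennreal \<bar>f x\<bar> * ennreal \<bar>g x\<bar> \<partial>M)\<^sup>2"
  proof -
    have "ennreal (\<integral>x. \<bar>f x * g x\<bar> \<partial>M) = (\<integral>\<^sup>+x. ennreal \<bar>f x\<bar> * ennreal \<bar>g x\<bar> \<partial>M)"
      using nn_integral_eq_integral[OF integrable_abs[OF fg]] by (simp add: abs_mult ennreal_mult)
    then show ?thesis by (simp add: ennreal_power[symmetric])
  qed
  also have "\<dots> \<le> (\<integral>\<^sup>+x. (ennreal \<bar>f x\<bar>)\<^sup>2 \<partial>M) * (\<integral>\<^sup>+x. (ennreal \<bar>g x\<bar>)\<^sup>2 \<partial>M)"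
    by (rule Cauchy_Schwarz_nn_integral) auto
  also have "\<dots> = ennreal ((\<integral>x. (f x)\<^sup>2 \<partial>M) * (\<integral>x. (g x)\<^sup>2 \<partial>M))"
    using int by (simp add: ennreal_power nn_integral_eq_integral ennreal_mult)
  finally show "(\<integral>x. \<bar>f x * g x\<bar> \<partial>M)\<^sup>2 \<le> (\<integral>x. (f x)\<^sup>2 \<partial>M) * (\<integral>x. (g x)\<^sup>2 \<partial>M)"
    by (subst (asm) ennreal_le_iff) (auto intro!: mult_nonneg_nonneg)
qed

text \<open>Formulated for differences because both sequences may vary with \<open>n\<close>: for
  the gradients, the factor \<open>\<psi>' (u (r n) x)\<close> occurs in both integrands.\<close>

lemma tendsto_integral_diff:
  fixes a b :: "nat \<Rightarrow> 'a \<Rightarrow> real"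
  assumes "\<And>n. integrable M (a n)" "\<And>n. integrable M (b n)" "\<And>n. integrable M (e n)"
    and "\<And>n x. x \<in> space M \<Longrightarrow> \<bar>a n x - b n x\<bar> \<le> e n x"
    and "(\<lambda>n. \<integral>x. e n x \<partial>M) \<longlonglongrightarrow> 0"
  shows "(\<lambda>n. (\<integral>x. a n x \<partial>M) - (\<integral>x. b n x \<partial>M)) \<longlonglongrightarrow> 0"
proof (rule Lim_null_comparison[OF _ assms(5)], intro always_eventually allI)
  fix n
  have "norm ((\<integral>x. a n x \<partial>M) - (\<integral>x. b n x \<partial>M)) = norm (\<integral>x. a n x - b n x \<partial>M)"
    using assms by simp
  also have "\<dots> \<le> (\<integral>x. norm (a n x - b n x) \<partial>M)"
    by (rule integral_norm_bound)
  also have "\<dots> \<le> (\<integral>x. e n x \<partial>M)"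
    using assms by (intro integral_mono) auto
  finally show "norm ((\<integral>x. a n x \<partial>M) - (\<integral>x. b n x \<partial>M)) \<le> (\<integral>x. e n x \<partial>M)" .
qed

text \<open>The components of the gradient are the first directional derivatives
  \<open>E [h]\<close>, which are themselves differentiable and hence continuous.\<close>

lemma smooth_on_imp_C1_on:
  assumes U: "open U" and s: "smooth_on U u" and D: "\<And>x. x \<in> U \<Longrightarrow> GDERIV u x :> Du x"
  shows "C1_on U u Du"
proof -
  obtain E where E0: "\<And>x. x \<in> U \<Longrightarrow> E [] x = u x"
    and E: "\<And>hs x. x \<in> U \<Longrightarrow> (E hs has_derivative (\<lambda>h. E (h # hs) x)) (at x)"
    using s unfolding smooth_on_def by blast
  have eq: "Du x \<bullet> h = E [h] x" if "x \<in> U" for x h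
  proof -
    have "(u has_derivative (\<lambda>h. E [h] x)) (at x)"
      by (rule has_derivative_transform_within_open[OF E U]) (use that E0 in auto)
    moreover have "(u has_derivative (\<lambda>h. h \<bullet> Du x)) (at x)"
      using D[OF that] by (simp add: gderiv_def)
    ultimately show ?thesis
      using has_derivative_unique by (metis inner_commute)
  qed
  have "continuous_on U (\<lambda>x. Du x \<bullet> h)" for h
  proof -
    have "continuous_on U (E [h])"
      by (intro continuous_at_imp_continuous_on ballI) (auto intro: has_derivative_continuous E)
    then show ?thesis using eq by (simp cong: continuous_on_cong)
  qed
  then have "continuous_on U Du" by (intro continuous_on_componentwise[THEN iffD2]) auto
  then show ?thesis using D by (auto simp: C1_on_def)
qed

lemma C1_on_compose:
  assumes "C1_on U u Du" "\<And>x. (\<psi> has_real_derivative \<psi>' x) (at x)" "continuous_on UNIV \<psi>'"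
  shows "C1_on U (\<lambda>x. \<psi> (u x)) (\<lambda>x. \<psi>' (u x) *\<^sub>R Du x)"
  using assms C1_on_continuous[OF assms(1)] unfolding C1_on_def
  by (auto intro!: GDERIV_DERIV_compose[where g = \<psi>] continuous_on_scaleR
      continuous_on_compose2[of UNIV \<psi>'])

text \<open>Collects what the geometry has to supply. The estimate is required for every
  \<open>C1_on\<close> function, since it is applied to compositions of some \<open>\<psi>\<close>
  with the smooth approximants in the definition of the trace.\<close>

locale edge_estimate =
  fixes U :: "'a::euclidean_space set" and p q :: 'a and C \<kappa> :: real
  assumes openU: "open U" and nonneg: "0 \<le> C" "0 \<le> \<kappa>"
    and estimate: "\<And>w Dw. C1_on U w Dw \<Longrightarrow> weighted_edge p q w
      \<le> ennreal C * ((\<integral>\<^sup>+x\<in>U. norm (Dw x) \<partial>lborel) + ennreal \<kappa> * (\<integral>\<^sup>+x\<in>U. \<bar>w x\<bar> \<partial>lborel))"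
begin

abbreviation M where "M \<equiv> restrict_space lborel U"
abbreviation N where "N \<equiv> restrict_space lborel {0<..<1::real}"

lemma estimate_lebesgue:
  assumes "C1_on U w Dw" "integrable M w" "integrable M Dw" "integrable N (edge_pullback p q w)"
  shows "(\<integral>t. dist p q * ((1 - t) * \<bar>edge_pullback p q w t\<bar>) \<partial>N)
    \<le> C * ((\<integral>x. norm (Dw x) \<partial>M) + \<kappa> * (\<integral>x. \<bar>w x\<bar> \<partial>M))"
proof -
  have [measurable]: "(\<lambda>t::real. 1 - t) \<in> borel_measurable N"
    by (intro measurable_restrict_space1) auto
  have int: "integrable N (\<lambda>t. (1 - t) * \<bar>edge_pullback p q w t\<bar>)"
    by (rule Bochner_Integration.integrable_bound[OF assms(4)])
       (use assms(4) in \<open>auto simp: space_restrict_space abs_mult mult_left_le_one_le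
          intro!: AE_I2\<close>)
  have "ennreal (\<integral>t. dist p q * ((1 - t) * \<bar>edge_pullback p q w t\<bar>) \<partial>N)
      = ennreal (dist p q) * (\<integral>\<^sup>+t. (1 - t) * \<bar>edge_pullback p q w t\<bar> \<partial>N)"
  proof -
    have nn: "AE t in N. 0 \<le> (1 - t) * \<bar>edge_pullback p q w t\<bar>"
      by (rule AE_I2) (simp add: space_restrict_space)
    show ?thesis
      unfolding nn_integral_eq_integral[OF int nn]
      using integral_nonneg_AE[OF nn] by (simp add: ennreal_mult)
  qed
  also have "\<dots> = weighted_edge p q w"
    by (simp add: weighted_edge_def edge_pullback_def nn_integral_restrict_space)
  also have "\<dots> \<le> ennreal C * ((\<integral>\<^sup>+x\<in>U. norm (Dw x) \<partial>lborel) + ennreal \<kappa> * (\<integral>\<^sup>+x\<in>U. \<bar>w x\<bar> \<partial>lborel))"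
    by (rule estimate) fact
  also have "\<dots> = ennreal C * ((\<integral>\<^sup>+x. norm (Dw x) \<partial>M) + ennreal \<kappa> * (\<integral>\<^sup>+x. \<bar>w x\<bar> \<partial>M))"
    using openU by (simp add: nn_integral_restrict_space)
  also have "\<dots> = ennreal (C * ((\<integral>x. norm (Dw x) \<partial>M) + \<kappa> * (\<integral>x. \<bar>w x\<bar> \<partial>M)))"
    using assms nonneg by (simp add: nn_integral_eq_integral ennreal_mult)
  finally show ?thesis
    using nonneg by (subst (asm) ennreal_le_iff) (auto intro!: mult_nonneg_nonneg add_nonneg_nonneg)
qed

text \<open>The estimate is applied to \<open>\<psi> (u n x)\<close>. As \<open>\<psi>\<close> is
  Lipschitz, these values converge in L1 on \<open>U\<close> and on the edge along with
  \<open>u n\<close>. The gradients are compared with \<open>\<psi>' (u n x) *\<^sub>R G x\<close>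
  by means of the bound \<open>B\<close>, and these with \<open>\<psi>' (v x) *\<^sub>R G x\<close>
  by dominated convergence. From \<open>\<psi> 0 = 0\<close> follows the integrability of
  \<open>\<psi> (f x)\<close> for integrable \<open>f\<close>.\<close>

lemma trace_estimate:
  assumes v: "in_Lp 1 U v" and G: "in_Lp 1 U G" and tr: "trace_on_edge U v G p q g"
    and \<psi>: "\<And>x. (\<psi> has_real_derivative \<psi>' x) (at x)" "continuous_on UNIV \<psi>'"
      "\<And>x. \<bar>\<psi>' x\<bar> \<le> B" "\<psi> 0 = 0"
  shows "(\<integral>t. dist p q * ((1 - t) * \<bar>\<psi> (edge_pullback p q g t)\<bar>) \<partial>N)
    \<le> C * ((\<integral>x. \<bar>\<psi>' (v x)\<bar> * norm (G x) \<partial>M) + \<kappa> * (\<integral>x. \<bar>\<psi> (v x)\<bar> \<partial>M))"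
proof -
  have Ub: "U \<in> sets borel" using openU by simp
  have Ib: "{0<..<1::real} \<in> sets borel" by simp
  obtain u Du where u: "\<And>n. smooth_on U (u n)" "\<And>n x. x \<in> U \<Longrightarrow> GDERIV (u n) x :> Du n x"
      "\<And>n. integrable M (u n)" "\<And>n. integrable M (Du n)"
      "\<And>n. integrable N (edge_pullback p q (u n))"
    and g[measurable]: "integrable N (edge_pullback p q g)"
    and lim: "(\<lambda>n. \<integral>x. norm (u n x - v x) \<partial>M) \<longlonglongrightarrow> 0"
      "(\<lambda>n. \<integral>x. norm (Du n x - G x) \<partial>M) \<longlonglongrightarrow> 0"
      "(\<lambda>n. edge_L1_norm p q (\<lambda>x. u n x - g x)) \<longlonglongrightarrow> 0"
    using tr unfolding trace_on_edge_def in_Lp_1_iff[OF Ub] in_Lp_1_iff[OF Ib] Lp_norm_1[OF Ub]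
    by blast
  have v[measurable]: "integrable M v" and G[measurable]: "integrable M G"
    using v G in_Lp_1_iff[OF Ub] by auto
  note [measurable] = u(3-5)
  have C1: "C1_on U (u n) (Du n)" for n
    by (rule smooth_on_imp_C1_on[OF openU u(1,2)])
  have "0 \<le> B" using \<psi>(3)[of 0] by linarith
  have contpsi: "continuous_on UNIV \<psi>"
    by (intro continuous_at_imp_continuous_on ballI) (auto intro!: DERIV_isCont \<psi>)
  have [measurable]: "\<psi> \<in> borel_measurable borel" "\<psi>' \<in> borel_measurable borel"
    using contpsi \<psi>(2) by (auto intro: borel_measurable_continuous_onI)
  have lip: "\<bar>\<psi> x - \<psi> y\<bar> \<le> B * \<bar>x - y\<bar>" for x y
  proof -
    have "norm (\<psi> x - \<psi> y) \<le> B * norm (x - y)"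
      by (rule field_differentiable_bound[of UNIV \<psi> \<psi>']) (use \<psi> in auto)
    then show ?thesis by simp
  qed
  have psi_le: "\<bar>\<psi> x\<bar> \<le> B * \<bar>x\<bar>" for x
    using lip[of x 0] \<psi>(4) by simp
  have psi_int: "integrable L (\<lambda>x. \<psi> (f x))" if "integrable L f" for L :: "'c measure" and f
  proof (rule Bochner_Integration.integrable_bound)
    show "integrable L (\<lambda>x. B * f x)" using that by simp
    show "(\<lambda>x. \<psi> (f x)) \<in> borel_measurable L"
      using that by measurable
    show "AE x in L. norm (\<psi> (f x)) \<le> norm (B * f x)"
      using psi_le \<open>0 \<le> B\<close> by (auto simp: abs_mult)
  qed
  have psi'_int: "integrable L (\<lambda>x. \<psi>' (f x) *\<^sub>R h x)"
    if "f \<in> borel_measurable L" "integrable L h" for L :: "'c measure" and f and h :: "'c \<Rightarrow> 'a"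
  proof (rule Bochner_Integration.integrable_bound)
    show "integrable L (\<lambda>x. B *\<^sub>R h x)" using that by simp
    show "(\<lambda>x. \<psi>' (f x) *\<^sub>R h x) \<in> borel_measurable L"
      using that by measurable
    show "AE x in L. norm (\<psi>' (f x) *\<^sub>R h x) \<le> norm (B *\<^sub>R h x)"
      using \<psi>(3) \<open>0 \<le> B\<close> by (auto intro!: mult_right_mono)
  qed
  \<comment> \<open>\<open>\<psi>'\<close> is only continuous and bounded, so
    \<open>\<psi>' (u n x)\<close> needs pointwise convergence, which L1 convergence gives along a
    subsequence.\<close>
  obtain r where r: "strict_mono r" "AE x in M. (\<lambda>n. u (r n) x - v x) \<longlonglongrightarrow> 0"
    using tendsto_L1_AE_subseq[of M "\<lambda>n x. u n x - v x"] u(3) v lim(1) by auto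
  have [measurable]: "(\<lambda>t::real. 1 - t) \<in> borel_measurable N"
    by (intro measurable_restrict_space1) auto
  have Nint: "integrable N (\<lambda>t. dist p q * ((1 - t) * \<bar>\<psi> (f t)\<bar>))" if "integrable N f" for f
  proof -
    have "integrable N (\<lambda>t. (1 - t) * \<bar>\<psi> (f t)\<bar>)"
      by (rule Bochner_Integration.integrable_bound[OF psi_int[OF that]])
         (use that in \<open>auto simp: space_restrict_space abs_mult mult_left_le_one_le
            intro!: AE_I2\<close>)
    then show ?thesis by simp
  qed
  let ?a = "\<lambda>n. \<integral>t. dist p q * ((1 - t) * \<bar>\<psi> (edge_pullback p q (u (r n)) t)\<bar>) \<partial>N"
  let ?b = "\<lambda>n. \<integral>x. norm (\<psi>' (u (r n) x) *\<^sub>R Du (r n) x) \<partial>M"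
  let ?c = "\<lambda>n. \<integral>x. \<bar>\<psi> (u (r n) x)\<bar> \<partial>M"
  have le: "?a n \<le> C * (?b n + \<kappa> * ?c n)" for n
    using estimate_lebesgue[OF C1_on_compose[OF C1 \<psi>(1,2), of "r n"]]
      psi_int[OF u(3)] psi'_int[OF _ u(4)] psi_int[OF u(5)]
    by (auto simp: edge_pullback_def)
  have "(\<lambda>n. ?a n - (\<integral>t. dist p q * ((1 - t) * \<bar>\<psi> (edge_pullback p q g t)\<bar>) \<partial>N)) \<longlonglongrightarrow> 0"
  proof (rule tendsto_integral_diff)
    let ?e = "\<lambda>n t. B * (dist p q * \<bar>edge_pullback p q (u (r n)) t - edge_pullback p q g t\<bar>)"
    show "integrable N (?e n)" for n using u(5) g by simp
    have "(\<lambda>n. B * edge_L1_norm p q (\<lambda>x. u (r n) x - g x)) \<longlonglongrightarrow> B * 0"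
      using LIMSEQ_subseq_LIMSEQ[OF lim(3) r(1)] by (intro tendsto_intros) (simp add: o_def)
    moreover have "B * edge_L1_norm p q (\<lambda>x. u (r n) x - g x) = (\<integral>t. ?e n t \<partial>N)" for n
      by (simp add: edge_L1_norm_def edge_pullback_def integral_restrict_space
          set_lebesgue_integral_def)
    ultimately show "(\<lambda>n. \<integral>t. ?e n t \<partial>N) \<longlonglongrightarrow> 0" by simp
    fix n t assume "t \<in> space N"
    then have t: "0 \<le> 1 - t" "1 - t \<le> 1" by (auto simp: space_restrict_space)
    let ?x = "edge_pullback p q (u (r n)) t" and ?y = "edge_pullback p q g t"
    have "\<bar>dist p q * ((1 - t) * \<bar>\<psi> ?x\<bar>) - dist p q * ((1 - t) * \<bar>\<psi> ?y\<bar>)\<bar>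
        = dist p q * ((1 - t) * \<bar>\<bar>\<psi> ?x\<bar> - \<bar>\<psi> ?y\<bar>\<bar>)"
      using t by (simp add: right_diff_distrib[symmetric] abs_mult)
    also have "\<dots> \<le> dist p q * (1 * (B * \<bar>?x - ?y\<bar>))"
      using t lip[of ?x ?y] \<open>0 \<le> B\<close> by (intro mult_left_mono mult_mono) auto
    finally show "\<bar>dist p q * ((1 - t) * \<bar>\<psi> ?x\<bar>) - dist p q * ((1 - t) * \<bar>\<psi> ?y\<bar>)\<bar> \<le> ?e n t"
      by (simp add: mult.left_commute)
  qed (intro Nint u g)+
  then have lim_a: "?a \<longlonglongrightarrow> (\<integral>t. dist p q * ((1 - t) * \<bar>\<psi> (edge_pullback p q g t)\<bar>) \<partial>N)"
    by (simp add: LIM_zero_cancel)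
  have "(\<lambda>n. ?c n - (\<integral>x. \<bar>\<psi> (v x)\<bar> \<partial>M)) \<longlonglongrightarrow> 0"
  proof (rule tendsto_integral_diff)
    let ?e = "\<lambda>n x. B * norm (u (r n) x - v x)"
    show "integrable M (?e n)" for n using u(3) v by simp
    have "(\<lambda>n. B * (\<integral>x. norm (u (r n) x - v x) \<partial>M)) \<longlonglongrightarrow> B * 0"
      using LIMSEQ_subseq_LIMSEQ[OF lim(1) r(1)] by (intro tendsto_intros) (simp add: o_def)
    then show "(\<lambda>n. \<integral>x. ?e n x \<partial>M) \<longlonglongrightarrow> 0" by simp
    show "\<bar>\<bar>\<psi> (u (r n) x)\<bar> - \<bar>\<psi> (v x)\<bar>\<bar> \<le> ?e n x" for n x
      using lip[of "u (r n) x" "v x"] by simp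
  qed (intro integrable_abs psi_int u v)+
  then have lim_c: "?c \<longlonglongrightarrow> (\<integral>x. \<bar>\<psi> (v x)\<bar> \<partial>M)"
    by (simp add: LIM_zero_cancel)
  have "(\<lambda>n. ?b n - (\<integral>x. norm (\<psi>' (u (r n) x) *\<^sub>R G x) \<partial>M)) \<longlonglongrightarrow> 0"
  proof (rule tendsto_integral_diff)
    let ?e = "\<lambda>n x. B * norm (Du (r n) x - G x)"
    show "integrable M (?e n)" for n using u(4) G by simp
    have "(\<lambda>n. B * (\<integral>x. norm (Du (r n) x - G x) \<partial>M)) \<longlonglongrightarrow> B * 0"
      using LIMSEQ_subseq_LIMSEQ[OF lim(2) r(1)] by (intro tendsto_intros) (simp add: o_def)
    then show "(\<lambda>n. \<integral>x. ?e n x \<partial>M) \<longlonglongrightarrow> 0" by simp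
    show "\<bar>norm (\<psi>' (u (r n) x) *\<^sub>R Du (r n) x) - norm (\<psi>' (u (r n) x) *\<^sub>R G x)\<bar> \<le> ?e n x" for n x
    proof -
      have "\<bar>norm (\<psi>' (u (r n) x) *\<^sub>R Du (r n) x) - norm (\<psi>' (u (r n) x) *\<^sub>R G x)\<bar>
          \<le> norm (\<psi>' (u (r n) x) *\<^sub>R (Du (r n) x - G x))"
        unfolding scaleR_diff_right by (rule norm_triangle_ineq3)
      also have "\<dots> \<le> ?e n x" using \<psi>(3) by (simp add: mult_right_mono)
      finally show ?thesis .
    qed
  qed (intro integrable_norm psi'_int u G borel_measurable_integrable)+
  moreover have "(\<lambda>n. \<integral>x. norm (\<psi>' (u (r n) x) *\<^sub>R G x) \<partial>M)
      \<longlonglongrightarrow> (\<integral>x. norm (\<psi>' (v x) *\<^sub>R G x) \<partial>M)"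
  proof (rule integral_dominated_convergence)
    show "integrable M (\<lambda>x. B * norm (G x))" using G by simp
    show "AE x in M. (\<lambda>n. norm (\<psi>' (u (r n) x) *\<^sub>R G x)) \<longlonglongrightarrow> norm (\<psi>' (v x) *\<^sub>R G x)"
      using r(2)
    proof eventually_elim
      case (elim x)
      then have "(\<lambda>n. u (r n) x) \<longlonglongrightarrow> v x" by (simp add: LIM_zero_cancel)
      then have "(\<lambda>n. \<psi>' (u (r n) x)) \<longlonglongrightarrow> \<psi>' (v x)"
        using continuous_on_tendsto_compose[OF \<psi>(2)] by auto
      then show ?case by (intro tendsto_intros)
    qed
    show "AE x in M. norm (norm (\<psi>' (u (r n) x) *\<^sub>R G x)) \<le> B * norm (G x)" for n
      using \<psi>(3) by (auto intro!: mult_right_mono)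
  qed measurable
  ultimately have lim_b: "?b \<longlonglongrightarrow> (\<integral>x. norm (\<psi>' (v x) *\<^sub>R G x) \<partial>M)"
    using tendsto_add by fastforce
  have "(\<lambda>n. C * (?b n + \<kappa> * ?c n))
      \<longlonglongrightarrow> C * ((\<integral>x. norm (\<psi>' (v x) *\<^sub>R G x) \<partial>M) + \<kappa> * (\<integral>x. \<bar>\<psi> (v x)\<bar> \<partial>M))"
    by (intro tendsto_intros lim_b lim_c)
  from LIMSEQ_le[OF lim_a this] le show ?thesis by auto
qed

lemma trace_estimate_L1:
  assumes "in_Lp 1 U v" "in_Lp 1 U G" "trace_on_edge U v G p q g"
  shows "(\<integral>t. dist p q * ((1 - t) * \<bar>edge_pullback p q g t\<bar>) \<partial>N)
    \<le> C * (Lp_norm 1 U G + \<kappa> * Lp_norm 1 U v)"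
  using trace_estimate[OF assms, of "\<lambda>x. x" "\<lambda>_. 1" 1] openU
  by (simp add: Lp_norm_1)

text \<open>The squares \<open>v\<^sup>2\<close> are approximated by the functions \<open>v\<^sup>2 / (1 + (\<delta> v)\<^sup>2)\<close>, which depend on \<open>v\<close>
  in a Lipschitz way, so that convergence in \<open>W\<^sup>1\<^sub>1\<close> is enough.\<close>

lemma trace_estimate_L2:
  assumes v: "in_Lp 1 U v" and G: "in_Lp 1 U G" and tr: "trace_on_edge U v G p q g"
    and L2: "in_Lp 2 U v" "in_Lp 2 U G"
  shows "dist p q * (\<integral>t. (1 - t) * \<bar>edge_pullback p q g t\<bar> \<partial>N)\<^sup>2
    \<le> 2 * C * (Lp_norm 2 U v * Lp_norm 2 U G + \<kappa> * (Lp_norm 2 U v)\<^sup>2)" (is "_ \<le> ?R")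
proof -
  have Ub: "U \<in> sets borel" using openU by simp
  note L2v = in_Lp_2D[OF Ub L2(1)] and L2G = in_Lp_2D[OF Ub L2(2)]
  note [measurable] = L2v(1) L2G(1)
  define gt where "gt = edge_pullback p q g"
  have gt[measurable]: "integrable N gt"
    using tr by (simp add: trace_on_edge_def gt_def in_Lp_1_iff)
  have [measurable]: "(\<lambda>t::real. 1 - t) \<in> borel_measurable N"
    by (intro measurable_restrict_space1) auto
  define S where "S = dist p q"
  have vG: "integrable M (\<lambda>x. \<bar>v x\<bar> * norm (G x))"
    "(\<integral>x. \<bar>v x\<bar> * norm (G x) \<partial>M) \<le> Lp_norm 2 U v * Lp_norm 2 U G"
  proof -
    note CS = Cauchy_Schwarz_integral[of "\<lambda>x. norm (v x)" M "\<lambda>x. norm (G x)", OF _ _ L2v(2) L2G(2)]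
    show "integrable M (\<lambda>x. \<bar>v x\<bar> * norm (G x))" using CS(1) by simp
    have "(\<integral>x. \<bar>v x\<bar> * norm (G x) \<partial>M)\<^sup>2 \<le> (Lp_norm 2 U v * Lp_norm 2 U G)\<^sup>2"
      using CS(2) unfolding power_mult_distrib L2v(3) L2G(3) by (simp add: abs_mult)
    then show "(\<integral>x. \<bar>v x\<bar> * norm (G x) \<partial>M) \<le> Lp_norm 2 U v * Lp_norm 2 U G"
      by (rule power2_le_imp_le) (simp add: Lp_norm_def)
  qed
  \<comment> \<open>The integrand is \<open>1 - t\<close> times the square root of
    \<open>\<psi> (gt t)\<close> for the \<open>\<psi>\<close> below. In this form
    \<open>\<delta>\<close> can tend to 0 by dominated convergence with majorant
    \<open>\<bar>gt t\<bar>\<close>, without knowing that the trace is square integrable.\<close>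
  have main: "S * (\<integral>t. (1 - t) * (\<bar>gt t\<bar> / sqrt (1 + (\<delta> * gt t)\<^sup>2)) \<partial>N)\<^sup>2 \<le> ?R"
    if \<delta>: "0 < \<delta>" for \<delta>
  proof -
    \<comment> \<open>Two bounds on the derivative serve different ends: \<open>1 / \<delta>\<close>
      only meets the boundedness hypothesis of \<open>trace_estimate\<close>, while
      \<open>2 * \<bar>x\<bar>\<close> is uniform in \<open>\<delta>\<close> and enters the
      result.\<close>
    define \<psi> \<psi>' where "\<psi> x = x\<^sup>2 / (1 + (\<delta> * x)\<^sup>2)" and "\<psi>' x = 2 * x / (1 + (\<delta> * x)\<^sup>2)\<^sup>2" for x
    have pos: "0 < 1 + (\<delta> * x)\<^sup>2" "1 \<le> 1 + (\<delta> * x)\<^sup>2" for x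
      by (auto intro: add_pos_nonneg)
    have nz: "1 + (\<delta> * x)\<^sup>2 \<noteq> 0" for x using pos(1)[of x] by simp
    have der: "(\<psi> has_real_derivative \<psi>' x) (at x)" for x
      unfolding \<psi>_def \<psi>'_def using nz[of x]
      by (auto intro!: derivative_eq_intros simp: field_simps power2_eq_square)
    have cont: "continuous_on UNIV \<psi>'"
      unfolding \<psi>'_def using nz by (auto intro!: continuous_intros)
    have psi0: "0 \<le> \<psi> x" "\<psi> x \<le> x\<^sup>2" for x
      using pos(1)[of x] mult_left_mono[OF pos(2)[of x], of "x\<^sup>2"]
      by (simp_all add: \<psi>_def pos_divide_le_eq)
    have psi'_le: "\<bar>\<psi>' x\<bar> \<le> 2 * \<bar>x\<bar> / (1 + (\<delta> * x)\<^sup>2)" for x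
    proof -
      have "\<bar>\<psi>' x\<bar> = (2 * \<bar>x\<bar> / (1 + (\<delta> * x)\<^sup>2)) / (1 + (\<delta> * x)\<^sup>2)"
        by (simp add: \<psi>'_def abs_mult power2_eq_square)
      also have "\<dots> \<le> (2 * \<bar>x\<bar> / (1 + (\<delta> * x)\<^sup>2)) / 1"
        by (intro divide_left_mono mult_pos_pos pos) auto
      finally show ?thesis by simp
    qed
    have psi'_le2: "\<bar>\<psi>' x\<bar> \<le> 2 * \<bar>x\<bar>" for x
    proof -
      have "2 * \<bar>x\<bar> / (1 + (\<delta> * x)\<^sup>2) \<le> 2 * \<bar>x\<bar> / 1"
        by (intro divide_left_mono mult_pos_pos pos) auto
      then show ?thesis using psi'_le[of x] by simp
    qed
    have psi'_bd: "\<bar>\<psi>' x\<bar> \<le> 1 / \<delta>" for x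
    proof -
      have "2 * (\<delta> * \<bar>x\<bar>) \<le> 1 + (\<delta> * x)\<^sup>2"
        using sum_squares_bound[of 1 "\<delta> * \<bar>x\<bar>"] by (simp add: power_mult_distrib)
      then have "2 * \<bar>x\<bar> / (1 + (\<delta> * x)\<^sup>2) \<le> 1 / \<delta>"
        using pos[of x] \<delta> by (simp add: field_simps)
      then show ?thesis using psi'_le[of x] by simp
    qed
    have psi_meas[measurable]: "\<psi> \<in> borel_measurable borel" "\<psi>' \<in> borel_measurable borel"
      unfolding \<psi>_def \<psi>'_def by measurable
    have intp: "integrable N (\<lambda>t. (1 - t) * \<psi> (gt t))"
    proof (rule Bochner_Integration.integrable_bound[OF integrable_mult_right[OF gt, of "1 / \<delta>"]])
      show "AE t in N. norm ((1 - t) * \<psi> (gt t)) \<le> norm (1 / \<delta> * gt t)"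
      proof (rule AE_I2)
        fix t assume "t \<in> space N"
        then have t: "0 \<le> 1 - t" "1 - t \<le> 1" by (auto simp: space_restrict_space)
        have "2 * (\<delta> * \<bar>gt t\<bar>) \<le> 1 + (\<delta> * gt t)\<^sup>2"
          using sum_squares_bound[of 1 "\<delta> * \<bar>gt t\<bar>"] by (simp add: power_mult_distrib)
        then have "\<delta> * \<bar>gt t\<bar> \<le> 1 + (\<delta> * gt t)\<^sup>2"
          using \<delta> mult_nonneg_nonneg[of \<delta> "\<bar>gt t\<bar>"] by linarith
        then have "\<bar>gt t\<bar> * (\<delta> * \<bar>gt t\<bar>) \<le> \<bar>gt t\<bar> * (1 + (\<delta> * gt t)\<^sup>2)"
          by (intro mult_left_mono) auto
        then have "\<psi> (gt t) \<le> \<bar>gt t\<bar> / \<delta>"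
          using \<delta> pos[of "gt t"] by (simp add: \<psi>_def field_simps power2_eq_square)
        moreover have "(1 - t) * \<psi> (gt t) \<le> \<psi> (gt t)"
          using t psi0 by (simp add: mult_left_le_one_le)
        ultimately show "norm ((1 - t) * \<psi> (gt t)) \<le> norm (1 / \<delta> * gt t)"
          using t psi0 \<delta> by (simp add: abs_mult)
      qed
    qed measurable
    have "S * (\<integral>t. (1 - t) * \<psi> (gt t) \<partial>N) = (\<integral>t. S * ((1 - t) * \<bar>\<psi> (gt t)\<bar>) \<partial>N)"
      using psi0 by simp
    also have "\<dots> \<le> C * ((\<integral>x. \<bar>\<psi>' (v x)\<bar> * norm (G x) \<partial>M) + \<kappa> * (\<integral>x. \<bar>\<psi> (v x)\<bar> \<partial>M))"
      unfolding gt_def S_def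
      by (rule trace_estimate[OF v G tr der cont psi'_bd]) (simp add: \<psi>_def)
    also have "\<dots> \<le> C * (2 * (Lp_norm 2 U v * Lp_norm 2 U G) + \<kappa> * (Lp_norm 2 U v)\<^sup>2)"
    proof (intro mult_left_mono add_mono nonneg)
      have "(\<integral>x. \<bar>\<psi>' (v x)\<bar> * norm (G x) \<partial>M) \<le> (\<integral>x. 2 * (\<bar>v x\<bar> * norm (G x)) \<partial>M)"
      proof (rule integral_mono')
        show "\<bar>\<psi>' (v x)\<bar> * norm (G x) \<le> 2 * (\<bar>v x\<bar> * norm (G x))" for x
          using mult_right_mono[OF psi'_le2[of "v x"], of "norm (G x)"] by simp
      qed (use vG in auto)
      then show "(\<integral>x. \<bar>\<psi>' (v x)\<bar> * norm (G x) \<partial>M) \<le> 2 * (Lp_norm 2 U v * Lp_norm 2 U G)"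
        using vG by simp
      show "(\<integral>x. \<bar>\<psi> (v x)\<bar> \<partial>M) \<le> (Lp_norm 2 U v)\<^sup>2"
        unfolding L2v(3) by (rule integral_mono') (use psi0 L2v(2) in auto)
    qed
    also have "\<dots> \<le> ?R"
      using nonneg by (simp add: algebra_simps)
    finally have le: "S * (\<integral>t. (1 - t) * \<psi> (gt t) \<partial>N) \<le> ?R" .
    \<comment> \<open>Cauchy-Schwarz against the constant 1 on the unit interval, with
      \<open>(1 - t)\<^sup>2 \<le> 1 - t\<close>, turns the bound on the integral of
      \<open>(1 - t) * \<psi> (gt t)\<close> into one on a squared integral.\<close>
    have sq: "((1 - t) * (\<bar>gt t\<bar> / sqrt (1 + (\<delta> * gt t)\<^sup>2)))\<^sup>2 = (1 - t)\<^sup>2 * \<psi> (gt t)" for t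
      using pos[of "gt t"] by (simp add: power_mult_distrib power_divide \<psi>_def)
    have sq_le: "(1 - t)\<^sup>2 * \<psi> (gt t) \<le> (1 - t) * \<psi> (gt t)" if "t \<in> space N" for t
      using that psi0 by (intro mult_right_mono)
        (auto simp: space_restrict_space power2_eq_square mult_left_le_one_le)
    have sq_int: "integrable N (\<lambda>t. (1 - t)\<^sup>2 * \<psi> (gt t))"
      by (rule Bochner_Integration.integrable_bound[OF intp])
         (use sq_le psi0 in \<open>auto simp: abs_mult space_restrict_space intro!: AE_I2\<close>)
    have one: "integrable N (\<lambda>_. 1::real)" "(\<integral>t. 1 \<partial>N) = (1::real)"
      by (auto simp: integrable_restrict_space measure_restrict_space space_restrict_space)
    have "(\<integral>t. \<bar>(1 - t) * (\<bar>gt t\<bar> / sqrt (1 + (\<delta> * gt t)\<^sup>2)) * 1\<bar> \<partial>N)\<^sup>2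
        \<le> (\<integral>t. ((1 - t) * (\<bar>gt t\<bar> / sqrt (1 + (\<delta> * gt t)\<^sup>2)))\<^sup>2 \<partial>N) * (\<integral>t. 1\<^sup>2 \<partial>N)"
    proof (rule Cauchy_Schwarz_integral(2))
      show "integrable N (\<lambda>t. ((1 - t) * (\<bar>gt t\<bar> / sqrt (1 + (\<delta> * gt t)\<^sup>2)))\<^sup>2)"
        unfolding sq by (rule sq_int)
      show "integrable N (\<lambda>_. 1\<^sup>2 :: real)" using one by simp
    qed measurable
    also have "\<dots> = (\<integral>t. (1 - t)\<^sup>2 * \<psi> (gt t) \<partial>N)" unfolding sq using one by simp
    also have "\<dots> \<le> (\<integral>t. (1 - t) * \<psi> (gt t) \<partial>N)"
      by (rule integral_mono[OF sq_int intp sq_le])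
    finally have "(\<integral>t. \<bar>(1 - t) * (\<bar>gt t\<bar> / sqrt (1 + (\<delta> * gt t)\<^sup>2))\<bar> \<partial>N)\<^sup>2
        \<le> (\<integral>t. (1 - t) * \<psi> (gt t) \<partial>N)" by simp
    moreover have "(\<integral>t. \<bar>(1 - t) * (\<bar>gt t\<bar> / sqrt (1 + (\<delta> * gt t)\<^sup>2))\<bar> \<partial>N)
        = (\<integral>t. (1 - t) * (\<bar>gt t\<bar> / sqrt (1 + (\<delta> * gt t)\<^sup>2)) \<partial>N)"
      by (rule Bochner_Integration.integral_cong) (auto simp: space_restrict_space abs_mult)
    ultimately have "S * (\<integral>t. (1 - t) * (\<bar>gt t\<bar> / sqrt (1 + (\<delta> * gt t)\<^sup>2)) \<partial>N)\<^sup>2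
        \<le> S * (\<integral>t. (1 - t) * \<psi> (gt t) \<partial>N)"
      by (simp add: S_def mult_left_mono)
    then show ?thesis using le by simp
  qed
  have "(\<lambda>n. \<integral>t. (1 - t) * (\<bar>gt t\<bar> / sqrt (1 + (1 / real (Suc n) * gt t)\<^sup>2)) \<partial>N)
      \<longlonglongrightarrow> (\<integral>t. (1 - t) * \<bar>gt t\<bar> \<partial>N)"
  proof (rule integral_dominated_convergence)
    show "integrable N (\<lambda>t. \<bar>gt t\<bar>)" using gt by simp
    show "AE t in N. (\<lambda>n. (1 - t) * (\<bar>gt t\<bar> / sqrt (1 + (1 / real (Suc n) * gt t)\<^sup>2)))
        \<longlonglongrightarrow> (1 - t) * \<bar>gt t\<bar>"
    proof (rule AE_I2)
      fix t
      have "(\<lambda>n. (1 - t) * (\<bar>gt t\<bar> / sqrt (1 + (1 / real (Suc n) * gt t)\<^sup>2)))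
        \<longlonglongrightarrow> (1 - t) * (\<bar>gt t\<bar> / sqrt (1 + (0 * gt t)\<^sup>2))"
        using LIMSEQ_inverse_real_of_nat by (intro tendsto_intros) (auto simp: inverse_eq_divide)
      then show "(\<lambda>n. (1 - t) * (\<bar>gt t\<bar> / sqrt (1 + (1 / real (Suc n) * gt t)\<^sup>2)))
        \<longlonglongrightarrow> (1 - t) * \<bar>gt t\<bar>" by simp
    qed
    show "AE t in N. norm ((1 - t) * (\<bar>gt t\<bar> / sqrt (1 + (1 / real (Suc n) * gt t)\<^sup>2))) \<le> \<bar>gt t\<bar>" for n
    proof (rule AE_I2)
      fix t assume "t \<in> space N"
      then have t: "0 \<le> 1 - t" "1 - t \<le> 1" by (auto simp: space_restrict_space)
      let ?s = "sqrt (1 + (1 / real (Suc n) * gt t)\<^sup>2)"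
      have "1 \<le> ?s" by simp
      then have "0 < ?s" by linarith
      then have "\<bar>gt t\<bar> / ?s \<le> \<bar>gt t\<bar> / 1"
        by (intro divide_left_mono mult_pos_pos \<open>1 \<le> ?s\<close>) auto
      then have "(1 - t) * (\<bar>gt t\<bar> / ?s) \<le> 1 * \<bar>gt t\<bar>"
        using t \<open>1 \<le> ?s\<close> by (intro mult_mono) auto
      then show "norm ((1 - t) * (\<bar>gt t\<bar> / ?s)) \<le> \<bar>gt t\<bar>"
        using t by (simp add: abs_mult)
    qed
  qed measurable
  then have "(\<lambda>n. S * (\<integral>t. (1 - t) * (\<bar>gt t\<bar> / sqrt (1 + (1 / real (Suc n) * gt t)\<^sup>2)) \<partial>N)\<^sup>2)
      \<longlonglongrightarrow> S * (\<integral>t. (1 - t) * \<bar>gt t\<bar> \<partial>N)\<^sup>2"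
    by (intro tendsto_intros)
  then have "S * (\<integral>t. (1 - t) * \<bar>gt t\<bar> \<partial>N)\<^sup>2 \<le> ?R"
  proof (rule LIMSEQ_le_const2, intro exI allI impI)
    show "S * (\<integral>t. (1 - t) * (\<bar>gt t\<bar> / sqrt (1 + (1 / real (Suc n) * gt t)\<^sup>2)) \<partial>N)\<^sup>2 \<le> ?R" for n
      by (rule main) simp
  qed
  then show ?thesis by (simp add: S_def gt_def)
qed

lemma edge_L1_norm_estimate:
  assumes v: "in_Lp 1 U v" "in_Lp 1 U G" "trace_on_edge U v G p q g"
    and \<phi>: "\<And>t. \<lbrakk>0 < t; t < 1\<rbrakk> \<Longrightarrow> \<phi> (p + t *\<^sub>R (q - p)) = 1 - t"
  shows "edge_L1_norm p q (\<lambda>x. g x * \<phi> x) \<le> C * (Lp_norm 1 U G + \<kappa> * Lp_norm 1 U v)"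
    and "\<lbrakk>in_Lp 2 U v; in_Lp 2 U G\<rbrakk> \<Longrightarrow> inverse (dist p q) * (edge_L1_norm p q (\<lambda>x. g x * \<phi> x))\<^sup>2
      \<le> 2 * C * (Lp_norm 2 U v * Lp_norm 2 U G + \<kappa> * (Lp_norm 2 U v)\<^sup>2)"
proof -
  have eq: "edge_L1_norm p q (\<lambda>x. g x * \<phi> x)
      = dist p q * (\<integral>t. (1 - t) * \<bar>edge_pullback p q g t\<bar> \<partial>N)"
    unfolding edge_L1_norm_def set_lebesgue_integral_def
    by (auto simp: integral_restrict_space edge_pullback_def \<phi> abs_mult indicator_def
        intro!: Bochner_Integration.integral_cong)
  show "edge_L1_norm p q (\<lambda>x. g x * \<phi> x) \<le> C * (Lp_norm 1 U G + \<kappa> * Lp_norm 1 U v)"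
    unfolding eq using trace_estimate_L1[OF v] by simp
  assume "in_Lp 2 U v" "in_Lp 2 U G"
  note L2 = trace_estimate_L2[OF v this]
  have "inverse S * (S * J)\<^sup>2 = S * J\<^sup>2" for S J :: real
    by (cases "S = 0") (auto simp: power2_eq_square)
  with L2 show "inverse (dist p q) * (edge_L1_norm p q (\<lambda>x. g x * \<phi> x))\<^sup>2
      \<le> 2 * C * (Lp_norm 2 U v * Lp_norm 2 U G + \<kappa> * (Lp_norm 2 U v)\<^sup>2)"
    unfolding eq by simp
qed

end

section \<open>Angles and triangulations\<close>

lemma tri_angle_leD:
  assumes "tri_angle a b c \<le> \<alpha>" "0 \<le> \<alpha>" "\<alpha> \<le> pi" "b \<noteq> a" "c \<noteq> a"
  shows "cos \<alpha> * (norm (b - a) * norm (c - a)) \<le> (b - a) \<bullet> (c - a)"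
proof -
  define x where "x = ((b - a) \<bullet> (c - a)) / (norm (b - a) * norm (c - a))"
  have pos: "0 < norm (b - a) * norm (c - a)" using assms by simp
  have "\<bar>(b - a) \<bullet> (c - a)\<bar> \<le> norm (b - a) * norm (c - a)" by (rule Cauchy_Schwarz_ineq2)
  then have "\<bar>x\<bar> \<le> 1" using pos by (simp add: x_def abs_mult)
  then have x: "-1 \<le> x" "x \<le> 1" by auto
  have "cos \<alpha> \<le> cos (arccos x)"
    using assms arccos_lbound[OF x] by (intro cos_monotone_0_pi_le) (auto simp: tri_angle_def x_def)
  then show ?thesis using x pos by (simp add: x_def le_divide_eq)
qed

text \<open>A small sine leaves an angle near zero or near a straight angle; the lower bound
  \<open>-c\<close> on the cosine with \<open>\<epsilon>\<^sup>2 \<le> 1 - c\<^sup>2\<close>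
  excludes the latter.\<close>

lemma inner_ge_of_cross2_less:
  fixes a b :: "real ^ 2"
  assumes "\<bar>cross2 a b\<bar> < \<epsilon> * (norm a * norm b)" "- c * (norm a * norm b) \<le> a \<bullet> b"
    and "0 \<le> c" "\<epsilon>\<^sup>2 \<le> 1 - c\<^sup>2" "0 < \<epsilon>"
  shows "sqrt (1 - \<epsilon>\<^sup>2) * (norm a * norm b) \<le> a \<bullet> b"
proof -
  define n where "n = norm a * norm b"
  have n: "0 \<le> n" by (simp add: n_def)
  have e: "c\<^sup>2 \<le> 1 - \<epsilon>\<^sup>2" "0 \<le> 1 - \<epsilon>\<^sup>2" using assms zero_le_power2[of c] by linarith+
  have "\<bar>cross2 a b\<bar>\<^sup>2 < (\<epsilon> * n)\<^sup>2"
    using assms by (intro power_strict_mono) (auto simp: n_def)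
  then have lt: "(1 - \<epsilon>\<^sup>2) * n\<^sup>2 < (a \<bullet> b)\<^sup>2"
    using cross2_inner_power2[of a b] by (simp add: n_def[symmetric] power_mult_distrib algebra_simps)
  have "0 \<le> a \<bullet> b"
  proof (rule ccontr)
    assume "\<not> 0 \<le> a \<bullet> b"
    then have "\<bar>a \<bullet> b\<bar>\<^sup>2 \<le> (c * n)\<^sup>2"
      using assms by (intro power_mono) (auto simp: n_def)
    also have "\<dots> \<le> (1 - \<epsilon>\<^sup>2) * n\<^sup>2"
      using e by (simp add: power_mult_distrib mult_right_mono)
    finally show False using lt by simp
  qed
  moreover have "(sqrt (1 - \<epsilon>\<^sup>2) * n)\<^sup>2 \<le> (a \<bullet> b)\<^sup>2"
    using lt e by (simp add: power_mult_distrib)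
  ultimately show ?thesis
    unfolding n_def[symmetric] by (rule power2_le_imp_le[rotated])
qed

text \<open>The squared chord between two unit vectors is 2 minus twice the cosine, and
  \<open>1 - \<epsilon>\<^sup>2 \<le> sqrt (1 - \<epsilon>\<^sup>2)\<close>.\<close>

lemma dist_sgn_le:
  fixes a b :: "real ^ 2"
  assumes "a \<noteq> 0" "b \<noteq> 0" "sqrt (1 - \<epsilon>\<^sup>2) * (norm a * norm b) \<le> a \<bullet> b" "0 \<le> \<epsilon>" "\<epsilon> \<le> 1"
  shows "dist (sgn a) (sgn b) \<le> 2 * \<epsilon>"
proof -
  have e: "\<epsilon>\<^sup>2 \<le> 1" using assms by (simp add: power_le_one)
  have "(1 - \<epsilon>\<^sup>2)\<^sup>2 \<le> 1 * (1 - \<epsilon>\<^sup>2)"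
    unfolding power2_eq_square[of "1 - \<epsilon>\<^sup>2"] using e by (intro mult_right_mono) auto
  then have "1 - \<epsilon>\<^sup>2 \<le> sqrt (1 - \<epsilon>\<^sup>2)" using e by (simp add: real_le_rsqrt)
  also have "sqrt (1 - \<epsilon>\<^sup>2) \<le> (a \<bullet> b) / (norm a * norm b)"
    using assms by (simp add: le_divide_eq)
  also have "\<dots> = sgn a \<bullet> sgn b" by (simp add: sgn_div_norm divide_simps)
  finally have s: "1 - \<epsilon>\<^sup>2 \<le> sgn a \<bullet> sgn b" .
  have "(dist (sgn a) (sgn b))\<^sup>2 = 2 - 2 * (sgn a \<bullet> sgn b)"
    using assms norm_sgn[of a] norm_sgn[of b]
    by (simp add: dist_norm power2_norm_eq_inner inner_diff_left inner_diff_right inner_commute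
        norm_eq_1)
  also have "\<dots> \<le> 4 * \<epsilon>\<^sup>2" using s zero_le_power2[of \<epsilon>] by linarith
  also have "\<dots> = (2 * \<epsilon>)\<^sup>2" by (simp add: power_mult_distrib)
  finally show ?thesis by (rule power2_le_imp_le) (use assms in simp)
qed

text \<open>Here \<open>-c\<close> is a lower bound of the cosines of the angles, and \<open>\<epsilon>\<close> the sine of a small angle: if the
  angles at \<open>p\<close> and \<open>q\<close> were both small, the one at \<open>r\<close> would be too large.\<close>

lemma cross2_ge_of_max_angle:
  fixes p q r :: "real ^ 2"
  assumes D: "cross2 (q - p) (r - p) \<noteq> 0"
    and c: "0 \<le> c" "2 * \<epsilon>\<^sup>2 < 1 - c" "\<epsilon>\<^sup>2 \<le> 1 - c\<^sup>2" "0 < \<epsilon>"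
    and angle: "- c * (norm (q - p) * norm (r - p)) \<le> (q - p) \<bullet> (r - p)"
      "- c * (norm (p - q) * norm (r - q)) \<le> (p - q) \<bullet> (r - q)"
      "- c * (norm (p - r) * norm (q - r)) \<le> (p - r) \<bullet> (q - r)"
    and small: "\<bar>cross2 (q - p) (r - p)\<bar> < \<epsilon> * (norm (q - p) * norm (r - p))"
  shows "\<epsilon> * (norm (q - p) * norm (r - q)) \<le> \<bar>cross2 (q - p) (r - p)\<bar>"
proof (rule ccontr)
  let ?D = "cross2 (q - p) (r - p)"
  define na nb nc where "na = norm (q - p)" and "nb = norm (r - p)" and "nc = norm (r - q)"
  assume "\<not> \<epsilon> * (norm (q - p) * norm (r - q)) \<le> \<bar>?D\<bar>"
  then have small2: "\<bar>?D\<bar> < \<epsilon> * (na * nc)" by (simp add: na_def nc_def)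
  have D2: "cross2 (p - q) (r - q) = - ?D" by (simp add: cross2_def algebra_simps)
  have nn: "norm (p - q) = na" "norm (p - r) = nb" "norm (q - r) = nc"
    by (simp_all add: na_def nb_def nc_def norm_minus_commute)
  have pos: "0 < na" "0 < nb" "0 < nc"
    using D D2 by (auto simp: na_def nb_def nc_def cross2_def)
  define s where "s = sqrt (1 - \<epsilon>\<^sup>2)"
  have s: "s\<^sup>2 = 1 - \<epsilon>\<^sup>2" "0 \<le> s"
    using c zero_le_power2[of c] by (auto simp: s_def)
  have X: "s * (na * nb) \<le> (q - p) \<bullet> (r - p)"
    using inner_ge_of_cross2_less[OF small angle(1) c(1,3,4)] by (simp add: s_def na_def nb_def)
  have Y: "s * (na * nc) \<le> (p - q) \<bullet> (r - q)"
    using inner_ge_of_cross2_less[OF _ angle(2) c(1,3,4)] small2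
    by (simp add: D2 s_def nn nc_def)
  have "(s * (na * nb)) * (s * (na * nc)) \<le> ((q - p) \<bullet> (r - p)) * ((p - q) \<bullet> (r - q))"
    using s pos by (intro mult_mono X Y order_trans[OF _ X]) auto
  moreover have "(s * (na * nb)) * (s * (na * nc)) = (1 - \<epsilon>\<^sup>2) * (na\<^sup>2 * (nb * nc))"
    unfolding s(1)[symmetric] by (simp add: power2_eq_square)
  moreover have "\<bar>?D\<bar> * \<bar>?D\<bar> \<le> (\<epsilon> * (na * nb)) * (\<epsilon> * (na * nc))"
    using small small2 by (intro mult_mono) (auto simp: na_def nb_def)
  moreover have "(\<epsilon> * (na * nb)) * (\<epsilon> * (na * nc)) = \<epsilon>\<^sup>2 * (na\<^sup>2 * (nb * nc))"
    by (simp add: power2_eq_square)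
  \<comment> \<open>The addition theorem cos r = sin p sin q - cos p cos q for angles of sum pi,
    multiplied by side lengths. With both sines below \<epsilon> the cosine at \<open>r\<close> is
    at most 2 \<epsilon>^2 - 1, hence below \<open>-c\<close>.\<close>
  moreover have "((p - r) \<bullet> (q - r)) * na\<^sup>2
      = \<bar>?D\<bar> * \<bar>?D\<bar> - ((q - p) \<bullet> (r - p)) * ((p - q) \<bullet> (r - q))"
    unfolding na_def power2_norm_eq_inner
    by (simp add: inner_vec_def sum_2 cross2_def algebra_simps)
  moreover have "(- c * (nb * nc)) * na\<^sup>2 \<le> ((p - r) \<bullet> (q - r)) * na\<^sup>2"
    using angle(3) by (intro mult_right_mono) (auto simp: nn)
  ultimately have "(- c * (nb * nc)) * na\<^sup>2
      \<le> \<epsilon>\<^sup>2 * (na\<^sup>2 * (nb * nc)) - (1 - \<epsilon>\<^sup>2) * (na\<^sup>2 * (nb * nc))" by linarith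
  then have "(1 - c) * (na\<^sup>2 * (nb * nc)) \<le> (2 * \<epsilon>\<^sup>2) * (na\<^sup>2 * (nb * nc))"
    by (simp add: algebra_simps)
  then show False using c pos by (simp add: mult_le_cancel_right)
qed

text \<open>Pigeonhole: one of the finitely many segments meets \<open>closed_segment p q\<close> in
  infinitely many points, and two of these determine the direction up to sign.\<close>

lemma closed_segment_subset_segments_direction:
  fixes p q :: "'a::euclidean_space"
  assumes E: "finite E" "closed_segment p q \<subseteq> (\<Union>(a, b)\<in>E. closed_segment a b)" and "p \<noteq> q"
  obtains a b where "(a, b) \<in> E" "sgn (q - p) = sgn (b - a) \<or> sgn (q - p) = - sgn (b - a)"
proof -
  have eq: "closed_segment p q = (\<Union>e\<in>E. closed_segment p q \<inter> closed_segment (fst e) (snd e))"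
    using E(2) by (auto simp: case_prod_unfold)
  have "infinite (closed_segment p q)" using \<open>p \<noteq> q\<close> by simp
  moreover have "finite (closed_segment p q)"
    if "\<forall>e\<in>E. finite (closed_segment p q \<inter> closed_segment (fst e) (snd e))"
    by (subst eq) (rule finite_UN_I[OF E(1)], use that in blast)
  ultimately have "\<exists>e\<in>E. infinite (closed_segment p q \<inter> closed_segment (fst e) (snd e))"
    by blast
  then obtain a b where ab: "(a, b) \<in> E" "infinite (closed_segment p q \<inter> closed_segment a b)"
    by auto
  then obtain x where x: "x \<in> closed_segment p q \<inter> closed_segment a b"
    using infinite_imp_nonempty by blast
  obtain y where y: "y \<in> closed_segment p q \<inter> closed_segment a b" "y \<noteq> x"
    using ab(2) by (metis finite.emptyI finite_insert finite_subset insertI1 subsetI)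
  have seg: "\<exists>t. u = c + t *\<^sub>R (d - c)" if u: "u \<in> closed_segment c d" for u c d :: 'a
  proof -
    obtain t where "u = (1 - t) *\<^sub>R c + t *\<^sub>R d" using u by (auto simp: in_segment)
    then have "u = c + t *\<^sub>R (d - c)" by (simp add: algebra_simps)
    then show ?thesis ..
  qed
  obtain s1 s2 t1 t2 where st: "x = p + s1 *\<^sub>R (q - p)" "y = p + s2 *\<^sub>R (q - p)"
    "x = a + t1 *\<^sub>R (b - a)" "y = a + t2 *\<^sub>R (b - a)"
    using seg[of x p q] seg[of y p q] seg[of x a b] seg[of y a b] x y by blast
  have eq1: "y - x = (s2 - s1) *\<^sub>R (q - p)" unfolding st(1,2) by (simp add: algebra_simps)
  have eq2: "y - x = (t2 - t1) *\<^sub>R (b - a)" unfolding st(3,4) by (simp add: algebra_simps)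
  have "sgn (y - x) = sgn (s2 - s1) *\<^sub>R sgn (q - p)" "sgn (y - x) = sgn (t2 - t1) *\<^sub>R sgn (b - a)"
    unfolding sgn_scaleR[symmetric] using eq1 eq2 by simp_all
  moreover have "s2 - s1 \<noteq> 0" "t2 - t1 \<noteq> 0" using eq1 eq2 y(2) by auto
  ultimately have "sgn (q - p) = sgn (b - a) \<or> sgn (q - p) = - sgn (b - a)"
    by (auto simp: sgn_real_def split: if_splits)
  then show ?thesis using that ab(1) by blast
qed

text \<open>For the frontier of the domain, \<theta> can be chosen independently of any
  triangulation; through it the domain enters the final constant.\<close>

definition min_direction_gap :: "real \<Rightarrow> point set \<Rightarrow> bool" where
  "min_direction_gap \<theta> F \<longleftrightarrow> 0 < \<theta> \<and> (\<forall>p q q'. closed_segment p q \<subseteq> F \<longrightarrow> closed_segment p q' \<subseteq> F \<longrightarrow>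
     q \<noteq> p \<longrightarrow> q' \<noteq> p \<longrightarrow> dist (sgn (q - p)) (sgn (q' - p)) < \<theta> \<longrightarrow> sgn (q - p) = sgn (q' - p))"

lemma polygonal_domain_direction_gap:
  assumes "polygonal_domain \<Omega>"
  obtains \<theta> where "min_direction_gap \<theta> (frontier \<Omega>)"
proof -
  obtain E where E: "finite E" "frontier \<Omega> = (\<Union>(a, b)\<in>E. closed_segment a b)"
    using assms unfolding polygonal_domain_def by blast
  define S where "S = (\<lambda>(a, b). sgn (b - a)) ` E \<union> (\<lambda>(a, b). - sgn (b - a)) ` E"
  \<comment> \<open>The element 1 keeps the set nonempty, so that \<open>Min P\<close> is a positive
    number even without two distinct directions.\<close>
  define P where "P = insert 1 {d \<in> (\<lambda>(x, y). dist x y) ` (S \<times> S). 0 < d}"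
  have "finite P" unfolding P_def S_def using E by auto
  moreover have "P \<noteq> {}" "\<forall>d\<in>P. 0 < d" by (auto simp: P_def)
  ultimately have pos: "0 < Min P" by simp
  have dir: "sgn (q - p) \<in> S" if seg: "closed_segment p q \<subseteq> frontier \<Omega>" "q \<noteq> p" for p q
  proof -
    obtain a b where "(a, b) \<in> E" "sgn (q - p) = sgn (b - a) \<or> sgn (q - p) = - sgn (b - a)"
      using closed_segment_subset_segments_direction[OF E(1), of p q] seg E(2) by auto
    then show ?thesis unfolding S_def by force
  qed
  have "sgn (q - p) = sgn (q' - p)"
    if "closed_segment p q \<subseteq> frontier \<Omega>" "closed_segment p q' \<subseteq> frontier \<Omega>" "q \<noteq> p" "q' \<noteq> p"
      "dist (sgn (q - p)) (sgn (q' - p)) < Min P" for p q q'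
  proof (rule ccontr)
    assume "sgn (q - p) \<noteq> sgn (q' - p)"
    moreover have "(sgn (q - p), sgn (q' - p)) \<in> S \<times> S" using dir that by simp
    then have "dist (sgn (q - p)) (sgn (q' - p)) \<in> (\<lambda>(x, y). dist x y) ` (S \<times> S)"
      by (rule rev_image_eqI) simp
    ultimately have "dist (sgn (q - p)) (sgn (q' - p)) \<in> P" by (simp add: P_def)
    then have "Min P \<le> dist (sgn (q - p)) (sgn (q' - p))" using \<open>finite P\<close> by simp
    then show False using that by simp
  qed
  then have "min_direction_gap (Min P) (frontier \<Omega>)"
    unfolding min_direction_gap_def using pos by blast
  then show ?thesis by (rule that)
qed

section \<open>Triangles, nodes and patches\<close>

locale triangulation =
  fixes \<Omega> :: "point set" and \<T> :: "triangle set"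
  assumes open_\<Omega>: "open \<Omega>" and tri: "polygon_triangulation \<Omega> \<T>"
begin

lemma finite_\<T>: "finite \<T>"
  and cover: "(\<Union>T\<in>\<T>. convex hull T) = closure \<Omega>"
  and conforming: "\<lbrakk>T \<in> \<T>; T' \<in> \<T>; T \<noteq> T'\<rbrakk> \<Longrightarrow>
    convex hull T \<inter> convex hull T' \<inter> \<Omega> = convex hull (T \<inter> T') \<inter> \<Omega>"
  using tri unfolding polygon_triangulation_def by simp_all

lemma edge_in_\<Omega>:
  assumes "T \<in> \<T>" "p \<in> T" "q \<in> T" "p \<noteq> q" "\<not> closed_segment p q \<subseteq> frontier \<Omega>"
  shows "open_segment p q \<subseteq> \<Omega>"
proof -
  have "\<forall>T\<in>\<T>. \<forall>a\<in>T. \<forall>b\<in>T. a \<noteq> b \<longrightarrow>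
        open_segment a b \<subseteq> \<Omega> \<or> closed_segment a b \<subseteq> frontier \<Omega>"
    using tri by (simp add: polygon_triangulation_def)
  then show ?thesis using assms by blast
qed

lemma triangleD:
  assumes "T \<in> \<T>"
  shows "card T = 3" "\<not> affine_dependent T" "interior (convex hull T) \<subseteq> \<Omega>" "finite T"
  using assms tri card_eq_0_iff[of T] unfolding polygon_triangulation_def by fastforce+

lemma third_vertex:
  assumes "T \<in> \<T>" "p \<in> T" "q \<in> T" "p \<noteq> q"
  obtains r where "T = {p, q, r}" "r \<noteq> p" "r \<noteq> q"
proof -
  have "card (T - {p, q}) = 1" using assms triangleD[OF assms(1)] by simp
  then obtain r where "T - {p, q} = {r}" by (rule card_1_singletonE)
  then show ?thesis using that[of r] assms by auto
qed

lemma triangle_cases: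
  assumes "T \<in> \<T>" "p \<in> T"
  obtains q r where "T = {p, q, r}" "p \<noteq> q" "p \<noteq> r" "q \<noteq> r"
proof -
  have "T \<noteq> {p}" using triangleD(1)[OF assms(1)] by auto
  then obtain q where "q \<in> T" "q \<noteq> p" using assms by blast
  then show ?thesis using third_vertex[OF assms, of q] that by metis
qed

lemma cross2_nonzero:
  assumes "{p, q, r} \<in> \<T>"
  shows "cross2 (q - p) (r - p) \<noteq> 0"
proof
  assume "cross2 (q - p) (r - p) = 0"
  then have "p = q \<or> p = r \<or> q = r \<or> affine_dependent {p, q, r}"
    using collinear_iff_cross2 collinear_3_eq_affine_dependent by blast
  then show False using triangleD[OF assms] by (auto simp: card_insert_if split: if_splits)
qed

lemma area_triangle: "area (convex hull {p, q, r}) = \<bar>cross2 (q - p) (r - p)\<bar> / 2"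
  by (simp add: area_def content_triangle cross2_def algebra_simps abs_minus_commute)

lemma H_tri:
  assumes "T \<in> \<T>"
  shows "\<lbrakk>a \<in> T; b \<in> T\<rbrakk> \<Longrightarrow> dist a b \<le> H_tri T"
    and "(\<And>a b. \<lbrakk>a \<in> T; b \<in> T\<rbrakk> \<Longrightarrow> dist a b \<le> d) \<Longrightarrow> H_tri T \<le> d"
    and "0 < H_tri T"
proof -
  have eq: "{dist a b | a b. a \<in> T \<and> b \<in> T} = (\<lambda>(a, b). dist a b) ` (T \<times> T)" by auto
  have fin: "finite {dist a b | a b. a \<in> T \<and> b \<in> T}"
    unfolding eq using triangleD(4)[OF assms] by auto
  have "T \<noteq> {}" using triangleD[OF assms] by auto
  then have ne: "{dist a b | a b. a \<in> T \<and> b \<in> T} \<noteq> {}" by auto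
  show *: "\<lbrakk>a \<in> T; b \<in> T\<rbrakk> \<Longrightarrow> dist a b \<le> H_tri T" for a b
    unfolding H_tri_def by (rule Max_ge[OF fin]) auto
  show "(\<And>a b. \<lbrakk>a \<in> T; b \<in> T\<rbrakk> \<Longrightarrow> dist a b \<le> d) \<Longrightarrow> H_tri T \<le> d"
    unfolding H_tri_def Max_le_iff[OF fin ne] by blast
  from \<open>T \<noteq> {}\<close> obtain a where "a \<in> T" by auto
  then obtain b where "b \<in> T" "a \<noteq> b" using triangle_cases[OF assms, of a] by blast
  then show "0 < H_tri T" using *[of a b] \<open>a \<in> T\<close> by (meson less_le_trans zero_less_dist_iff)
qed

lemma h_tri_H_tri:
  assumes "{p, q, r} \<in> \<T>"
  shows "h_tri {p, q, r} * H_tri {p, q, r} = \<bar>cross2 (q - p) (r - p)\<bar>"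
  using H_tri(3)[OF assms] by (simp add: h_tri_def area_triangle)

lemma h_tri_pos: "T \<in> \<T> \<Longrightarrow> 0 < h_tri T"
  using triangleD[of T] H_tri(3)[of T] cross2_nonzero h_tri_H_tri
  by (metis card_3_iff zero_less_abs_iff zero_less_mult_pos2)

text \<open>Twice the area is at most the product of two edge lengths, one of which is at most
  \<open>H_tri T\<close>.\<close>

lemma h_tri_le_dist:
  assumes "T \<in> \<T>" "p \<in> T" "q \<in> T" "p \<noteq> q"
  shows "h_tri T \<le> dist p q"
proof -
  obtain r where r: "T = {p, q, r}" using third_vertex[OF assms] by metis
  have "h_tri T * H_tri T \<le> norm (q - p) * norm (r - p)"
    using h_tri_H_tri cross2_le_norm assms r by metis
  also have "\<dots> \<le> norm (q - p) * H_tri T"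
    using H_tri(1)[OF assms(1), of r p] r by (intro mult_left_mono) (auto simp: dist_norm)
  finally show ?thesis
    using H_tri(3)[OF assms(1)] by (simp add: dist_norm norm_minus_commute)
qed

text \<open>Adjacency at a point is symmetric, so a sector is an equivalence class and each of its
  triangles generates the same node.\<close>

lemma node_elements:
  assumes "z \<in> nodes \<Omega> \<T>" "T \<in> elements z"
  shows "T \<in> \<T>" "pos z \<in> T" "node_of \<Omega> \<T> T (pos z) = z"
    and "(T, T') \<in> adjacent_at \<Omega> \<T> (pos z) \<Longrightarrow> T' \<in> elements z"
proof -
  obtain T0 p where z: "z = (p, (adjacent_at \<Omega> \<T> p)\<^sup>* `` {T0})" "T0 \<in> \<T>" "p \<in> T0"
    using assms(1) unfolding nodes_def node_of_def by blast
  have T: "(T0, T) \<in> (adjacent_at \<Omega> \<T> p)\<^sup>*" using assms(2) z by simp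
  then have "T \<in> \<T> \<and> p \<in> T"
    by (induction rule: rtrancl_induct) (auto simp: z adjacent_at_def)
  then show "T \<in> \<T>" "pos z \<in> T" using z by auto
  have "sym (adjacent_at \<Omega> \<T> p)" by (auto simp: sym_def adjacent_at_def)
  then have "sym ((adjacent_at \<Omega> \<T> p)\<^sup>*)" by (rule sym_rtrancl)
  then have "(T, T0) \<in> (adjacent_at \<Omega> \<T> p)\<^sup>*" using T by (auto dest: symD)
  then have "(adjacent_at \<Omega> \<T> p)\<^sup>* `` {T} = (adjacent_at \<Omega> \<T> p)\<^sup>* `` {T0}"
    using T by (auto intro: rtrancl_trans)
  then show "node_of \<Omega> \<T> T (pos z) = z" by (simp add: node_of_def z(1))
  show "(T, T') \<in> adjacent_at \<Omega> \<T> (pos z) \<Longrightarrow> T' \<in> elements z"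
    using T z by (auto intro: rtrancl.rtrancl_into_rtrancl)
qed

definition neighbours :: "node \<Rightarrow> (triangle \<times> triangle) set" where
  "neighbours z = adjacent_at \<Omega> \<T> (pos z) \<inter> elements z \<times> elements z"

lemma neighboursE:
  assumes "(T, T') \<in> neighbours z"
  obtains q where "q \<noteq> pos z" "q \<in> T" "q \<in> T'" "q \<in> gamma \<Omega> z" "T \<in> elements z" "T' \<in> elements z"
  using assms
  by (auto simp: neighbours_def adjacent_at_def gamma_def edges_at_def boundary_edges_def)

lemma finite_elements:
  assumes "z \<in> nodes \<Omega> \<T>"
  shows "finite (elements z)"
  by (rule finite_subset[OF _ finite_\<T>]) (use node_elements(1)[OF assms] in auto)

text \<open>In a finite relation reachability needs no more steps than the relation has pairs. The
  count \<open>m * m\<close> is crude but depends on \<open>m\<close> alone.\<close>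

lemma neighbours_chain:
  assumes z: "z \<in> nodes \<Omega> \<T>" and TT': "T \<in> elements z" "T' \<in> elements z"
    and m: "card (elements z) \<le> m"
  obtains n where "n \<le> m * m" "(T, T') \<in> neighbours z ^^ n"
proof -
  obtain T0 p where z0: "z = (p, (adjacent_at \<Omega> \<T> p)\<^sup>* `` {T0})"
    using z unfolding nodes_def node_of_def by blast
  have star: "(T0, S) \<in> (neighbours z)\<^sup>*" if "S \<in> elements z" for S
  proof -
    have "(T0, S) \<in> (adjacent_at \<Omega> \<T> p)\<^sup>*" using that z0 by simp
    then show ?thesis
    proof (induction rule: rtrancl_induct)
      case (step S S')
      then have "(S, S') \<in> neighbours z"
        by (auto simp: neighbours_def z0 intro: rtrancl.rtrancl_into_rtrancl)
      with step show ?case by (auto intro: rtrancl.rtrancl_into_rtrancl)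
    qed simp
  qed
  have "sym (neighbours z)" by (auto simp: sym_def neighbours_def adjacent_at_def)
  then have "sym ((neighbours z)\<^sup>*)" by (rule sym_rtrancl)
  then have "(T, T') \<in> (neighbours z)\<^sup>*"
    using star[OF TT'(1)] star[OF TT'(2)] by (meson rtrancl_trans symD)
  moreover have sub: "neighbours z \<subseteq> elements z \<times> elements z" by (simp add: neighbours_def)
  have fin: "finite (elements z \<times> elements z)" using finite_elements[OF z] by simp
  then have "finite (neighbours z)" using sub finite_subset by blast
  ultimately obtain n where "n \<le> card (neighbours z)" "(T, T') \<in> neighbours z ^^ n"
    by (auto simp: rtrancl_finite_eq_relpow)
  moreover have "card (neighbours z) \<le> m * m"
  proof -
    have "card (neighbours z) \<le> card (elements z) * card (elements z)"
      using card_mono[OF fin sub] by (simp add: card_cartesian_product)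
    also have "\<dots> \<le> m * m" using m by (intro mult_mono) auto
    finally show ?thesis .
  qed
  ultimately show ?thesis using that by (meson order_trans)
qed

text \<open>A small ball about \<open>x\<close> avoids the finitely many triangles not containing
  \<open>x\<close>. If \<open>T'\<close> contains \<open>x\<close>, conformity puts \<open>x\<close>
  into the hull of \<open>T \<inter> T'\<close>, and affine independence of \<open>T\<close> into
  the hull of the points of \<open>{p, q}\<close> in \<open>T'\<close>. As \<open>x\<close> is
  neither \<open>p\<close> nor \<open>q\<close>, both belong to \<open>T'\<close>.\<close>

lemma edge_neighbourhood:
  assumes T: "T \<in> \<T>" "p \<in> T" "q \<in> T" "p \<noteq> q" and "open_segment p q \<subseteq> \<Omega>" and x: "x \<in> open_segment p q"
  obtains d where "0 < d" "ball x d \<subseteq> \<Omega>"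
    "\<And>y. y \<in> ball x d \<Longrightarrow> \<exists>T'\<in>\<T>. p \<in> T' \<and> q \<in> T' \<and> y \<in> convex hull T'"
proof -
  define K where "K = (\<Union>T'\<in>{T' \<in> \<T>. x \<notin> convex hull T'}. convex hull T')"
  have "closed K"
    unfolding K_def using finite_\<T> triangleD(4)
    by (intro closed_UN) (auto intro!: compact_imp_closed finite_imp_compact_convex_hull)
  then have "open (\<Omega> - K)" using open_\<Omega> by auto
  moreover have x\<Omega>: "x \<in> \<Omega>" using assms by auto
  then have "x \<in> \<Omega> - K" by (auto simp: K_def)
  ultimately obtain d where d: "0 < d" "ball x d \<subseteq> \<Omega> - K"
    using open_contains_ball by blast
  have "\<exists>T'\<in>\<T>. p \<in> T' \<and> q \<in> T' \<and> y \<in> convex hull T'" if "y \<in> ball x d" for y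
  proof -
    have "y \<in> \<Omega>" "y \<notin> K" using that d by auto
    then have "y \<in> closure \<Omega>" using closure_subset by auto
    then obtain T' where T': "T' \<in> \<T>" "y \<in> convex hull T'"
      unfolding cover[symmetric] by blast
    then have xT': "x \<in> convex hull T'" using \<open>y \<notin> K\<close> by (auto simp: K_def)
    have xpq: "x \<in> convex hull {p, q}"
      using x by (simp add: open_segment_def segment_convex_hull)
    have xT: "x \<in> convex hull T" using xpq T by (meson empty_subsetI hull_mono insert_subset subsetD)
    have "x \<in> convex hull (T \<inter> T')"
    proof (cases "T = T'")
      case False
      then show ?thesis using xT xT' x\<Omega> conforming[OF T(1) T'(1)] by blast
    qed (use xT in simp)
    moreover have "\<not> affine_dependent ({p, q} \<union> T \<inter> T')"
      by (rule affine_independent_subset[OF triangleD(2)[OF T(1)]]) (use T in auto)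
    ultimately have "x \<in> convex hull ({p, q} \<inter> (T \<inter> T'))"
      using xpq convex_hull_Int by blast
    moreover have "x \<noteq> p" "x \<noteq> q" using x by (auto simp: open_segment_def)
    ultimately have "p \<in> T'" "q \<in> T'"
      using T by (auto simp: Int_insert_left split: if_splits)
    then show ?thesis using T' by blast
  qed
  with d show ?thesis using that by blast
qed

lemma gammaE:
  assumes "z \<in> nodes \<Omega> \<T>" "q \<in> gamma \<Omega> z"
  obtains T where "T \<in> elements z" "q \<in> T" "q \<noteq> pos z" "\<not> closed_segment (pos z) q \<subseteq> frontier \<Omega>"
  using assms by (auto simp: gamma_def edges_at_def boundary_edges_def)

text \<open>Triangles having the interior edge in common are adjacent through it, hence belong to
  the same sector.\<close>

lemma edge_neighbourhood_patch:
  assumes z: "z \<in> nodes \<Omega> \<T>" and q: "q \<in> gamma \<Omega> z" and x: "x \<in> open_segment (pos z) q"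
  obtains d where "0 < d" "ball x d \<subseteq> \<Omega>"
    "\<And>y. y \<in> ball x d \<Longrightarrow> \<exists>T'\<in>elements z. y \<in> convex hull T'"
proof -
  obtain T where T: "T \<in> elements z" "q \<in> T" "q \<noteq> pos z" "\<not> closed_segment (pos z) q \<subseteq> frontier \<Omega>"
    using gammaE[OF z q] .
  note T\<T> = node_elements(1,2)[OF z T(1)]
  have sub: "open_segment (pos z) q \<subseteq> \<Omega>"
    using edge_in_\<Omega>[OF T\<T> T(2)] T by auto
  obtain d where d: "0 < d" "ball x d \<subseteq> \<Omega>"
    "\<And>y. y \<in> ball x d \<Longrightarrow> \<exists>T'\<in>\<T>. pos z \<in> T' \<and> q \<in> T' \<and> y \<in> convex hull T'"
    using edge_neighbourhood[OF T\<T> T(2) _ sub x] T(3) by metis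
  have "T' \<in> elements z" if "T' \<in> \<T>" "pos z \<in> T'" "q \<in> T'" for T'
    by (rule node_elements(4)[OF z T(1)])
       (use that T T\<T> in \<open>auto simp: adjacent_at_def\<close>)
  with d show ?thesis using that by blast
qed

lemma open_segment_subset_open_patch:
  assumes z: "z \<in> nodes \<Omega> \<T>" and q: "q \<in> gamma \<Omega> z"
  shows "open_segment (pos z) q \<subseteq> open_patch \<Omega> z"
proof
  fix x assume "x \<in> open_segment (pos z) q"
  then obtain d where d: "0 < d" "ball x d \<subseteq> \<Omega>"
    "\<And>y. y \<in> ball x d \<Longrightarrow> \<exists>T'\<in>elements z. y \<in> convex hull T'"
    using edge_neighbourhood_patch[OF z q] by metis
  then have "ball x d \<subseteq> patch z" by (auto simp: patch_def)
  then have "ball x d \<subseteq> interior (patch z)" by (simp add: interior_maximal)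
  then show "x \<in> open_patch \<Omega> z" using d by (auto simp: open_patch_def)
qed

lemma interior_triangle_subset_open_patch:
  assumes z: "z \<in> nodes \<Omega> \<T>" and T: "T \<in> elements z"
  shows "interior (convex hull T) \<subseteq> open_patch \<Omega> z"
proof -
  have "convex hull T \<subseteq> patch z" using T by (auto simp: patch_def)
  then show ?thesis
    using interior_mono triangleD(3)[OF node_elements(1)[OF z T]] by (auto simp: open_patch_def)
qed

lemma open_open_patch: "open (open_patch \<Omega> z)"
  using open_\<Omega> by (auto simp: open_patch_def)

text \<open>One affine piece with the edge as a side suffices. Its value at \<open>q\<close> is 0
  because a node at \<open>q\<close> differs from \<open>z\<close> already in its position.\<close>

lemma hat_on_edge:
  assumes z: "z \<in> nodes \<Omega> \<T>" and q: "q \<in> gamma \<Omega> z" and \<phi>: "hat_function \<Omega> \<T> z \<phi>"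
    and t: "0 < t" "t < 1"
  shows "\<phi> (pos z + t *\<^sub>R (q - pos z)) = 1 - t"
proof -
  let ?p = "pos z" and ?x = "pos z + t *\<^sub>R (q - pos z)"
  obtain T where T: "T \<in> elements z" "q \<in> T" "q \<noteq> ?p" using gammaE[OF z q] .
  note T\<T> = node_elements[OF z T(1)]
  have x: "?x \<in> open_segment ?p q" using T(3) t by (intro mem_open_segment_affine) auto
  then have "?x \<in> \<Omega>" using open_segment_subset_open_patch[OF z q] by (auto simp: open_patch_def)
  moreover have "?x \<in> convex hull {?p, q}"
    using x by (simp add: open_segment_def segment_convex_hull)
  then have "?x \<in> convex hull T" using T\<T> T by (meson empty_subsetI hull_mono insert_subset subsetD)
  moreover obtain c d where cd: "\<And>y. y \<in> convex hull T \<inter> \<Omega> \<Longrightarrow> \<phi> y = c + d \<bullet> y"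
    "\<And>y. y \<in> T \<Longrightarrow> c + d \<bullet> y = (if node_of \<Omega> \<T> T y = z then 1 else 0)"
    using \<phi> T\<T>(1) unfolding hat_function_def by meson
  ultimately have "\<phi> ?x = c + d \<bullet> ?x" by blast
  moreover have "c + d \<bullet> ?p = 1" using cd(2)[OF T\<T>(2)] T\<T>(3) by simp
  moreover have "node_of \<Omega> \<T> T q \<noteq> z" using T(3) by (auto simp: node_of_def)
  then have "c + d \<bullet> q = 0" using cd(2)[OF T(2)] by simp
  moreover have "d \<bullet> ?x = d \<bullet> ?p + t * (d \<bullet> q - d \<bullet> ?p)"
    by (simp add: inner_add_right inner_diff_right)
  moreover have "c + (d \<bullet> ?p + t * (d \<bullet> q - d \<bullet> ?p))
      = (c + d \<bullet> ?p) + t * ((c + d \<bullet> q) - (c + d \<bullet> ?p))"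
    by (simp add: algebra_simps)
  ultimately show ?thesis by simp
qed

end

section \<open>Edges around a node\<close>

text \<open>The bracket of the first bound, as an extended real so that it makes sense without
  integrability.\<close>

definition weighted_W11_norm ::
    "'a::euclidean_space set \<Rightarrow> real \<Rightarrow> ('a \<Rightarrow> real) \<Rightarrow> ('a \<Rightarrow> 'a) \<Rightarrow> ennreal" where
  "weighted_W11_norm U \<kappa> w Dw =
     (\<integral>\<^sup>+x\<in>U. norm (Dw x) \<partial>lborel) + ennreal \<kappa> * (\<integral>\<^sup>+x\<in>U. \<bar>w x\<bar> \<partial>lborel)"

lemma weighted_W11_norm_mono:
  assumes "\<kappa> \<le> D * \<kappa>'" "1 \<le> D" "0 \<le> \<kappa>'"
  shows "weighted_W11_norm U \<kappa> w Dw \<le> ennreal D * weighted_W11_norm U \<kappa>' w Dw"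
proof -
  have "ennreal 1 * (\<integral>\<^sup>+x\<in>U. norm (Dw x) \<partial>lborel) \<le> ennreal D * (\<integral>\<^sup>+x\<in>U. norm (Dw x) \<partial>lborel)"
    using assms by (intro mult_right_mono ennreal_leI) auto
  moreover have "ennreal \<kappa> * (\<integral>\<^sup>+x\<in>U. \<bar>w x\<bar> \<partial>lborel)
      \<le> ennreal (D * \<kappa>') * (\<integral>\<^sup>+x\<in>U. \<bar>w x\<bar> \<partial>lborel)"
    using assms by (intro mult_right_mono ennreal_leI) auto
  ultimately show ?thesis
    using assms unfolding weighted_W11_norm_def
    by (simp add: distrib_left ennreal_mult mult.assoc add_mono)
qed

text \<open>For a triangle with vertex \<open>p\<close>: the sine of its angle at \<open>p\<close>
  is at least \<epsilon>.\<close>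

definition wide :: "real \<Rightarrow> point \<Rightarrow> triangle \<Rightarrow> bool" where
  "wide \<epsilon> p T \<longleftrightarrow> (\<forall>q\<in>T - {p}. \<forall>r\<in>T - {p}. q \<noteq> r \<longrightarrow>
     \<epsilon> * (norm (q - p) * norm (r - p)) \<le> \<bar>cross2 (q - p) (r - p)\<bar>)"

lemma wide_iff:
  assumes "p \<noteq> q" "p \<noteq> r" "q \<noteq> r"
  shows "wide \<epsilon> p {p, q, r} \<longleftrightarrow>
    \<epsilon> * (norm (q - p) * norm (r - p)) \<le> \<bar>cross2 (q - p) (r - p)\<bar>"
proof -
  have "{p, q, r} - {p} = {q, r}" using assms by auto
  moreover have "\<bar>cross2 (r - p) (q - p)\<bar> = \<bar>cross2 (q - p) (r - p)\<bar>"
    by (simp add: cross2_def abs_minus_commute mult.commute)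
  moreover have "norm (r - p) * norm (q - p) = norm (q - p) * norm (r - p)" by simp
  ultimately show ?thesis using assms(3) unfolding wide_def by (simp only: ball_simps) metis
qed

context triangulation
begin

section \<open>Existence of a wide angle at every node\<close>

lemma elements_nonempty:
  assumes "z \<in> nodes \<Omega> \<T>"
  shows "elements z \<noteq> {}"
proof -
  obtain T p where "z = (p, (adjacent_at \<Omega> \<T> p)\<^sup>* `` {T})"
    using assms unfolding nodes_def node_of_def by blast
  then have "T \<in> elements z" by simp
  then show ?thesis by blast
qed

text \<open>All triangles of the patch lie in the half plane with outer normal \<open>n\<close>
  whose boundary line carries the edge. Around the midpoint of an interior edge the patch would
  contain a ball, and so points beyond that line.\<close>

lemma extreme_edge_in_frontier:
  assumes z: "z \<in> nodes \<Omega> \<T>" and q: "q \<in> edges_at z" and n: "n \<noteq> 0"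
    and ext: "n \<bullet> (q - pos z) = 0" "\<And>q'. q' \<in> edges_at z \<Longrightarrow> n \<bullet> (q' - pos z) \<le> 0"
  shows "closed_segment (pos z) q \<subseteq> frontier \<Omega>"
proof (rule ccontr)
  assume "\<not> closed_segment (pos z) q \<subseteq> frontier \<Omega>"
  then have q\<gamma>: "q \<in> gamma \<Omega> z" using q by (simp add: gamma_def boundary_edges_def)
  define x where "x = pos z + (1 / 2) *\<^sub>R (q - pos z)"
  have "x \<in> open_segment (pos z) q"
    unfolding x_def using q by (intro mem_open_segment_affine) (auto simp: edges_at_def)
  then obtain d where d: "0 < d" "\<And>y. y \<in> ball x d \<Longrightarrow> \<exists>T'\<in>elements z. y \<in> convex hull T'"
    using edge_neighbourhood_patch[OF z q\<gamma>] by metis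
  define y where "y = x + (d / 2 / norm n) *\<^sub>R n"
  have "y \<in> ball x d" using d n by (simp add: y_def dist_norm)
  then obtain T' where T': "T' \<in> elements z" "y \<in> convex hull T'" using d by blast
  have "T' \<subseteq> {y. n \<bullet> y \<le> n \<bullet> pos z}"
  proof
    fix q' assume "q' \<in> T'"
    then have "q' = pos z \<or> q' \<in> edges_at z" using T' by (auto simp: edges_at_def)
    then show "q' \<in> {y. n \<bullet> y \<le> n \<bullet> pos z}" using ext(2) by (auto simp: inner_diff_right)
  qed
  then have "convex hull T' \<subseteq> {y. n \<bullet> y \<le> n \<bullet> pos z}"
    by (intro hull_minimal convex_halfspace_le)
  then have "n \<bullet> y \<le> n \<bullet> pos z" using T' by auto
  moreover have "n \<bullet> y = n \<bullet> pos z + d / 2 / norm n * (n \<bullet> n)"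
    using ext(1) by (simp add: y_def x_def inner_add_right)
  moreover have "0 < d / 2 / norm n * (n \<bullet> n)" using d n by simp
  ultimately show False by simp
qed

text \<open>Otherwise the patch would be a narrow cone near the node, bounded by two edges in the frontier
  of the domain.\<close>

lemma not_all_narrow:
  assumes z: "z \<in> nodes \<Omega> \<T>" and m: "card (elements z) \<le> m"
    and gap: "min_direction_gap \<theta> (frontier \<Omega>)"
    and \<epsilon>: "0 < \<epsilon>" "2 * (2 * \<epsilon> * (real (m * m) + 1)) < \<theta>" "2 * \<epsilon> * (real (m * m) + 1) < 1"
  shows "\<exists>T\<in>elements z. \<exists>q\<in>T - {pos z}. \<exists>r\<in>T - {pos z}.
    q \<noteq> r \<and> 2 * \<epsilon> < dist (sgn (q - pos z)) (sgn (r - pos z))"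
proof (rule ccontr)
  assume neg: "\<not> ?thesis"
  define dir where "dir q = sgn (q - pos z)" for q
  have step: "dist (dir q) (dir r) \<le> 2 * \<epsilon>"
    if "T \<in> elements z" "q \<in> T - {pos z}" "r \<in> T - {pos z}" for T q r
    using neg that \<epsilon>(1) by (cases "q = r") (auto simp: dir_def not_less)
  \<comment> \<open>A path of \<open>n\<close> steps visits \<open>n + 1\<close> triangles,
    consecutive ones sharing an edge at the node, and each triangle turns the direction by at most
    \<open>2 * \<epsilon>\<close>.\<close>
  have chain: "dist (dir q) (dir q') \<le> 2 * \<epsilon> * (real n + 1)"
    if "(T, T') \<in> neighbours z ^^ n" "T \<in> elements z" "q \<in> T - {pos z}" "q' \<in> T' - {pos z}" for T T' q q' n
    using that
  proof (induction n arbitrary: T' q')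
    case 0
    then show ?case using step[of T q q'] by simp
  next
    case (Suc n)
    then obtain T1 where T1: "(T, T1) \<in> neighbours z ^^ n" "(T1, T') \<in> neighbours z" by auto
    then obtain q1 where q1: "q1 \<noteq> pos z" "q1 \<in> T1" "q1 \<in> T'" "T' \<in> elements z"
      by (auto elim: neighboursE)
    have "dist (dir q) (dir q1) \<le> 2 * \<epsilon> * (real n + 1)" using Suc T1 q1 by auto
    moreover have "dist (dir q1) (dir q') \<le> 2 * \<epsilon>" using step[of T' q1 q'] q1 Suc by auto
    ultimately show ?case
      using dist_triangle[of "dir q" "dir q'" "dir q1"] by (simp add: algebra_simps)
  qed
  have close: "dist (dir q) (dir q') \<le> 2 * \<epsilon> * (real (m * m) + 1)"
    if q: "q \<in> edges_at z" "q' \<in> edges_at z" for q q'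
  proof -
    obtain T T' where T: "T \<in> elements z" "q \<in> T - {pos z}" "T' \<in> elements z" "q' \<in> T' - {pos z}"
      using q unfolding edges_at_def by blast
    obtain n where n: "n \<le> m * m" "(T, T') \<in> neighbours z ^^ n"
      using neighbours_chain[OF z T(1,3) m] .
    have "dist (dir q) (dir q') \<le> 2 * \<epsilon> * (real n + 1)"
      using chain[OF n(2) T(1,2,4)] .
    also have "\<dots> \<le> 2 * \<epsilon> * (real (m * m) + 1)"
      using n(1) \<epsilon>(1) by (intro mult_left_mono add_right_mono of_nat_mono) auto
    finally show ?thesis .
  qed
  obtain T0 where T0: "T0 \<in> elements z"
    using elements_nonempty[OF z] by blast
  obtain q0 r0 where q0: "T0 = {pos z, q0, r0}" "pos z \<noteq> q0" "pos z \<noteq> r0" "q0 \<noteq> r0"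
    using triangle_cases[OF node_elements(1,2)[OF z T0]] .
  have q0e: "q0 \<in> edges_at z" "r0 \<in> edges_at z" using T0 q0 by (auto simp: edges_at_def)
  define e where "e = dir q0"
  have norm_dir: "norm (dir q) = 1" if "q \<in> edges_at z" for q
    using that by (auto simp: dir_def edges_at_def norm_sgn)
  have dir: "q - pos z = norm (q - pos z) *\<^sub>R dir q" for q
    by (cases "q = pos z") (auto simp: dir_def sgn_div_norm)
  have epos: "0 < e \<bullet> dir q" if "q \<in> edges_at z" for q
  proof -
    have "(dist e (dir q))\<^sup>2 < 1"
      using close[OF q0e(1) that] \<epsilon>(3) by (simp add: abs_square_less_1 e_def)
    moreover have "(dist e (dir q))\<^sup>2 = 2 - 2 * (e \<bullet> dir q)"
      using norm_dir[OF that] norm_dir[OF q0e(1)]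
      by (simp add: e_def dist_norm power2_norm_eq_inner inner_diff_left inner_diff_right
          inner_commute norm_eq_1)
    ultimately show ?thesis by simp
  qed
  \<comment> \<open>The tangent of the angle to \<open>e\<close>. Every direction is at distance
    less than 1 from \<open>e\<close>, so the denominator is positive, and the extreme slopes mark
    the two sides of the cone.\<close>
  define slope where "slope q = cross2 e (dir q) / (e \<bullet> dir q)" for q
  have fin: "finite (slope ` edges_at z)" and ne: "slope ` edges_at z \<noteq> {}"
    using finite_elements[OF z] node_elements(1)[OF z] triangleD(4) q0e
    by (auto simp: edges_at_def)
  obtain q1 where q1: "q1 \<in> edges_at z" "slope q1 = Max (slope ` edges_at z)"
    using Max_in[OF fin ne] by force
  obtain q2 where q2: "q2 \<in> edges_at z" "slope q2 = Min (slope ` edges_at z)"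
    using Min_in[OF fin ne] by force
  have max: "slope q \<le> slope q1" and min: "slope q2 \<le> slope q" if "q \<in> edges_at z" for q
    using that fin q1 q2 by auto
  define perp :: point where "perp = vector [- e $ 2, e $ 1]"
  have perp: "cross2 e x = perp \<bullet> x" for x
    by (simp add: perp_def cross2_def inner_vec_def sum_2)
  have ee: "perp \<bullet> perp = 1" "perp \<bullet> e = 0"
    using norm_dir[OF q0e(1)]
    by (simp_all add: e_def[symmetric] perp_def inner_vec_def sum_2 norm_eq_1)
  have nrm: "k *\<^sub>R perp - c *\<^sub>R e \<noteq> 0" if "k \<noteq> 0" for k c :: real
  proof
    assume "k *\<^sub>R perp - c *\<^sub>R e = 0"
    then have "perp \<bullet> (k *\<^sub>R perp - c *\<^sub>R e) = 0" by simp
    then show False using ee that by (simp add: inner_diff_right)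
  qed
  \<comment> \<open>\<open>perp - s *\<^sub>R e\<close> is normal to the direction of slope
    \<open>s\<close>, so its product with an edge has the sign of the difference of slopes. The
    factor \<open>k\<close> is 1 for the largest slope and -1 for the smallest.\<close>
  have val: "(k *\<^sub>R perp - (k * s) *\<^sub>R e) \<bullet> (q - pos z)
      = k * ((slope q - s) * (norm (q - pos z) * (e \<bullet> dir q)))" if "q \<in> edges_at z" for k s q
  proof -
    have "(k *\<^sub>R perp - (k * s) *\<^sub>R e) \<bullet> (q - pos z)
        = norm (q - pos z) * (k * (perp \<bullet> dir q) - k * s * (e \<bullet> dir q))"
      by (subst dir) (simp add: inner_diff_left)
    moreover have "perp \<bullet> dir q = slope q * (e \<bullet> dir q)"
      using epos[OF that] by (simp add: slope_def perp)
    ultimately show ?thesis by (simp add: algebra_simps)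
  qed
  have nonneg: "0 \<le> norm (q - pos z) * (e \<bullet> dir q)" if "q \<in> edges_at z" for q
    using epos[OF that] by simp
  have "closed_segment (pos z) q1 \<subseteq> frontier \<Omega>"
  proof (rule extreme_edge_in_frontier[OF z q1(1) nrm[of 1 "1 * slope q1"]])
    fix q assume "q \<in> edges_at z"
    then show "(1 *\<^sub>R perp - (1 * slope q1) *\<^sub>R e) \<bullet> (q - pos z) \<le> 0"
      unfolding val[OF \<open>q \<in> edges_at z\<close>]
      using max nonneg by (simp add: mult_nonpos_nonneg)
  qed (use val[OF q1(1), of 1 "slope q1"] in auto)
  moreover have "closed_segment (pos z) q2 \<subseteq> frontier \<Omega>"
  proof (rule extreme_edge_in_frontier[OF z q2(1) nrm[of "-1" "-1 * slope q2"]])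
    fix q assume "q \<in> edges_at z"
    then show "((-1) *\<^sub>R perp - (-1 * slope q2) *\<^sub>R e) \<bullet> (q - pos z) \<le> 0"
      unfolding val[OF \<open>q \<in> edges_at z\<close>]
      using min nonneg by simp
  qed (use val[OF q2(1), of "-1" "slope q2"] in auto)
  moreover have "dist (dir q1) (dir q2) < \<theta>"
  proof -
    have "0 \<le> 2 * \<epsilon> * (real (m * m) + 1)" using \<epsilon>(1) by simp
    then show ?thesis using close[OF q1(1) q2(1)] \<epsilon>(2) by linarith
  qed
  ultimately have "dir q1 = dir q2"
    using gap q1(1) q2(1) unfolding min_direction_gap_def dir_def edges_at_def by blast
  \<comment> \<open>Equal extreme slopes make all edges parallel, and \<open>T0\<close> would be
    degenerate.\<close>
  then have "slope q1 = slope q2" by (simp add: slope_def)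
  then have "slope r0 = slope q0" using max[OF q0e(1)] max[OF q0e(2)] min[OF q0e(1)] min[OF q0e(2)] by linarith
  moreover have "cross2 e e = 0" by (simp add: cross2_def)
  ultimately have "cross2 e (dir r0) = 0"
    using epos[OF q0e(2)] by (simp add: slope_def e_def[symmetric])
  then have "cross2 (q0 - pos z) (r0 - pos z) = 0"
    by (subst dir[of q0], subst dir[of r0]) (simp add: cross2_def e_def algebra_simps)
  then show False using cross2_nonzero node_elements(1)[OF z T0] q0 by blast
qed

text \<open>The patch lies in the disk of radius \<open>H_node z\<close> about the node, and pi < 4
  gives the factor 4. In the last claim it lies in the disk of radius \<open>d\<close>.\<close>

lemma node_size:
  assumes z: "z \<in> nodes \<Omega> \<T>"
  shows "0 < H_node z" "0 < h_node z" "h_node z \<le> 4 * H_node z"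
    and "(\<And>T. T \<in> elements z \<Longrightarrow> H_tri T \<le> d) \<Longrightarrow> H_node z \<le> 2 * d"
proof -
  have comp: "compact (patch z)"
    unfolding patch_def using finite_elements[OF z] node_elements(1)[OF z] triangleD(4)
    by (intro compact_UN) (auto intro: finite_imp_compact_convex_hull)
  then have bdd: "bounded (patch z)" by (rule compact_imp_bounded)
  obtain T0 where T0: "T0 \<in> elements z"
    using elements_nonempty[OF z] by blast
  note T0\<T> = node_elements(1,2)[OF z T0]
  have sub: "convex hull T0 \<subseteq> patch z" using T0 by (auto simp: patch_def)
  have "H_tri T0 \<le> H_node z"
    unfolding H_node_def
    by (rule H_tri(2)[OF T0\<T>(1)])
       (use sub hull_subset[of T0 convex] in \<open>auto intro!: diameter_bounded_bound[OF bdd]\<close>)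
  then show H: "0 < H_node z" using H_tri(3)[OF T0\<T>(1)] by simp
  obtain q r where T0_eq: "T0 = {pos z, q, r}" using triangle_cases[OF T0\<T>] by metis
  have "0 < area (convex hull T0)"
    using cross2_nonzero T0\<T>(1) unfolding T0_eq area_triangle by simp
  also have "\<dots> \<le> area (patch z)"
    unfolding area_def using sub comp triangleD(4)[OF T0\<T>(1)]
    by (intro measure_mono_fmeasurable fmeasurable_compact)
       (auto intro!: borel_compact finite_imp_compact_convex_hull)
  finally show "0 < h_node z" using H by (simp add: h_node_def)
  have pz: "pos z \<in> patch z" using sub T0\<T>(2) hull_inc[of "pos z" T0 convex] by blast
  have "patch z \<subseteq> cball (pos z) (H_node z)"
    unfolding H_node_def using diameter_bounded_bound[OF bdd pz] by auto
  then have "area (patch z) \<le> measure lborel (cball (pos z) (H_node z))"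
    unfolding area_def using comp by (intro measure_mono_fmeasurable fmeasurable_compact) (auto intro: borel_compact)
  also have "\<dots> = pi * (H_node z)\<^sup>2"
    using H by (simp add: content_cball_conv_ball circle_area)
  also have "\<dots> \<le> 4 * (H_node z)\<^sup>2" using pi_less_4 by (intro mult_right_mono) auto
  finally show "h_node z \<le> 4 * H_node z"
    using H by (simp add: h_node_def divide_le_eq power2_eq_square)
  assume d: "\<And>T. T \<in> elements z \<Longrightarrow> H_tri T \<le> d"
  have cb: "patch z \<subseteq> cball (pos z) d"
  proof -
    have "convex hull T \<subseteq> cball (pos z) d" if T: "T \<in> elements z" for T
    proof (intro hull_minimal convex_cball subsetI)
      fix x assume "x \<in> T"
      then have "dist (pos z) x \<le> H_tri T"
        using H_tri(1) node_elements(1,2)[OF z T] by blast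
      then show "x \<in> cball (pos z) d" using d[OF T] by simp
    qed
    then show ?thesis by (auto simp: patch_def)
  qed
  show "H_node z \<le> 2 * d"
    unfolding H_node_def
  proof (rule diameter_le)
    fix x y assume "x \<in> patch z" "y \<in> patch z"
    then have "dist (pos z) x \<le> d" "dist (pos z) y \<le> d" using cb by auto
    then show "norm (x - y) \<le> 2 * d"
      using dist_triangle2[of x y "pos z"] by (simp add: dist_norm norm_minus_commute)
  qed (use pz in auto)
qed

section \<open>The first bound for C1 functions, by type of node and edge\<close>

lemma weighted_edge_wide:
  assumes z: "z \<in> nodes \<Omega> \<T>" and T: "T \<in> elements z" "T = {pos z, q, r}" "q \<in> gamma \<Omega> z"
    and w: "C1_on (open_patch \<Omega> z) w Dw"
    and \<epsilon>: "0 < \<epsilon>" "\<epsilon> * (norm (q - pos z) * norm (r - pos z)) \<le> \<bar>cross2 (q - pos z) (r - pos z)\<bar>"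
    and l: "0 < l" "l \<le> dist (pos z) r"
  shows "weighted_edge (pos z) q w \<le> ennreal (1 / \<epsilon>) * weighted_W11_norm (open_patch \<Omega> z) (1 / l) w Dw"
  unfolding weighted_W11_norm_def
  using open_segment_subset_open_patch[OF z T(3)] interior_triangle_subset_open_patch[OF z T(1)]
    cross2_nonzero[of "pos z" q r] node_elements(1)[OF z T(1)] \<epsilon> l T(2)
  by (intro weighted_edge_le_triangle[OF open_open_patch _ _ w])
     (auto simp: dist_norm norm_minus_commute)

text \<open>\<open>\<kappa>\<close> is arbitrary because the transfer costs only the gradient
  term.\<close>

lemma weighted_edge_narrow:
  assumes z: "z \<in> nodes \<Omega> \<T>" and T: "T \<in> elements z" "T = {pos z, q, r}"
      "q \<in> gamma \<Omega> z" "r \<in> gamma \<Omega> z"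
    and w: "C1_on (open_patch \<Omega> z) w Dw"
    and \<epsilon>: "0 < \<epsilon>" "\<epsilon> * (norm (q - pos z) * norm (r - q)) \<le> \<bar>cross2 (q - pos z) (r - pos z)\<bar>"
  shows "weighted_edge (pos z) q w
    \<le> ennreal (1 / \<epsilon>) * (weighted_edge (pos z) r w + weighted_W11_norm (open_patch \<Omega> z) \<kappa> w Dw)"
proof -
  have "weighted_edge (pos z) q w \<le> ennreal (1 / \<epsilon>) *
      (weighted_edge (pos z) r w + (\<integral>\<^sup>+x\<in>open_patch \<Omega> z. norm (Dw x) \<partial>lborel))"
    using open_segment_subset_open_patch[OF z T(3)] open_segment_subset_open_patch[OF z T(4)]
      interior_triangle_subset_open_patch[OF z T(1)]
      cross2_nonzero[of "pos z" q r] node_elements(1)[OF z T(1)] \<epsilon> T(2)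
    by (intro weighted_edge_transfer[OF open_open_patch _ _ _ w]) auto
  also have "\<dots> \<le> ennreal (1 / \<epsilon>) *
      (weighted_edge (pos z) r w + weighted_W11_norm (open_patch \<Omega> z) \<kappa> w Dw)"
    by (intro mult_left_mono add_left_mono) (auto simp: weighted_W11_norm_def)
  finally show ?thesis .
qed

text \<open>Induction on the number of steps to the wide triangle \<open>W\<close>. A narrow
  \<open>T\<close> passes the estimate from the edge it shares with the next triangle to the edge
  \<open>q\<close>. Bounding both summands of the transfer by the induction bound doubles it, hence
  the factor \<open>2 / \<epsilon>\<close> per step.\<close>

lemma weighted_edge_chain:
  assumes z: "z \<in> nodes \<Omega> \<T>" and w: "C1_on (open_patch \<Omega> z) w Dw"
    and \<epsilon>: "0 < \<epsilon>" "\<epsilon> \<le> 1"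
    and narrow: "\<And>T q r. \<lbrakk>T \<in> elements z; T = {pos z, q, r}; pos z \<noteq> q; pos z \<noteq> r; q \<noteq> r; \<not> wide \<epsilon> (pos z) T\<rbrakk>
      \<Longrightarrow> \<epsilon> * (norm (q - pos z) * norm (r - q)) \<le> \<bar>cross2 (q - pos z) (r - pos z)\<bar>"
    and l: "0 < l" "\<And>T r. \<lbrakk>T \<in> elements z; r \<in> T; r \<noteq> pos z\<rbrakk> \<Longrightarrow> l \<le> dist (pos z) r"
    and W: "wide \<epsilon> (pos z) W"
  shows "\<lbrakk>(T, W) \<in> neighbours z ^^ n; T \<in> elements z; q \<in> T; q \<in> gamma \<Omega> z\<rbrakk> \<Longrightarrow>
    weighted_edge (pos z) q w
      \<le> ennreal ((2 / \<epsilon>) ^ Suc n) * weighted_W11_norm (open_patch \<Omega> z) (1 / l) w Dw"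
proof (induction n arbitrary: T q)
  let ?X = "weighted_W11_norm (open_patch \<Omega> z) (1 / l) w Dw"
  have k: "1 \<le> 1 / \<epsilon>" "1 / \<epsilon> \<le> 2 / \<epsilon>" "0 \<le> 2 / \<epsilon>" using \<epsilon> by (auto simp: field_simps)
  have base: "weighted_edge (pos z) q w \<le> ennreal (1 / \<epsilon>) * ?X"
    if T: "T \<in> elements z" "q \<in> T" "q \<in> gamma \<Omega> z" "wide \<epsilon> (pos z) T" for T q
  proof -
    have "pos z \<noteq> q" using T(3) by (auto simp: gamma_def edges_at_def)
    then obtain r where r: "T = {pos z, q, r}" "r \<noteq> pos z" "r \<noteq> q"
      using third_vertex[OF node_elements(1,2)[OF z T(1)] T(2)] by metis
    have "\<epsilon> * (norm (q - pos z) * norm (r - pos z)) \<le> \<bar>cross2 (q - pos z) (r - pos z)\<bar>"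
      using T(4) r \<open>pos z \<noteq> q\<close> wide_iff[of "pos z" q r \<epsilon>] by auto
    moreover have "l \<le> dist (pos z) r" using l(2)[OF T(1), of r] r by auto
    ultimately show ?thesis
      using weighted_edge_wide[OF z T(1) r(1) T(3) w] \<epsilon> l(1) by blast
  qed
  {
    case 0
    have "weighted_edge (pos z) q w \<le> ennreal (1 / \<epsilon>) * ?X" using base[of T q] 0 W by auto
    also have "\<dots> \<le> ennreal ((2 / \<epsilon>) ^ Suc 0) * ?X"
      using k by (intro mult_right_mono ennreal_leI) auto
    finally show ?case .
  next
    case (Suc n)
    let ?B = "(2 / \<epsilon>) ^ Suc n"
    have B: "1 \<le> ?B" using k by (intro one_le_power) linarith
    have B2: "?B \<le> (2 / \<epsilon>) ^ Suc (Suc n)" using k by (intro power_increasing) auto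
    have finish: "weighted_edge (pos z) q w \<le> ennreal ((2 / \<epsilon>) ^ Suc (Suc n)) * ?X"
      if "weighted_edge (pos z) q w \<le> ennreal c * ?X" "c \<le> ?B" for c
      using that(1) B2 that(2)
      by (elim order_trans) (intro mult_right_mono ennreal_leI, auto)
    show ?case
    proof (cases "wide \<epsilon> (pos z) T")
      case True
      have "1 / \<epsilon> \<le> (2 / \<epsilon>) ^ 1" using k by simp
      also have "\<dots> \<le> ?B" using k by (intro power_increasing) auto
      finally show ?thesis using finish base[OF Suc.prems(2-4) True] by blast
    next
      case False
      obtain T1 where T1: "(T, T1) \<in> neighbours z" "(T1, W) \<in> neighbours z ^^ n"
        using Suc.prems(1) by (blast dest: relpow_Suc_D2)
      obtain q1 where q1: "q1 \<noteq> pos z" "q1 \<in> T" "q1 \<in> T1" "q1 \<in> gamma \<Omega> z" "T1 \<in> elements z"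
        using T1(1) by (auto elim: neighboursE)
      have IH: "weighted_edge (pos z) q1 w \<le> ennreal ?B * ?X"
        using Suc.IH[OF T1(2) q1(5,3,4)] .
      show ?thesis
      \<comment> \<open>The shared edge may be \<open>q\<close> itself, in which case there is
        nothing to transfer.\<close>
      proof (cases "q1 = q")
        case True
        then show ?thesis using finish IH by blast
      next
        case False
        have pq: "pos z \<noteq> q" using Suc.prems(4) by (auto simp: gamma_def edges_at_def)
        obtain r where "T = {pos z, q, r}" "r \<noteq> pos z" "r \<noteq> q"
          using third_vertex[OF node_elements(1,2)[OF z Suc.prems(2)] Suc.prems(3)] pq by metis
        then have T_eq: "T = {pos z, q, q1}" using q1 False by auto
        have "weighted_edge (pos z) q w \<le> ennreal (1 / \<epsilon>) * (weighted_edge (pos z) q1 w + ?X)"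
          using weighted_edge_narrow[OF z Suc.prems(2) T_eq Suc.prems(4) q1(4) w \<epsilon>(1)]
            narrow[OF Suc.prems(2) T_eq] pq q1(1) False \<open>\<not> wide \<epsilon> (pos z) T\<close> by metis
        also have "\<dots> \<le> ennreal (1 / \<epsilon>) * (ennreal ?B * ?X + ennreal ?B * ?X)"
        proof (intro mult_left_mono add_mono IH)
          have "ennreal 1 * ?X \<le> ennreal ?B * ?X" using B by (intro mult_right_mono ennreal_leI) auto
          then show "?X \<le> ennreal ?B * ?X" by simp
        qed simp
        also have "\<dots> = ennreal (1 / \<epsilon>) * (ennreal (?B + ?B) * ?X)"
          using B by (subst ennreal_plus) (auto simp: distrib_right)
        also have "\<dots> = ennreal (1 / \<epsilon> * (?B + ?B)) * ?X"
          using \<epsilon> B by (subst ennreal_mult) (auto simp: mult.assoc)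
        also have "1 / \<epsilon> * (?B + ?B) = (2 / \<epsilon>) ^ Suc (Suc n)"
          by (simp add: field_simps)
        finally show ?thesis .
      qed
    qed
  }
qed

lemma max_angle_inner:
  assumes "max_angle_condition \<alpha> \<T>" "0 < \<alpha>" "\<alpha> < pi" and "{a, b, d} \<in> \<T>"
    and "a \<noteq> b" "a \<noteq> d" "b \<noteq> d" and c: "- c \<le> cos \<alpha>"
  shows "- c * (norm (b - a) * norm (d - a)) \<le> (b - a) \<bullet> (d - a)"
proof -
  have "tri_angle a b d \<le> \<alpha>"
    using assms(1)[unfolded max_angle_condition_def, rule_format, OF assms(4), of a b d] assms(5-7)
    by simp
  then have "cos \<alpha> * (norm (b - a) * norm (d - a)) \<le> (b - a) \<bullet> (d - a)"
    using assms by (intro tri_angle_leD) auto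
  moreover have "- c * (norm (b - a) * norm (d - a)) \<le> cos \<alpha> * (norm (b - a) * norm (d - a))"
    using c by (intro mult_right_mono) auto
  ultimately show ?thesis by linarith
qed

text \<open>Two directions more than \<open>2 * \<epsilon>\<close> apart in one triangle force a
  sine of at least \<epsilon> between them, by \<open>dist_sgn_le\<close>; so a wide triangle
  exists. Every edge at the node is at least a height, hence at least \<open>h_node z / K\<close>,
  which yields the weight \<open>1 / h_node z\<close>.\<close>

lemma weighted_edge_anisotropic_long:
  assumes z: "z \<in> nodes \<Omega> \<T>" and m: "card (elements z) \<le> m"
    and angle: "max_angle_condition \<alpha> \<T>" "0 < \<alpha>" "\<alpha> < pi"
    and gap: "min_direction_gap \<theta> (frontier \<Omega>)"
    and \<epsilon>: "0 < \<epsilon>" "\<epsilon> \<le> 1" "2 * (2 * \<epsilon> * (real (m * m) + 1)) < \<theta>" "2 * \<epsilon> * (real (m * m) + 1) < 1"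
    and c: "0 \<le> c" "2 * \<epsilon>\<^sup>2 < 1 - c" "\<epsilon>\<^sup>2 \<le> 1 - c\<^sup>2" "- c \<le> cos \<alpha>"
    and K: "0 < K" "\<And>T. T \<in> elements z \<Longrightarrow> h_node z \<le> K * h_tri T"
    and q: "q \<in> gamma \<Omega> z" and w: "C1_on (open_patch \<Omega> z) w Dw"
  shows "weighted_edge (pos z) q w \<le> ennreal ((2 / \<epsilon>) ^ Suc (m * m) * max 1 K) *
    weighted_W11_norm (open_patch \<Omega> z) (1 / h_node z) w Dw"
proof -
  let ?p = "pos z"
  have inner: "sqrt (1 - \<epsilon>\<^sup>2) * (norm (b - a) * norm (d - a)) \<le> (b - a) \<bullet> (d - a)"
    if "{a, b, d} \<in> \<T>" "a \<noteq> b" "a \<noteq> d" "b \<noteq> d"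
      "\<bar>cross2 (b - a) (d - a)\<bar> < \<epsilon> * (norm (b - a) * norm (d - a))" for a b d
    using inner_ge_of_cross2_less[OF that(5) max_angle_inner[OF angle that(1-4) c(4)]] c \<epsilon>(1) by blast
  have "\<exists>W\<in>elements z. wide \<epsilon> ?p W"
  proof -
    obtain T q r where T: "T \<in> elements z" "q \<in> T - {?p}" "r \<in> T - {?p}" "q \<noteq> r"
      and far: "2 * \<epsilon> < dist (sgn (q - ?p)) (sgn (r - ?p))"
      using not_all_narrow[OF z m gap \<epsilon>(1,3,4)] by blast
    note T\<T> = node_elements(1,2)[OF z T(1)]
    obtain r' where "T = {?p, q, r'}" using third_vertex[OF T\<T>, of q] T by blast
    then have T_eq: "T = {?p, q, r}" using T by auto
    have "\<epsilon> * (norm (q - ?p) * norm (r - ?p)) \<le> \<bar>cross2 (q - ?p) (r - ?p)\<bar>"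
    proof (rule ccontr)
      assume "\<not> ?thesis"
      then have "sqrt (1 - \<epsilon>\<^sup>2) * (norm (q - ?p) * norm (r - ?p)) \<le> (q - ?p) \<bullet> (r - ?p)"
        using T T\<T> T_eq by (intro inner) auto
      then have "dist (sgn (q - ?p)) (sgn (r - ?p)) \<le> 2 * \<epsilon>"
        using T \<epsilon> by (intro dist_sgn_le) auto
      then show False using far by simp
    qed
    then have "wide \<epsilon> ?p T" using T T_eq wide_iff[of ?p q r \<epsilon>] by auto
    then show ?thesis using T by blast
  qed
  then obtain W where W: "W \<in> elements z" "wide \<epsilon> ?p W" by blast
  have narrow: "\<epsilon> * (norm (q - ?p) * norm (r - q)) \<le> \<bar>cross2 (q - ?p) (r - ?p)\<bar>"
    if T: "T \<in> elements z" "T = {?p, q, r}" "?p \<noteq> q" "?p \<noteq> r" "q \<noteq> r" "\<not> wide \<epsilon> ?p T" for T q r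
  proof -
    have T\<T>: "{?p, q, r} \<in> \<T>" using node_elements(1)[OF z T(1)] T(2) by simp
    then have perm: "{q, ?p, r} \<in> \<T>" "{r, ?p, q} \<in> \<T>" by (simp_all add: insert_commute)
    have "\<bar>cross2 (q - ?p) (r - ?p)\<bar> < \<epsilon> * (norm (q - ?p) * norm (r - ?p))"
      using T(6) wide_iff[OF T(3-5), of \<epsilon>] T(2) by auto
    then show ?thesis
      using max_angle_inner[OF angle T\<T>, of c] max_angle_inner[OF angle perm(1), of c]
        max_angle_inner[OF angle perm(2), of c] T c \<epsilon>(1)
      by (intro cross2_ge_of_max_angle[OF cross2_nonzero[OF T\<T>], of c]) auto
  qed
  have l: "h_node z / K \<le> dist ?p r" if T: "T \<in> elements z" "r \<in> T" "r \<noteq> ?p" for T r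
  proof -
    have "h_tri T \<le> dist ?p r"
      using h_tri_le_dist node_elements(1,2)[OF z T(1)] T by metis
    then have "K * h_tri T \<le> K * dist ?p r" using K by simp
    then have "h_node z \<le> K * dist ?p r" using K(2)[OF T(1)] by linarith
    then show ?thesis using K by (simp add: divide_le_eq mult.commute)
  qed
  obtain T where T: "T \<in> elements z" "q \<in> T" using gammaE[OF z q] .
  obtain n where n: "n \<le> m * m" "(T, W) \<in> neighbours z ^^ n"
    using neighbours_chain[OF z T(1) W(1) m] .
  have hpos: "0 < h_node z" by (rule node_size(2)[OF z])
  have "weighted_edge ?p q w
      \<le> ennreal ((2 / \<epsilon>) ^ Suc n) * weighted_W11_norm (open_patch \<Omega> z) (1 / (h_node z / K)) w Dw"
    by (rule weighted_edge_chain[OF z w \<epsilon>(1,2) narrow _ l W(2) n(2) T q]) (use hpos K in auto)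
  also have "\<dots> \<le> ennreal ((2 / \<epsilon>) ^ Suc (m * m)) *
      (ennreal (max 1 K) * weighted_W11_norm (open_patch \<Omega> z) (1 / h_node z) w Dw)"
  proof (intro mult_mono ennreal_leI weighted_W11_norm_mono)
    show "(2 / \<epsilon>) ^ Suc n \<le> (2 / \<epsilon>) ^ Suc (m * m)"
      using n(1) \<epsilon> by (intro power_increasing) (auto simp: le_divide_eq)
    show "1 / (h_node z / K) \<le> max 1 K * (1 / h_node z)"
      using hpos by (auto simp: field_simps)
  qed (use hpos in auto)
  also have "\<dots> = ennreal ((2 / \<epsilon>) ^ Suc (m * m) * max 1 K) *
      weighted_W11_norm (open_patch \<Omega> z) (1 / h_node z) w Dw"
    using \<epsilon> by (subst ennreal_mult) (auto simp: mult.assoc)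
  finally show ?thesis .
qed

text \<open>A short edge makes the angle at the node wide: the sine is
  \<open>h_tri T * H_tri T\<close> divided by the product of the two edge lengths, where the first
  edge is at most \<open>K' * K * h_tri T\<close> and the second at most \<open>H_tri T\<close>. The
  second edge is then of size \<open>H_tri T\<close>, since the sum of the two bounds
  \<open>H_tri T\<close> and \<open>h_tri T\<close> is at most the second.\<close>

lemma weighted_edge_anisotropic_short:
  assumes z: "z \<in> nodes \<Omega> \<T>"
    and K: "0 < K" "0 < K'" "\<And>T. T \<in> elements z \<Longrightarrow> h_node z \<le> K * h_tri T"
      "\<And>T. T \<in> elements z \<Longrightarrow> H_node z \<le> K * H_tri T"
    and q: "q \<in> gamma \<Omega> z" "dist (pos z) q \<le> K' * h_node z" and w: "C1_on (open_patch \<Omega> z) w Dw"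
  shows "weighted_edge (pos z) q w \<le> ennreal (K * K' * max 1 (K * (1 + K * K'))) *
    weighted_W11_norm (open_patch \<Omega> z) (1 / H_node z) w Dw"
proof -
  let ?p = "pos z"
  obtain T where T: "T \<in> elements z" "q \<in> T" "q \<noteq> ?p" using gammaE[OF z q(1)] .
  note T\<T> = node_elements(1,2)[OF z T(1)]
  obtain r where r: "T = {?p, q, r}" "r \<noteq> ?p" "r \<noteq> q"
    using third_vertex[OF T\<T> T(2)] T(3) by metis
  define a b where "a = norm (q - ?p)" and "b = norm (r - ?p)"
  have ab: "0 < a" "0 < b" "dist ?p q = a" "dist ?p r = b"
    using T r by (auto simp: a_def b_def dist_norm norm_minus_commute)
  have hb: "h_tri T \<le> b" using h_tri_le_dist[OF T\<T>, of r] r ab by auto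
  have bH: "b \<le> H_tri T" using H_tri(1)[OF T\<T>(1), of ?p r] r ab by auto
  have H: "H_tri T \<le> a + b"
    using dist_triangle3[of q r ?p] ab
    by (intro H_tri(2)[OF T\<T>(1)]) (auto simp: r(1) dist_commute)
  note size = node_size(1,2)[OF z] h_tri_pos[OF T\<T>(1)]
  have aK: "a \<le> K' * (K * h_tri T)"
    using q(2) K(3)[OF T(1)] K ab by (meson mult_left_mono order_less_imp_le order_trans)
  have "K' * (K * h_tri T) \<le> K' * (K * b)"
    using hb K(1,2) by (intro mult_left_mono) auto
  with aK have "a \<le> K' * (K * b)" by linarith
  then have "H_tri T \<le> (1 + K * K') * b" using H by (simp add: algebra_simps)
  then have "K * H_tri T \<le> K * ((1 + K * K') * b)"
    using K(1) by (intro mult_left_mono) auto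
  then have Hb: "H_node z \<le> K * (1 + K * K') * b"
    using K(4)[OF T(1)] by (simp add: mult.assoc)
  have "weighted_edge ?p q w \<le> ennreal (1 / (1 / (K * K'))) *
      weighted_W11_norm (open_patch \<Omega> z) (1 / (H_node z / (K * (1 + K * K')))) w Dw"
  proof (rule weighted_edge_wide[OF z T(1) r(1) q(1) w])
    have "a * b \<le> (K' * (K * h_tri T)) * H_tri T"
      using aK bH ab K size by (intro mult_mono) auto
    also have "\<dots> = K * K' * \<bar>cross2 (q - ?p) (r - ?p)\<bar>"
      using h_tri_H_tri[of ?p q r] T\<T>(1) r(1) by (simp add: mult.assoc mult.left_commute)
    finally show "1 / (K * K') * (norm (q - ?p) * norm (r - ?p)) \<le> \<bar>cross2 (q - ?p) (r - ?p)\<bar>"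
      using K by (simp add: a_def b_def divide_le_eq mult.commute mult.assoc)
    have "0 < K * (1 + K * K')" using K by (intro mult_pos_pos add_pos_pos) auto
    then show "0 < H_node z / (K * (1 + K * K'))" "H_node z / (K * (1 + K * K')) \<le> dist ?p r"
      using Hb size ab by (auto simp: divide_le_eq mult.commute)
  qed (use K in auto)
  also have "\<dots> \<le> ennreal (K * K') * (ennreal (max 1 (K * (1 + K * K'))) *
      weighted_W11_norm (open_patch \<Omega> z) (1 / H_node z) w Dw)"
  proof (intro mult_mono weighted_W11_norm_mono)
    show "1 / (H_node z / (K * (1 + K * K'))) \<le> max 1 (K * (1 + K * K')) * (1 / H_node z)"
      using size by (simp add: divide_right_mono)
  qed (use size in auto)
  also have "\<dots> = ennreal (K * K' * max 1 (K * (1 + K * K'))) *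
      weighted_W11_norm (open_patch \<Omega> z) (1 / H_node z) w Dw"
    using K(1,2) by (simp add: ennreal_mult mult.assoc)
  finally show ?thesis .
qed

text \<open>Every angle has sine at least \<open>1 / K\<close>. Diameters of neighbours compare
  through the shared edge, at a factor \<open>K\<close> per step, so that all edges at the node are
  comparable to \<open>H_node z\<close>.\<close>

lemma weighted_edge_regular:
  assumes z: "z \<in> nodes \<Omega> \<T>" and m: "card (elements z) \<le> m"
    and K: "1 \<le> K" "\<And>T. T \<in> elements z \<Longrightarrow> H_tri T \<le> K * h_tri T"
    and q: "q \<in> gamma \<Omega> z" and w: "C1_on (open_patch \<Omega> z) w Dw"
    and \<kappa>: "1 / (4 * H_node z) \<le> \<kappa>"
  shows "weighted_edge (pos z) q w \<le> ennreal (K * (8 * K ^ Suc (m * m))) *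
    weighted_W11_norm (open_patch \<Omega> z) \<kappa> w Dw"
proof -
  let ?p = "pos z"
  obtain T where T: "T \<in> elements z" "q \<in> T" "q \<noteq> ?p" using gammaE[OF z q(1)] .
  note T\<T> = node_elements(1,2)[OF z T(1)]
  obtain r where r: "T = {?p, q, r}" "r \<noteq> ?p" "r \<noteq> q"
    using third_vertex[OF T\<T> T(2)] T(3) by metis
  have chain: "H_tri T' \<le> K ^ n * H_tri T" if "(T, T') \<in> neighbours z ^^ n" for n T'
    using that
  proof (induction n arbitrary: T')
    case (Suc n)
    then obtain T1 where T1: "(T, T1) \<in> neighbours z ^^ n" "(T1, T') \<in> neighbours z" by auto
    then obtain q1 where q1: "q1 \<noteq> ?p" "q1 \<in> T1" "q1 \<in> T'" "T1 \<in> elements z" "T' \<in> elements z"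
      by (auto elim: neighboursE)
    note T1\<T> = node_elements(1,2)[OF z q1(4)] and T'\<T> = node_elements(1,2)[OF z q1(5)]
    have "H_tri T' \<le> K * h_tri T'" by (rule K(2)[OF q1(5)])
    also have "\<dots> \<le> K * dist ?p q1"
      using h_tri_le_dist[OF T'\<T> q1(3)] q1(1) K(1) by (intro mult_left_mono) auto
    also have "\<dots> \<le> K * H_tri T1"
      using H_tri(1)[OF T1\<T> q1(2)] K(1) by (intro mult_left_mono) auto
    also have "\<dots> \<le> K * (K ^ n * H_tri T)"
      using Suc.IH[OF T1(1)] K(1) by (intro mult_left_mono) auto
    finally show ?case by (simp add: mult.assoc)
  qed simp
  have Hpos: "0 < H_tri T" by (rule H_tri(3)[OF T\<T>(1)])
  have "H_node z \<le> 2 * (K ^ (m * m) * H_tri T)"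
  proof (rule node_size(4)[OF z])
    fix T' assume "T' \<in> elements z"
    then obtain n where n: "n \<le> m * m" "(T, T') \<in> neighbours z ^^ n"
      using neighbours_chain[OF z T(1) _ m] by metis
    have "H_tri T' \<le> K ^ n * H_tri T" by (rule chain[OF n(2)])
    also have "\<dots> \<le> K ^ (m * m) * H_tri T"
      using n(1) K(1) Hpos by (intro mult_right_mono power_increasing) auto
    finally show "H_tri T' \<le> K ^ (m * m) * H_tri T" .
  qed
  also have "\<dots> \<le> 2 * (K ^ (m * m) * (K * dist ?p r))"
  proof -
    have "H_tri T \<le> K * dist ?p r"
    proof -
      have "K * h_tri T \<le> K * dist ?p r"
        using h_tri_le_dist[OF T\<T>, of r] r K(1) by (intro mult_left_mono) auto
      then show ?thesis using K(2)[OF T(1)] by linarith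
    qed
    then show ?thesis using K(1) by (intro mult_left_mono) auto
  qed
  finally have Hr: "H_node z \<le> 2 * K ^ Suc (m * m) * dist ?p r" by (simp add: mult.assoc mult.left_commute)
  have Kp: "0 < 2 * K ^ Suc (m * m)" using K(1) by (intro mult_pos_pos zero_less_power) auto
  have Hz: "0 < H_node z" by (rule node_size(1)[OF z])
  have "weighted_edge ?p q w \<le> ennreal (1 / (1 / K)) *
      weighted_W11_norm (open_patch \<Omega> z) (1 / (H_node z / (2 * K ^ Suc (m * m)))) w Dw"
  proof (rule weighted_edge_wide[OF z T(1) r(1) q w])
    have "norm (q - ?p) * norm (r - ?p) \<le> H_tri T * H_tri T"
      using H_tri(1)[OF T\<T>(1), of q ?p] H_tri(1)[OF T\<T>(1), of r ?p] r(1) Hpos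
      by (intro mult_mono) (auto simp: dist_norm)
    also have "\<dots> \<le> (K * h_tri T) * H_tri T"
      using K(2)[OF T(1)] Hpos by (intro mult_right_mono) auto
    also have "\<dots> = K * \<bar>cross2 (q - ?p) (r - ?p)\<bar>"
      using h_tri_H_tri[of ?p q r] T\<T>(1) r(1) by (simp add: mult.assoc)
    finally show "1 / K * (norm (q - ?p) * norm (r - ?p)) \<le> \<bar>cross2 (q - ?p) (r - ?p)\<bar>"
      using K(1) by (simp add: divide_le_eq mult.commute)
    show "0 < H_node z / (2 * K ^ Suc (m * m))" using Hz Kp by (rule divide_pos_pos)
    show "H_node z / (2 * K ^ Suc (m * m)) \<le> dist ?p r"
      using Hr Kp by (simp add: pos_divide_le_eq mult.commute)
  qed (use K in auto)
  also have "\<dots> \<le> ennreal K * (ennreal (8 * K ^ Suc (m * m)) *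
      weighted_W11_norm (open_patch \<Omega> z) \<kappa> w Dw)"
  proof (intro mult_mono weighted_W11_norm_mono)
    \<comment> \<open>The 8 is the 2 from bounding the diameter of the patch times the 4 in the
      hypothesis on \<open>\<kappa>\<close>.\<close>
    have "1 / (H_node z / (2 * K ^ Suc (m * m))) = 8 * K ^ Suc (m * m) * (1 / (4 * H_node z))"
      using Hz by simp
    also have "\<dots> \<le> 8 * K ^ Suc (m * m) * \<kappa>"
      using \<kappa> Kp by (intro mult_left_mono) auto
    finally show "1 / (H_node z / (2 * K ^ Suc (m * m))) \<le> 8 * K ^ Suc (m * m) * \<kappa>" .
    have "1 \<le> K ^ Suc (m * m)" using K(1) by (rule one_le_power)
    then show "1 \<le> 8 * K ^ Suc (m * m)" by linarith
    have "0 \<le> 1 / (4 * H_node z)" using Hz by simp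
    then show "0 \<le> \<kappa>" using \<kappa> by linarith
  qed (use K in auto)
  also have "\<dots> = ennreal (K * (8 * K ^ Suc (m * m))) *
      weighted_W11_norm (open_patch \<Omega> z) \<kappa> w Dw"
    using K(1) by (simp add: ennreal_mult mult.assoc)
  finally show ?thesis .
qed

end

text \<open>A single \<epsilon> has to keep the total turn along a path of \<open>N\<close> steps
  below the gap \<theta> and below 1, and to satisfy the two conditions on \<open>c\<close> from the
  maximum angle; for these \<open>1 - c \<le> 1 - c\<^sup>2\<close> helps.\<close>

lemma angle_threshold:
  fixes \<theta> c :: real
  assumes "0 < \<theta>" "0 \<le> c" "c < 1"
  obtains \<epsilon> where "0 < \<epsilon>" "\<epsilon> \<le> 1" "2 * (2 * \<epsilon> * (real N + 1)) < \<theta>" "2 * \<epsilon> * (real N + 1) < 1"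
    "2 * \<epsilon>\<^sup>2 < 1 - c" "\<epsilon>\<^sup>2 \<le> 1 - c\<^sup>2"
proof -
  define \<delta> where "\<delta> = min (min 1 \<theta>) (1 - c)"
  define \<epsilon> where "\<epsilon> = \<delta> / (8 * (real N + 1))"
  have \<delta>: "0 < \<delta>" "\<delta> \<le> 1" "\<delta> \<le> \<theta>" "\<delta> \<le> 1 - c" using assms by (auto simp: \<delta>_def)
  have e: "0 < \<epsilon>" using \<delta> by (simp add: \<epsilon>_def)
  have "real N + 1 \<noteq> 0" by linarith
  then have eN: "\<epsilon> * (real N + 1) = \<delta> / 8" unfolding \<epsilon>_def by (simp add: divide_simps)
  have "\<epsilon> * 1 \<le> \<epsilon> * (real N + 1)" using e by (intro mult_left_mono) auto
  then have le: "\<epsilon> \<le> \<delta> / 8" using eN by simp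
  then have "\<epsilon> * \<epsilon> \<le> \<epsilon> * 1" using e \<delta> by (intro mult_left_mono) auto
  then have sq: "\<epsilon>\<^sup>2 \<le> \<delta> / 8" using le by (simp add: power2_eq_square)
  have "c * c \<le> 1 * c" using assms by (intro mult_right_mono) auto
  then have c2: "1 - c \<le> 1 - c\<^sup>2" by (simp add: power2_eq_square)
  show ?thesis
  proof (rule that[of \<epsilon>])
    show "2 * (2 * \<epsilon> * (real N + 1)) < \<theta>" "2 * \<epsilon> * (real N + 1) < 1"
      unfolding mult.assoc eN using \<delta> by simp_all
  qed (use e le \<delta> sq c2 in linarith)+
qed

theorem lemma3p1:
  fixes \<Omega> :: "point set" and \<alpha>\<^sub>0 c\<^sub>0 K\<^sub>R K\<^sub>a K\<^sub>r K\<^sub>\<gamma> :: real and m :: nat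
  assumes "polygonal_domain \<Omega>"
    and "0 < \<alpha>\<^sub>0" "\<alpha>\<^sub>0 < pi"
    and "0 < c\<^sub>0" "c\<^sub>0 < 1"
    and "0 < K\<^sub>R" "0 < K\<^sub>a" "0 < K\<^sub>r" "0 < K\<^sub>\<gamma>"
  shows "\<exists>C>0. \<forall>\<T>.
    polygon_triangulation \<Omega> \<T> \<longrightarrow>
    basic_triangulation_assumptions \<alpha>\<^sub>0 K\<^sub>R m \<Omega> \<T> \<longrightarrow>
    nodes \<Omega> \<T> = anisotropic_nodes c\<^sub>0 K\<^sub>a \<Omega> \<T> \<union> regular_nodes K\<^sub>r \<Omega> \<T> \<longrightarrow>
    (\<forall>z \<in> nodes \<Omega> \<T>. \<forall>\<phi> v G q g.
      hat_function \<Omega> \<T> z \<phi> \<longrightarrow>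
      W11 (open_patch \<Omega> z) v G \<longrightarrow>
      q \<in> gamma \<Omega> z \<longrightarrow>
      trace_on_edge (open_patch \<Omega> z) v G (pos z) q g \<longrightarrow>
        edge_L1_norm (pos z) q (\<lambda>x. g x * \<phi> x)
          \<le> C * (Lp_norm 1 (open_patch \<Omega> z) G
                  + kappa K\<^sub>\<gamma> \<Omega> z q * Lp_norm 1 (open_patch \<Omega> z) v) \<and>
        (in_Lp 2 (open_patch \<Omega> z) v \<and> in_Lp 2 (open_patch \<Omega> z) G \<longrightarrow>
          inverse (dist (pos z) q) * (edge_L1_norm (pos z) q (\<lambda>x. g x * \<phi> x))\<^sup>2
            \<le> C * (Lp_norm 2 (open_patch \<Omega> z) v * Lp_norm 2 (open_patch \<Omega> z) G
                    + kappa K\<^sub>\<gamma> \<Omega> z q * (Lp_norm 2 (open_patch \<Omega> z) v)\<^sup>2)))"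
proof -
  obtain \<theta> where gap: "min_direction_gap \<theta> (frontier \<Omega>)"
    using polygonal_domain_direction_gap[OF assms(1)] .
  \<comment> \<open>\<open>-c\<close> is a nonpositive lower bound of all cosines;
    \<open>c < 1\<close> because the maximum angle stays below pi.\<close>
  define c where "c = max 0 (- cos \<alpha>\<^sub>0)"
  have "cos pi < cos \<alpha>\<^sub>0" using assms(2,3) by (intro cos_monotone_0_pi) auto
  then have c: "0 \<le> c" "c < 1" "- c \<le> cos \<alpha>\<^sub>0" by (auto simp: c_def)
  obtain \<epsilon> where \<epsilon>: "0 < \<epsilon>" "\<epsilon> \<le> 1" "2 * (2 * \<epsilon> * (real (m * m) + 1)) < \<theta>"
      "2 * \<epsilon> * (real (m * m) + 1) < 1" "2 * \<epsilon>\<^sup>2 < 1 - c" "\<epsilon>\<^sup>2 \<le> 1 - c\<^sup>2"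
    using angle_threshold[of \<theta> c "m * m"] gap c unfolding min_direction_gap_def by blast
  \<comment> \<open>The constants for long edges of anisotropic nodes, short edges of anisotropic
    nodes, and regular nodes; each is at most their sum \<open>A\<close>. The factor 2 beside
    \<open>A\<close> below comes from the derivative of the square in the second bound.\<close>
  define A1 where "A1 = (2 / \<epsilon>) ^ Suc (m * m) * max 1 K\<^sub>a"
  define A2 where "A2 = K\<^sub>a * K\<^sub>\<gamma> * max 1 (K\<^sub>a * (1 + K\<^sub>a * K\<^sub>\<gamma>))"
  define A3 where "A3 = max 1 K\<^sub>r * (8 * max 1 K\<^sub>r ^ Suc (m * m))"
  define A where "A = A1 + A2 + A3"
  have A_pos: "0 < A1" "0 < A2" "0 < A3"
    using \<epsilon>(1) assms by (auto simp: A1_def A2_def A3_def intro!: mult_pos_pos zero_less_power)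
  have main: "edge_L1_norm (pos z) q (\<lambda>x. g x * \<phi> x)
          \<le> 2 * A * (Lp_norm 1 (open_patch \<Omega> z) G
                  + kappa K\<^sub>\<gamma> \<Omega> z q * Lp_norm 1 (open_patch \<Omega> z) v) \<and>
        (in_Lp 2 (open_patch \<Omega> z) v \<and> in_Lp 2 (open_patch \<Omega> z) G \<longrightarrow>
          inverse (dist (pos z) q) * (edge_L1_norm (pos z) q (\<lambda>x. g x * \<phi> x))\<^sup>2
            \<le> 2 * A * (Lp_norm 2 (open_patch \<Omega> z) v * Lp_norm 2 (open_patch \<Omega> z) G
                    + kappa K\<^sub>\<gamma> \<Omega> z q * (Lp_norm 2 (open_patch \<Omega> z) v)\<^sup>2))"
    if tri: "polygon_triangulation \<Omega> \<T>"
      and basic: "basic_triangulation_assumptions \<alpha>\<^sub>0 K\<^sub>R m \<Omega> \<T>"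
      and types: "nodes \<Omega> \<T> = anisotropic_nodes c\<^sub>0 K\<^sub>a \<Omega> \<T> \<union> regular_nodes K\<^sub>r \<Omega> \<T>"
      and z: "z \<in> nodes \<Omega> \<T>" and \<phi>: "hat_function \<Omega> \<T> z \<phi>" and v: "W11 (open_patch \<Omega> z) v G"
      and q: "q \<in> gamma \<Omega> z" and g: "trace_on_edge (open_patch \<Omega> z) v G (pos z) q g"
    for \<T> z \<phi> v G q g
  proof -
    interpret triangulation \<Omega> \<T>
      using assms(1) tri by unfold_locales (auto simp: polygonal_domain_def)
    have angle: "max_angle_condition \<alpha>\<^sub>0 \<T>" and m: "card (elements z) \<le> m"
      using basic z by (auto simp: basic_triangulation_assumptions_def)
    let ?\<kappa> = "kappa K\<^sub>\<gamma> \<Omega> z q"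
    note size = node_size(1-3)[OF z]
    \<comment> \<open>Valid for both values of \<open>kappa\<close>, because
      \<open>h_node z \<le> 4 * H_node z\<close>; hence regular nodes need no distinction of long
      and short edges.\<close>
    have \<kappa>: "1 / (4 * H_node z) \<le> ?\<kappa>"
      using size by (auto simp: kappa_def field_simps)
    have \<kappa>0: "0 \<le> ?\<kappa>" using size by (simp add: kappa_def)
    have est: "weighted_edge (pos z) q w \<le> ennreal A * weighted_W11_norm (open_patch \<Omega> z) ?\<kappa> w Dw"
      if w: "C1_on (open_patch \<Omega> z) w Dw" for w Dw
    proof -
      consider (long) "z \<in> anisotropic_nodes c\<^sub>0 K\<^sub>a \<Omega> \<T>" "q \<notin> gamma_ring K\<^sub>\<gamma> \<Omega> z"
        | (short) "z \<in> anisotropic_nodes c\<^sub>0 K\<^sub>a \<Omega> \<T>" "q \<in> gamma_ring K\<^sub>\<gamma> \<Omega> z"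
        | (reg) "z \<in> regular_nodes K\<^sub>r \<Omega> \<T>"
        using z types by blast
      then have "\<exists>B\<le>A. weighted_edge (pos z) q w
          \<le> ennreal B * weighted_W11_norm (open_patch \<Omega> z) ?\<kappa> w Dw"
      proof cases
        case long
        then have "h_node z \<le> K\<^sub>a * h_tri T" if "T \<in> elements z" for T
          using that by (auto simp: anisotropic_nodes_def comparable_def)
        from weighted_edge_anisotropic_long[OF z m angle assms(2,3) gap \<epsilon>(1-4) c(1) \<epsilon>(5,6) c(3)
            assms(7) this q w]
        show ?thesis
          using long A_pos by (intro exI[of _ A1]) (auto simp: A_def A1_def kappa_def)
      next
        case short
        then have "h_node z \<le> K\<^sub>a * h_tri T" "H_node z \<le> K\<^sub>a * H_tri T" if "T \<in> elements z" for T
          using that by (auto simp: anisotropic_nodes_def comparable_def)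
        moreover have "dist (pos z) q \<le> K\<^sub>\<gamma> * h_node z" using short by (simp add: gamma_ring_def)
        ultimately have "weighted_edge (pos z) q w
            \<le> ennreal A2 * weighted_W11_norm (open_patch \<Omega> z) (1 / H_node z) w Dw"
          unfolding A2_def using weighted_edge_anisotropic_short[OF z assms(7,9) _ _ q _ w] by blast
        then show ?thesis
          using short A_pos by (intro exI[of _ A2]) (auto simp: A_def kappa_def)
      next
        case reg
        have "H_tri T \<le> max 1 K\<^sub>r * h_tri T" if T: "T \<in> elements z" for T
        proof -
          have "H_tri T \<le> K\<^sub>r * h_tri T"
            using reg T by (auto simp: regular_nodes_def comparable_def)
          also have "\<dots> \<le> max 1 K\<^sub>r * h_tri T"
            using h_tri_pos[OF node_elements(1)[OF z T]] by (intro mult_right_mono) auto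
          finally show ?thesis .
        qed
        from weighted_edge_regular[OF z m _ this q w \<kappa>]
        show ?thesis using A_pos by (intro exI[of _ A3]) (auto simp: A_def A3_def)
      qed
      then obtain B where B: "B \<le> A" "weighted_edge (pos z) q w
          \<le> ennreal B * weighted_W11_norm (open_patch \<Omega> z) ?\<kappa> w Dw" by blast
      show ?thesis
        by (rule order_trans[OF B(2)]) (intro mult_right_mono ennreal_leI B(1), simp)
    qed
    interpret edge_estimate "open_patch \<Omega> z" "pos z" q A ?\<kappa>
      using open_open_patch \<kappa>0 A_pos est
      by unfold_locales (auto simp: A_def weighted_W11_norm_def)
    have v1: "in_Lp 1 (open_patch \<Omega> z) v" "in_Lp 1 (open_patch \<Omega> z) G"
      using v by (auto simp: W11_def)
    note bounds = edge_L1_norm_estimate[OF v1 g hat_on_edge[OF z q \<phi>]]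
    have "0 \<le> Lp_norm 1 (open_patch \<Omega> z) G + ?\<kappa> * Lp_norm 1 (open_patch \<Omega> z) v"
      using \<kappa>0 by (intro add_nonneg_nonneg mult_nonneg_nonneg) (auto simp: Lp_norm_def)
    then have "A * (Lp_norm 1 (open_patch \<Omega> z) G + ?\<kappa> * Lp_norm 1 (open_patch \<Omega> z) v)
        \<le> 2 * A * (Lp_norm 1 (open_patch \<Omega> z) G + ?\<kappa> * Lp_norm 1 (open_patch \<Omega> z) v)"
      using A_pos by (intro mult_right_mono) (auto simp: A_def)
    with bounds show ?thesis by (meson order_trans)
  qed
  have "0 < 2 * A" using A_pos by (simp add: A_def)
  with main show ?thesis by blast
qed

end
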